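(* Let $K$ be a field of characteristic different from $2$, let $n\ge 2$, and let $G$ be a group. Let $A_1$ and $A_2$ be two $G$-graded algebras, each being the Jordan algebra $\mathrm{UJ}_n$ of upper triangular $n\times n$ matrices over $K$ equipped with some $G$-grading. Then $A_1\simeq A_2$ as $G$-graded algebras if and only if $T_G(A_1)=T_G(A_2)$.
   Context: $\mathrm{UJ}_n$ is the $K$-vector space of upper triangular $n\times n$ matrices over $K$ with the Jordan product $a\circ b=ab+ba$. A $G$-grading on an algebra $A$ is a vector space decomposition $A=\bigoplus_{g\in G}A_g$ with $A_g\circ A_h\subseteq A_{gh}$ for all $g,h\in G$. An isomorphism of $G$-graded algebras is an algebra isomorphism mapping the component of degree $g$ onto the component of degree $g$ for every $g\in G$. A graded polynomial is an element $f(x_1^{(g_1)},\dots,x_m^{(g_m)})$ of the free (nonassociative) $K$-algebra on the variables $x_i^{(g)}$, $i\in\mathbb{N}$, $g\in G$. It is a $G$-graded identity of a $G$-graded algebra $A$ if it vanishes whenever each variable $x_i^{(g)}$ is replaced by an arbitrary element of $A_g$. $T_G(A)$ denotes the set of all $G$-graded identities of $A$. *)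

theory Defs
  imports "HOL-Analysis.Analysis" "HOL-Library.Poly_Mapping"
begin

text \<open>
  Matrices of size \<open>n \<times> n\<close> are indexed by a finite linearly ordered type with \<open>n\<close> elements.
  The grading group is a type of class \<^class>\<open>group_add\<close>: it is written additively, but it is not
  assumed to be commutative.
\<close>

subsection \<open>The Jordan algebra of upper triangular matrices\<close>

type_synonym ('k, 'n) sqmat = "'k ^ 'n ^ 'n"

definition mscale :: "'k::field \<Rightarrow> 'k^'n^'m \<Rightarrow> 'k^'n^'m"
  where "mscale c a = (\<chi> i j. c * a $ i $ j)"

interpretation mat: vector_space "mscale :: 'k::field \<Rightarrow> 'k^'n^'m \<Rightarrow> 'k^'n^'m"
  by unfold_locales (simp_all add: mscale_def vec_eq_iff algebra_simps)

definition UJ :: "('k::field, 'n::{finite,linorder}) sqmat set"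
  where "UJ = {a. \<forall>i j. j < i \<longrightarrow> a $ i $ j = 0}"

definition jordan :: "('k::field, 'n::{finite,linorder}) sqmat \<Rightarrow> ('k, 'n) sqmat \<Rightarrow> ('k, 'n) sqmat"
    (infixl "\<circ>\<^sub>J" 70)
  where "a \<circ>\<^sub>J b = a ** b + b ** a"

subsection \<open>Gradings\<close>

definition direct_sum_decomposition ::
    "('k::field, 'n::finite) sqmat set \<Rightarrow> ('g \<Rightarrow> ('k, 'n) sqmat set) \<Rightarrow> bool"
  where "direct_sum_decomposition V A \<longleftrightarrow>
    (\<forall>g. mat.subspace (A g) \<and> A g \<subseteq> V) \<and>
    (\<forall>v\<in>V. \<exists>!c. (\<forall>g. c g \<in> A g) \<and> finite {g. c g \<noteq> 0} \<and> v = (\<Sum>g | c g \<noteq> 0. c g))"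

definition UJ_grading :: "('g::group_add \<Rightarrow> ('k::field, 'n::{finite,linorder}) sqmat set) \<Rightarrow> bool"
  where "UJ_grading A \<longleftrightarrow> direct_sum_decomposition UJ A \<and>
    (\<forall>g h. \<forall>a\<in>A g. \<forall>b\<in>A h. a \<circ>\<^sub>J b \<in> A (g + h))"

text \<open>Only the restriction of the map to \<^const>\<open>UJ\<close> matters.\<close>

definition UJ_automorphism ::
    "(('k::field, 'n::{finite,linorder}) sqmat \<Rightarrow> ('k, 'n) sqmat) \<Rightarrow> bool"
  where "UJ_automorphism \<phi> \<longleftrightarrow> bij_betw \<phi> UJ UJ \<and>
    (\<forall>a\<in>UJ. \<forall>b\<in>UJ. \<phi> (a + b) = \<phi> a + \<phi> b) \<and>
    (\<forall>c. \<forall>a\<in>UJ. \<phi> (mscale c a) = mscale c (\<phi> a)) \<and>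
    (\<forall>a\<in>UJ. \<forall>b\<in>UJ. \<phi> (a \<circ>\<^sub>J b) = \<phi> a \<circ>\<^sub>J \<phi> b)"

definition graded_isomorphic ::
    "('g \<Rightarrow> ('k::field, 'n::{finite,linorder}) sqmat set) \<Rightarrow> ('g \<Rightarrow> ('k, 'n) sqmat set) \<Rightarrow> bool"
  where "graded_isomorphic A B \<longleftrightarrow> (\<exists>\<phi>. UJ_automorphism \<phi> \<and> (\<forall>g. \<phi> ` A g = B g))"

subsection \<open>Graded polynomials and graded identities\<close>

text \<open>
  A variable \<open>(i, g)\<close> is \<open>x\<^sub>i\<close> of degree \<open>g\<close>. The free nonassociative algebra (without unit) has the
  free magma on the variables as a basis, so its elements are the finitely supported functions from
  nonassociative monomials to the field. The value of a polynomial under a substitution is the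
  linear extension of the unique magma homomorphism given by the substitution.
\<close>

datatype 'x nmonom = Var 'x | Mul "'x nmonom" "'x nmonom"

type_synonym ('k, 'g) graded_poly = "(nat \<times> 'g) nmonom \<Rightarrow>\<^sub>0 'k"

primrec eval_monom ::
    "('x \<Rightarrow> ('k::field, 'n::{finite,linorder}) sqmat) \<Rightarrow> 'x nmonom \<Rightarrow> ('k, 'n) sqmat"
  where
    "eval_monom \<sigma> (Var x) = \<sigma> x"
  | "eval_monom \<sigma> (Mul u v) = eval_monom \<sigma> u \<circ>\<^sub>J eval_monom \<sigma> v"

definition eval_poly ::
    "('x \<Rightarrow> ('k::field, 'n::{finite,linorder}) sqmat) \<Rightarrow> ('x nmonom \<Rightarrow>\<^sub>0 'k) \<Rightarrow> ('k, 'n) sqmat"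
  where "eval_poly \<sigma> f =
    (\<Sum>m\<in>Poly_Mapping.keys f. mscale (Poly_Mapping.lookup f m) (eval_monom \<sigma> m))"

definition graded_identities ::
    "('g \<Rightarrow> ('k::field, 'n::{finite,linorder}) sqmat set) \<Rightarrow> ('k, 'g) graded_poly set"
  where "graded_identities A =
    {f. \<forall>\<sigma>. (\<forall>i g. \<sigma> (i, g) \<in> A g) \<longrightarrow> eval_poly \<sigma> f = 0}"

end

theory Submission
  imports Defs
begin

text \<open>
  The powers \<open>J k\<close> of the radical are graded because the radical is spanned by associators. For
  homogeneous \<open>a\<close>, \<open>b\<close> whose degrees do not add up to \<open>0\<close>, the operator \<open>x \<mapsto> a \<circ> (b \<circ> x)\<close>
  has trace zero on every \<open>J k\<close>. Comparing these traces shows that modulo the radical the grading is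
  either trivial, or there is \<open>t\<close> of order \<open>2\<close> such that the degrees \<open>0\<close> and \<open>t\<close> consist of the
  diagonals which are symmetric, respectively antisymmetric, under the reflection. Lifting tripotents
  yields an isomorphic grading in which \<open>e\<^sub>i\<close>, respectively \<open>e\<^sub>i \<plusminus> e\<^sub>n\<^sub>+\<^sub>1\<^sub>-\<^sub>i\<close>, are homogeneous; it
  is determined by the degrees of its superdiagonal elements.

  The type and \<open>t\<close> are visible in the identities, since \<open>A g\<close> lies in the radical iff powers of a
  variable of degree \<open>g\<close> vanish. The degrees on the superdiagonal are detected by a polynomial
  that multiplies radical elements \<open>X\<^sub>0, X\<^sub>1, \<dots>\<close> through Jordan triple products
  \<open>{w, y\<^sub>l, X\<^sub>l}\<close>, starting with \<open>X\<^sub>0 \<circ> y\<^sub>0\<close>, and alternates in the \<open>y\<^sub>l\<close>. The vertices at which two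
  consecutive factors meet are exactly the interior ones, so alternation kills every arrangement in
  which \<open>X\<^sub>0\<close> is not an end edge; hence only the arrangement \<open>X\<^sub>0 X\<^sub>1 \<dots>\<close> and its reverse survive.
\<close>

subsection \<open>Matrices indexed by natural numbers\<close>

text \<open>In the mirrored type the diagonal idempotents are not homogeneous in general, only sums
  and differences over mirror pairs are. Lifting is therefore done for tripotents, elements with
  \<open>a^3 = a\<close>, and the idempotents \<open>(a^2 + a)/2\<close> and
  \<open>(a^2 - a)/2\<close> are split off afterwards. Degrees are known for Jordan products only,
  so squares, products of commuting elements and sandwiches \<open>S u S\<close> are first rewritten
  through the Jordan product.

  The group may be infinite and noncommutative, the field finite or of positive characteristic.
  Hence neither a dual group action nor a generic substitution is at hand; traces and alternating
  sums replace them, and 2 is the only integer that is inverted.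

  The detecting polynomial cannot tell the superdiagonal from its reversal. This is harmless:
  transposition along the antidiagonal is a Jordan automorphism which reverses the superdiagonal,
  and in the mirrored type an edge and its mirror image always occur together in a homogeneous
  element.\<close>

definition ix :: "nat \<Rightarrow> 'n::{finite,linorder}" where
  "ix i = sorted_list_of_set UNIV ! i"

definition rk :: "'n::{finite,linorder} \<Rightarrow> nat" where
  "rk = the_inv_into {..<CARD('n)} ix"

text \<open>Superdiagonals call for index arithmetic such as \<open>i + k\<close>, which the index
  type does not offer, so rows and columns are numbered from 0 in increasing order. Outside
  \<open>{..<CARD('n)}\<close> the value of \<open>ix\<close> is unspecified, hence the range
  hypotheses below; \<open>E i j\<close> with an index out of range is the zero matrix.\<close>

definition ent :: "('k::field, 'n::{finite,linorder}) sqmat \<Rightarrow> nat \<Rightarrow> nat \<Rightarrow> 'k" where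
  "ent a i j = a $ ix i $ ix j"

definition mk :: "(nat \<Rightarrow> nat \<Rightarrow> 'k) \<Rightarrow> ('k::field, 'n::{finite,linorder}) sqmat" where
  "mk f = (\<chi> i j. f (rk i) (rk j))"

definition E :: "nat \<Rightarrow> nat \<Rightarrow> ('k::field, 'n::{finite,linorder}) sqmat" where
  "E i j = mk (\<lambda>k l. if k = i \<and> l = j then 1 else 0)"

lemma bij_ix: "bij_betw (ix :: nat \<Rightarrow> 'n::{finite,linorder}) {..<CARD('n)} UNIV"
proof -
  have "bij_betw (\<lambda>i. sorted_list_of_set (UNIV :: 'n set) ! i) {..<CARD('n)} UNIV"
    by (rule bij_betw_nth) auto
  then show ?thesis by (simp add: ix_def[abs_def])
qed

lemma ix_less: "i < CARD('n) \<Longrightarrow> j < CARD('n) \<Longrightarrow> (ix i :: 'n::{finite,linorder}) < ix j \<longleftrightarrow> i < j"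
proof -
  assume *: "i < CARD('n)" "j < CARD('n)"
  have sd: "sorted_wrt (<) (sorted_list_of_set (UNIV :: 'n set))" by simp
  have m: "a < b \<Longrightarrow> b < CARD('n) \<Longrightarrow> (ix a :: 'n) < ix b" for a b
    using sorted_wrt_nth_less[OF sd] by (simp add: ix_def)
  show ?thesis
    by (metis * less_irrefl m nat_neq_iff order_less_asym)
qed

lemma rk_ix [simp]: "i < CARD('n) \<Longrightarrow> rk (ix i :: 'n::{finite,linorder}) = i"
  unfolding rk_def using bij_ix[where 'n='n] by (simp add: bij_betw_def the_inv_into_f_f)

lemma ix_rk [simp]: "ix (rk k) = (k :: 'n::{finite,linorder})"
  unfolding rk_def using bij_ix[where 'n='n] by (simp add: bij_betw_def f_the_inv_into_f)

lemma rk_less [simp]: "rk (k :: 'n::{finite,linorder}) < CARD('n)"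
proof -
  obtain i where "i < CARD('n)" "k = ix i" using bij_ix[where 'n='n] by (auto simp: bij_betw_def)
  then show ?thesis by simp
qed

lemma sum_ix: "(\<Sum>k\<in>(UNIV :: 'n::{finite,linorder} set). f k) = (\<Sum>k<CARD('n). f (ix k))"
  using sum.reindex_bij_betw[OF bij_ix[where 'n='n], of f] by simp

lemma mat_eqI:
  fixes a b :: "('k::field, 'n::{finite,linorder}) sqmat"
  assumes "\<And>i j. i < CARD('n) \<Longrightarrow> j < CARD('n) \<Longrightarrow> ent a i j = ent b i j"
  shows "a = b"
proof -
  have "a $ i $ j = b $ i $ j" for i j
    using assms[of "rk i" "rk j"] by (simp add: ent_def)
  then show ?thesis by (simp add: vec_eq_iff)
qed

lemma ent_mult: "ent (a ** b) i j = (\<Sum>k<CARD('n). ent a i k * ent (b :: ('k::field, 'n::{finite,linorder}) sqmat) k j)"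
  by (simp add: ent_def matrix_matrix_mult_def sum_ix)

lemma ent_add [simp]: "ent (a + b) i j = ent a i j + ent b i j" by (simp add: ent_def)
lemma ent_diff [simp]: "ent (a - b) i j = ent a i j - ent b i j" by (simp add: ent_def)
lemma ent_minus [simp]: "ent (- a) i j = - ent a i j" by (simp add: ent_def)
lemma ent_zero [simp]: "ent 0 i j = 0" by (simp add: ent_def)
lemma ent_mscale [simp]: "ent (mscale c a) i j = c * ent a i j" by (simp add: ent_def mscale_def)
lemma ent_sum [simp]: "ent (\<Sum>x\<in>X. f x) i j = (\<Sum>x\<in>X. ent (f x) i j)"
  by (induction X rule: infinite_finite_induct) auto

lemma ent_mk [simp]:
  "i < CARD('n) \<Longrightarrow> j < CARD('n) \<Longrightarrow> ent (mk f :: ('k::field, 'n::{finite,linorder}) sqmat) i j = f i j"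
  by (simp add: ent_def mk_def)

lemma ent_E [simp]:
  "i < CARD('n) \<Longrightarrow> j < CARD('n) \<Longrightarrow>
    ent (E k l :: ('k::field, 'n::{finite,linorder}) sqmat) i j = (if i = k \<and> j = l then 1 else 0)"
  by (simp add: E_def)

lemma ent_one [simp]:
  "i < CARD('n) \<Longrightarrow> j < CARD('n) \<Longrightarrow>
    ent (mat 1 :: ('k::field, 'n::{finite,linorder}) sqmat) i j = (if i = j then 1 else 0)"
  by (auto simp: ent_def mat_def) (metis rk_ix)

lemma UJ_iff: "a \<in> UJ \<longleftrightarrow> (\<forall>i<CARD('n). \<forall>j<i. ent (a :: ('k::field, 'n::{finite,linorder}) sqmat) i j = 0)"
proof
  assume "a \<in> UJ"
  then show "\<forall>i<CARD('n). \<forall>j<i. ent a i j = 0"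
    by (auto simp: UJ_def ent_def ix_less)
next
  assume *: "\<forall>i<CARD('n). \<forall>j<i. ent a i j = 0"
  have "a $ i $ j = 0" if "j < i" for i j
  proof -
    have "rk j < rk i" using ix_less[of "rk j" "rk i", where 'n='n] that by simp
    then show ?thesis using *[rule_format, of "rk i" "rk j"] by (simp add: ent_def)
  qed
  then show "a \<in> UJ" by (simp add: UJ_def)
qed

lemma ent_lower: "a \<in> UJ \<Longrightarrow> i < CARD('n) \<Longrightarrow> j < i \<Longrightarrow> ent (a :: ('k::field, 'n::{finite,linorder}) sqmat) i j = 0"
  by (simp add: UJ_iff)

text \<open>The \<open>k\<close>-th power of the Jacobson radical; \<open>J 0\<close> is the whole algebra.\<close>

definition J :: "nat \<Rightarrow> ('k::field, 'n::{finite,linorder}) sqmat set" where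
  "J k = {a. \<forall>i<CARD('n). \<forall>j<CARD('n). j < i + k \<longrightarrow> ent a i j = 0}"

lemma J_0: "J 0 = (UJ :: ('k::field, 'n::{finite,linorder}) sqmat set)"
  by (auto simp: J_def UJ_iff)

lemma J_mono: "k \<le> l \<Longrightarrow> J l \<subseteq> (J k :: ('k::field, 'n::{finite,linorder}) sqmat set)"
  by (auto simp: J_def)

lemma J_UJ: "a \<in> J k \<Longrightarrow> a \<in> UJ"
  using J_mono[of 0 k] by (auto simp: J_0)

lemma J_top: "CARD('n) \<le> k \<Longrightarrow> a \<in> J k \<Longrightarrow> (a :: ('k::field, 'n::{finite,linorder}) sqmat) = 0"
  by (rule mat_eqI) (simp add: J_def)

lemma J_zero [simp]: "0 \<in> J k" by (simp add: J_def)
lemma J_add: "a \<in> J k \<Longrightarrow> b \<in> J k \<Longrightarrow> a + b \<in> J k" by (simp add: J_def)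
lemma J_diff: "a \<in> J k \<Longrightarrow> b \<in> J k \<Longrightarrow> a - b \<in> J k" by (simp add: J_def)
lemma J_mscale: "a \<in> J k \<Longrightarrow> mscale c a \<in> J k" by (simp add: J_def)
lemma J_sum: "(\<And>x. x \<in> X \<Longrightarrow> f x \<in> J k) \<Longrightarrow> sum f X \<in> J k"
  by (simp add: J_def)

lemma J_subspace: "mat.subspace (J k)"
  by (simp add: mat.subspace_def J_add J_mscale)

lemma J_1_iff:
  "(a :: ('k::field, 'n::{finite,linorder}) sqmat) \<in> J 1 \<longleftrightarrow> a \<in> UJ \<and> (\<forall>i<CARD('n). ent a i i = 0)"
  by (auto simp: J_def UJ_iff less_Suc_eq)

lemma ent_mult_UJ:
  fixes a b :: "('k::field, 'n::{finite,linorder}) sqmat"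
  assumes "a \<in> UJ" "b \<in> UJ" "i < CARD('n)" "j < CARD('n)"
  shows "ent (a ** b) i j = (\<Sum>k\<in>{i..j}. ent a i k * ent b k j)"
  unfolding ent_mult
  by (rule sum.mono_neutral_right) (use assms in \<open>auto simp: ent_lower not_le\<close>)

lemma J_mult:
  fixes a b :: "('k::field, 'n::{finite,linorder}) sqmat"
  assumes "a \<in> J k" "b \<in> J l"
  shows "a ** b \<in> J (k + l)"
proof -
  have "ent (a ** b) i j = 0" if "i < CARD('n)" "j < CARD('n)" "j < i + (k + l)" for i j
    unfolding ent_mult
  proof (rule sum.neutral, rule ballI)
    fix x assume "x \<in> {..<CARD('n)}"
    then show "ent a i x * ent b x j = 0"
      using assms that by (cases "x < i + k") (auto simp: J_def)
  qed
  then show ?thesis by (simp add: J_def)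
qed

text \<open>A summation index below \<open>i + k\<close> kills the left factor and one above it
  kills the right factor. On its first possible diagonal a product is thus computed in the
  associated graded algebra of the radical filtration.\<close>

lemma J_mult_leading:
  fixes a b :: "('k::field, 'n::{finite,linorder}) sqmat"
  assumes "a \<in> J k" "b \<in> J l" "i + k + l < CARD('n)"
  shows "ent (a ** b) i (i + k + l) = ent a i (i + k) * ent b (i + k) (i + k + l)"
proof -
  have "ent (a ** b) i (i + k + l) = (\<Sum>x\<in>{i + k}. ent a i x * ent b x (i + k + l))"
    unfolding ent_mult
  proof (rule sum.mono_neutral_right)
    show "\<forall>x\<in>{..<CARD('n)} - {i + k}. ent a i x * ent b x (i + k + l) = 0"
    proof
      fix x assume "x \<in> {..<CARD('n)} - {i + k}"
      then show "ent a i x * ent b x (i + k + l) = 0"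
        using assms by (cases "x < i + k") (auto simp: J_def)
    qed
  qed (use assms in auto)
  then show ?thesis by simp
qed

lemma UJ_mult: "a \<in> UJ \<Longrightarrow> b \<in> UJ \<Longrightarrow> a ** b \<in> UJ"
  using J_mult[of a 0 b 0] by (simp add: J_0)

lemma diag_mult:
  fixes a b :: "('k::field, 'n::{finite,linorder}) sqmat"
  assumes "a \<in> UJ" "b \<in> UJ" "i < CARD('n)"
  shows "ent (a ** b) i i = ent a i i * ent b i i"
  using J_mult_leading[of a 0 b 0 i] assms by (simp add: J_0)

lemma UJ_0 [simp]: "0 \<in> UJ" using J_zero[of 0] by (simp add: J_0)
lemma UJ_add: "a \<in> UJ \<Longrightarrow> b \<in> UJ \<Longrightarrow> a + b \<in> UJ" using J_add[of a 0 b] by (simp add: J_0)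
lemma UJ_diff: "a \<in> UJ \<Longrightarrow> b \<in> UJ \<Longrightarrow> a - b \<in> UJ" using J_diff[of a 0 b] by (simp add: J_0)
lemma UJ_mscale: "a \<in> UJ \<Longrightarrow> mscale c a \<in> UJ" using J_mscale[of a 0] by (simp add: J_0)
lemma UJ_sum: "(\<And>x. x \<in> X \<Longrightarrow> f x \<in> UJ) \<Longrightarrow> sum f X \<in> UJ" using J_sum[of X f 0] by (simp add: J_0)
lemma UJ_subspace: "mat.subspace UJ" using J_subspace[of 0] by (simp add: J_0)
lemma UJ_one [simp]: "mat 1 \<in> UJ" by (auto simp: UJ_iff)
lemma UJ_E [simp]: "i \<le> j \<Longrightarrow> E i j \<in> UJ" by (auto simp: UJ_iff)

lemma J_E: "i + k \<le> j \<Longrightarrow> E i j \<in> J k" by (auto simp: J_def)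

lemma mult_distribs:
  fixes a b c :: "('k::field, 'n::{finite,linorder}) sqmat"
  shows "a ** (b + c) = a ** b + a ** c" "(a + b) ** c = a ** c + b ** c"
    "a ** (b - c) = a ** b - a ** c" "(a - b) ** c = a ** c - b ** c"
    "a ** (- b) = - (a ** b)" "(- a) ** b = - (a ** b)"
    "mscale k a ** b = mscale k (a ** b)" "a ** mscale k b = mscale k (a ** b)"
    "a ** (0 :: ('k, 'n) sqmat) = 0" "(0 :: ('k, 'n) sqmat) ** a = 0"
  by (rule mat_eqI; simp add: ent_mult algebra_simps sum.distrib sum_subtractf sum_negf sum_distrib_left)+

lemma mult_sum_left:
  fixes f :: "'x \<Rightarrow> ('k::field, 'n::{finite,linorder}) sqmat" and b :: "('k, 'n) sqmat"
  shows "(\<Sum>x\<in>X. f x) ** b = (\<Sum>x\<in>X. f x ** b)"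
  by (induction X rule: infinite_finite_induct) (auto simp: mult_distribs)

lemma mult_sum_right:
  fixes f :: "'x \<Rightarrow> ('k::field, 'n::{finite,linorder}) sqmat" and b :: "('k, 'n) sqmat"
  shows "b ** (\<Sum>x\<in>X. f x) = (\<Sum>x\<in>X. b ** f x)"
  by (induction X rule: infinite_finite_induct) (auto simp: mult_distribs)

lemma ent_E_mult:
  fixes a :: "('k::field, 'n::{finite,linorder}) sqmat"
  assumes "k < CARD('n)" "l < CARD('n)" "i < CARD('n)" "j < CARD('n)"
  shows "ent (E k l ** a) i j = (if i = k then ent a l j else 0)"
    "ent (a ** E k l) i j = (if j = l then ent a i k else 0)"
proof -
  have "ent (E k l ** a) i j = (\<Sum>x<CARD('n). if x = l then (if i = k then ent a l j else 0) else 0)"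
    unfolding ent_mult by (rule sum.cong) (use assms in auto)
  then show "ent (E k l ** a) i j = (if i = k then ent a l j else 0)"
    using assms by simp
  have "ent (a ** E k l) i j = (\<Sum>x<CARD('n). if x = k then (if j = l then ent a i k else 0) else 0)"
    unfolding ent_mult by (rule sum.cong) (use assms in auto)
  then show "ent (a ** E k l) i j = (if j = l then ent a i k else 0)"
    using assms by simp
qed

lemma E_mult:
  assumes "i < CARD('n)" "j < CARD('n)" "k < CARD('n)" "l < CARD('n)"
  shows "E i j ** (E k l :: ('k::field, 'n::{finite,linorder}) sqmat) = (if j = k then E i l else 0)"
  by (rule mat_eqI) (use assms in \<open>auto simp: ent_E_mult\<close>)

lemma E_expand:
  fixes a :: "('k::field, 'n::{finite,linorder}) sqmat"
  assumes "a \<in> UJ"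
  shows "a = (\<Sum>(i, j)\<in>{(i, j). i \<le> j \<and> j < CARD('n)}. mscale (ent a i j) (E i j))"
proof -
  let ?X = "{(i, j). i \<le> j \<and> j < CARD('n)}"
  have fin: "finite ?X"
    by (rule finite_subset[of _ "{..<CARD('n)} \<times> {..<CARD('n)}"]) auto
  show ?thesis
  proof (rule mat_eqI)
    fix k l assume kl: "k < CARD('n)" "l < CARD('n)"
    have "ent (\<Sum>(i, j)\<in>?X. mscale (ent a i j) (E i j) :: ('k, 'n) sqmat) k l
        = (\<Sum>p\<in>?X. if p = (k, l) then ent a k l else 0)"
      unfolding ent_sum by (rule sum.cong) (use kl in \<open>auto split: if_splits\<close>)
    also have "\<dots> = ent a k l"
      using fin kl assms by (auto simp: ent_lower not_le)
    finally show "ent a k l = ent (\<Sum>(i, j)\<in>?X. mscale (ent a i j) (E i j) :: ('k, 'n) sqmat) k l" by (rule sym)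
  qed
qed

lemma mat_E_sum: "mat 1 = (\<Sum>i<CARD('n). E i i :: ('k::field, 'n::{finite,linorder}) sqmat)"
  by (rule mat_eqI) (auto intro!: sum.neutral)

section \<open>The Jordan product and the radical filtration\<close>

lemma jordan_distribs:
  fixes a b c :: "('k::field, 'n::{finite,linorder}) sqmat"
  shows "a \<circ>\<^sub>J (b + c) = a \<circ>\<^sub>J b + a \<circ>\<^sub>J c" "(a + b) \<circ>\<^sub>J c = a \<circ>\<^sub>J c + b \<circ>\<^sub>J c"
    "a \<circ>\<^sub>J (b - c) = a \<circ>\<^sub>J b - a \<circ>\<^sub>J c" "(a - b) \<circ>\<^sub>J c = a \<circ>\<^sub>J c - b \<circ>\<^sub>J c"
    "mscale k a \<circ>\<^sub>J b = mscale k (a \<circ>\<^sub>J b)" "a \<circ>\<^sub>J mscale k b = mscale k (a \<circ>\<^sub>J b)"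
    "a \<circ>\<^sub>J 0 = 0" "0 \<circ>\<^sub>J a = 0"
  by (simp_all add: jordan_def mult_distribs mat.scale_right_distrib)

lemma jordan_sum_left: "(\<Sum>x\<in>X. f x) \<circ>\<^sub>J b = (\<Sum>x\<in>X. f x \<circ>\<^sub>J b)"
  by (induction X rule: infinite_finite_induct) (auto simp: jordan_distribs)

lemma jordan_sum_right: "b \<circ>\<^sub>J (\<Sum>x\<in>X. f x) = (\<Sum>x\<in>X. b \<circ>\<^sub>J f x)"
  by (induction X rule: infinite_finite_induct) (auto simp: jordan_distribs)

lemma J_jordan: "a \<in> J k \<Longrightarrow> b \<in> J l \<Longrightarrow> a \<circ>\<^sub>J b \<in> J (k + l)"
  using J_mult[of a k b l] J_mult[of b l a k] by (simp add: jordan_def J_add add.commute)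

lemma UJ_jordan: "a \<in> UJ \<Longrightarrow> b \<in> UJ \<Longrightarrow> a \<circ>\<^sub>J b \<in> UJ"
  using J_jordan[of a 0 b 0] by (simp add: J_0)

lemma diag_jordan:
  fixes a b :: "('k::field, 'n::{finite,linorder}) sqmat"
  assumes "a \<in> UJ" "b \<in> UJ" "i < CARD('n)"
  shows "ent (a \<circ>\<^sub>J b) i i = 2 * ent a i i * ent b i i"
  using assms by (simp add: jordan_def diag_mult)

lemma one_jordan: "mat 1 \<circ>\<^sub>J a = mscale 2 a" "a \<circ>\<^sub>J mat 1 = mscale 2 a"
  by (simp_all add: jordan_def vec_eq_iff mscale_def)

subsection \<open>Homogeneous components\<close>

text \<open>The decomposition is known to exist and to be unique for \<open>v\<close> in
  \<open>UJ\<close> only; for other matrices the value is arbitrary, so \<open>pr A g\<close> is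
  linear on \<open>UJ\<close> and not on the whole matrix space.\<close>

definition pr :: "('g \<Rightarrow> ('k::field, 'n::{finite,linorder}) sqmat set) \<Rightarrow> 'g \<Rightarrow> ('k, 'n) sqmat \<Rightarrow> ('k, 'n) sqmat" where
  "pr A g v = (THE c. (\<forall>g. c g \<in> A g) \<and> finite {g. c g \<noteq> 0} \<and> v = (\<Sum>g | c g \<noteq> 0. c g)) g"

locale graded_UJ =
  fixes A :: "'g::group_add \<Rightarrow> ('k::field, 'n::{finite,linorder}) sqmat set"
  assumes grading: "UJ_grading A"
    and two: "(2 :: 'k) \<noteq> 0"
    and card2: "2 \<le> CARD('n)"
begin

lemma sub: "mat.subspace (A g)"
  using grading by (simp add: UJ_grading_def direct_sum_decomposition_def)

lemma A_UJ: "a \<in> A g \<Longrightarrow> a \<in> UJ"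
  using grading by (auto simp: UJ_grading_def direct_sum_decomposition_def)

lemma A_jordan: "a \<in> A g \<Longrightarrow> b \<in> A h \<Longrightarrow> a \<circ>\<^sub>J b \<in> A (g + h)"
  using grading by (auto simp: UJ_grading_def)

lemma A_zero [simp]: "0 \<in> A g" by (simp add: sub mat.subspace_0)
lemma A_add: "a \<in> A g \<Longrightarrow> b \<in> A g \<Longrightarrow> a + b \<in> A g" by (simp add: sub mat.subspace_add)
lemma A_diff: "a \<in> A g \<Longrightarrow> b \<in> A g \<Longrightarrow> a - b \<in> A g" by (simp add: sub mat.subspace_diff)
lemma A_mscale: "a \<in> A g \<Longrightarrow> mscale c a \<in> A g" by (simp add: sub mat.subspace_scale)
lemma A_sum: "(\<And>x. x \<in> X \<Longrightarrow> f x \<in> A g) \<Longrightarrow> sum f X \<in> A g"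
  by (rule mat.subspace_sum[OF sub])

lemma pr_ex1:
  "v \<in> UJ \<Longrightarrow> \<exists>!c. (\<forall>g. c g \<in> A g) \<and> finite {g. c g \<noteq> 0} \<and> v = (\<Sum>g | c g \<noteq> 0. c g)"
  using grading by (simp add: UJ_grading_def direct_sum_decomposition_def)

lemma pr_spec:
  assumes "v \<in> UJ"
  shows "pr A g v \<in> A g" "finite {g. pr A g v \<noteq> 0}" "v = (\<Sum>g | pr A g v \<noteq> 0. pr A g v)"
  using theI'[OF pr_ex1[OF assms]] by (simp_all add: pr_def[abs_def])

lemma pr_UJ: "v \<in> UJ \<Longrightarrow> pr A g v \<in> UJ"
  using A_UJ pr_spec(1) by blast

lemma pr_unique:
  assumes "finite S" "\<And>g. g \<in> S \<Longrightarrow> c g \<in> A g" "v = (\<Sum>g\<in>S. c g)"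
  shows "pr A g v = (if g \<in> S then c g else 0)"
proof -
  let ?c = "\<lambda>g. if g \<in> S then c g else 0"
  have v: "v \<in> UJ" unfolding assms(3) by (rule UJ_sum) (rule A_UJ[OF assms(2)])
  have "(\<Sum>g | ?c g \<noteq> 0. ?c g) = (\<Sum>g\<in>S. ?c g)"
    using assms(1) by (intro sum.mono_neutral_left) auto
  then have *: "(\<forall>g. ?c g \<in> A g) \<and> finite {g. ?c g \<noteq> 0} \<and> v = (\<Sum>g | ?c g \<noteq> 0. ?c g)"
    using assms by (auto intro: finite_subset[OF _ assms(1)])
  have "(THE c. (\<forall>g. c g \<in> A g) \<and> finite {g. c g \<noteq> 0} \<and> v = (\<Sum>g | c g \<noteq> 0. c g)) = ?c"
    by (rule the1_equality[OF pr_ex1[OF v]]) (rule *)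
  then show ?thesis by (simp add: pr_def)
qed

lemma pr_homogeneous: "a \<in> A g \<Longrightarrow> pr A h a = (if h = g then a else 0)"
  using pr_unique[of "{g}" "\<lambda>_. a" a h] by auto

lemma pr_sum_superset:
  assumes "v \<in> UJ" "finite S" "\<And>g. g \<notin> S \<Longrightarrow> pr A g v = 0"
  shows "v = (\<Sum>g\<in>S. pr A g v)"
proof -
  have "(\<Sum>g | pr A g v \<noteq> 0. pr A g v) = (\<Sum>g\<in>S. pr A g v)"
    by (rule sum.mono_neutral_left) (use assms in auto)
  then show ?thesis using pr_spec(3)[OF assms(1)] by simp
qed

lemma pr_add:
  assumes "v \<in> UJ" "w \<in> UJ"
  shows "pr A g (v + w) = pr A g v + pr A g w"
proof -
  let ?S = "{g. pr A g v \<noteq> 0} \<union> {g. pr A g w \<noteq> 0}"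
  have "v + w = (\<Sum>g\<in>?S. pr A g v + pr A g w)"
    unfolding sum.distrib
    by (intro arg_cong2[of _ _ _ _ plus] pr_sum_superset) (use assms pr_spec(2) in auto)
  then have "pr A g (v + w) = (if g \<in> ?S then pr A g v + pr A g w else 0)"
    using assms pr_spec by (intro pr_unique) (auto intro: A_add)
  then show ?thesis by auto
qed

lemma pr_mscale:
  assumes "v \<in> UJ"
  shows "pr A g (mscale c v) = mscale c (pr A g v)"
proof -
  let ?S = "{g. pr A g v \<noteq> 0}"
  have "mscale c v = (\<Sum>g\<in>?S. mscale c (pr A g v))"
    using pr_spec(3)[OF assms] by (metis mat.scale_sum_right)
  then have "pr A g (mscale c v) = (if g \<in> ?S then mscale c (pr A g v) else 0)"
    using assms pr_spec by (intro pr_unique) (auto intro: A_mscale)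
  then show ?thesis by auto
qed

lemma pr_diff: "v \<in> UJ \<Longrightarrow> w \<in> UJ \<Longrightarrow> pr A g (v - w) = pr A g v - pr A g w"
  using pr_add[of v "mscale (- 1) w" g] pr_mscale[of w g "- 1"] UJ_mscale[of w "- 1"] by simp

lemma pr_zero [simp]: "pr A g 0 = 0"
  using pr_homogeneous[OF A_zero, of g g] by simp

lemma pr_sum: "(\<And>x. x \<in> X \<Longrightarrow> f x \<in> UJ) \<Longrightarrow> pr A g (sum f X) = (\<Sum>x\<in>X. pr A g (f x))"
  by (induction X rule: infinite_finite_induct) (auto simp: pr_add UJ_sum)

text \<open>One finite set that contains the degrees of the components of every element at once, so
  that sums over the possibly infinite group become sums over a fixed finite set.\<close>

definition degrees :: "'g set" where
  "degrees = (\<Union>i<CARD('n). \<Union>j\<in>{i..<CARD('n)}. {g. pr A g (E i j) \<noteq> 0})"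

lemma finite_degrees: "finite degrees"
  unfolding degrees_def by (auto intro!: pr_spec(2))

lemma pr_expand:
  assumes "v \<in> UJ"
  shows "pr A g v = (\<Sum>(i, j)\<in>{(i, j). i \<le> j \<and> j < CARD('n)}. mscale (ent v i j) (pr A g (E i j)))"
proof -
  have "pr A g v = pr A g (\<Sum>(i, j)\<in>{(i, j). i \<le> j \<and> j < CARD('n)}. mscale (ent v i j) (E i j))"
    by (rule arg_cong[OF E_expand[OF assms]])
  also have "\<dots> = (\<Sum>(i, j)\<in>{(i, j). i \<le> j \<and> j < CARD('n)}. mscale (ent v i j) (pr A g (E i j)))"
    by (subst pr_sum) (auto intro!: UJ_mscale sum.cong simp: pr_mscale)
  finally show ?thesis .
qed

lemma pr_not_degree:
  assumes "v \<in> UJ" "g \<notin> degrees"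
  shows "pr A g v = 0"
  unfolding pr_expand[OF assms(1)]
  by (rule sum.neutral) (use assms in \<open>auto simp: degrees_def\<close>)

lemma pr_decompose: "v \<in> UJ \<Longrightarrow> (\<Sum>g\<in>degrees. pr A g v) = v"
  by (rule pr_sum_superset[symmetric]) (auto intro: finite_degrees pr_not_degree)

text \<open>Adding \<open>h\<close> on the right is injective on degrees, so distinct components of
  \<open>v\<close> cannot mix when multiplied by \<open>a\<close>.\<close>

lemma pr_jordan_right:
  assumes "v \<in> UJ" "a \<in> A h"
  shows "pr A (g + h) (v \<circ>\<^sub>J a) = pr A g v \<circ>\<^sub>J a"
proof -
  have "pr A (g + h) (v \<circ>\<^sub>J a) = pr A (g + h) (\<Sum>g\<in>degrees. pr A g v \<circ>\<^sub>J a)"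
    by (simp only: pr_decompose assms flip: jordan_sum_left)
  also have "\<dots> = (\<Sum>x\<in>degrees. pr A (g + h) (pr A x v \<circ>\<^sub>J a))"
    using assms by (intro pr_sum UJ_jordan pr_UJ) (auto intro: A_UJ)
  also have "\<dots> = (\<Sum>x\<in>degrees. if x = g then pr A g v \<circ>\<^sub>J a else 0)"
    by (rule sum.cong) (auto simp: pr_homogeneous[OF A_jordan[OF pr_spec(1)[OF assms(1)] assms(2)]])
  also have "\<dots> = pr A g v \<circ>\<^sub>J a"
    using finite_degrees pr_not_degree[OF assms(1)] by (auto simp: jordan_distribs)
  finally show ?thesis .
qed

text \<open>Comparing components in the product of the identity with a homogeneous \<open>a\<close>
  shows that the degree 0 part of the identity already acts as multiplication by 2 on every
  \<open>a\<close>. Applied to the components of the identity itself, this makes the two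
  equal.\<close>

lemma one_A0: "mat 1 \<in> A 0"
proof -
  let ?I = "mat 1 :: ('k, 'n) sqmat" and ?u = "pr A 0 (mat 1)"
  have u: "?u \<in> A 0" by (simp add: pr_spec)
  have *: "?u \<circ>\<^sub>J a = mscale 2 a" if "a \<in> A g" for a g
  proof -
    have "?u \<circ>\<^sub>J a = pr A (0 + g) (?I \<circ>\<^sub>J a)"
      using pr_jordan_right[of ?I a g 0] that by simp
    also have "\<dots> = mscale 2 a"
      using pr_homogeneous[OF A_mscale[OF that], of g 2] by (simp add: one_jordan)
    finally show ?thesis .
  qed
  have "mscale 2 ?u = ?u \<circ>\<^sub>J ?I" by (simp add: one_jordan)
  also have "\<dots> = (\<Sum>g\<in>degrees. ?u \<circ>\<^sub>J pr A g ?I)"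
    by (simp only: pr_decompose[OF UJ_one] flip: jordan_sum_right)
  also have "\<dots> = (\<Sum>g\<in>degrees. mscale 2 (pr A g ?I))"
    by (rule sum.cong) (auto intro!: * pr_spec)
  also have "\<dots> = mscale 2 ?I"
    by (simp only: pr_decompose[OF UJ_one] flip: mat.scale_sum_right)
  finally have "?u = ?I" using two by simp
  then show ?thesis using u by simp
qed

lemma pr_jordan_expand:
  assumes "x \<in> UJ" "y \<in> UJ"
  shows "pr A s (x \<circ>\<^sub>J y) = (\<Sum>g\<in>degrees. \<Sum>h\<in>degrees. pr A s (pr A g x \<circ>\<^sub>J pr A h y))"
proof -
  have "x \<circ>\<^sub>J y = (\<Sum>g\<in>degrees. \<Sum>h\<in>degrees. pr A g x \<circ>\<^sub>J pr A h y)"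
    by (simp only: pr_decompose assms flip: jordan_sum_left jordan_sum_right)
  then show ?thesis
    using assms by (simp add: pr_sum UJ_sum UJ_jordan pr_UJ)
qed

section \<open>The radical powers are graded\<close>

lemma pr_homogeneous_in:
  assumes "a \<in> A g" "a \<in> V" "0 \<in> V"
  shows "pr A h a \<in> V"
  using assms by (simp add: pr_homogeneous)

lemma associator_J1:
  assumes "a \<in> UJ" "b \<in> UJ" "c \<in> UJ"
  shows "(a \<circ>\<^sub>J b) \<circ>\<^sub>J c - a \<circ>\<^sub>J (b \<circ>\<^sub>J c) \<in> (J 1 :: ('k, 'n) sqmat set)"
  using assms by (subst J_1_iff) (auto simp: UJ_diff UJ_jordan diag_jordan)

text \<open>Both terms of an associator of homogeneous elements have degree \<open>g + h + k\<close>
  by associativity of the group, so it is homogeneous and each of its components is the associator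
  itself or 0. The general case is trilinear expansion.\<close>

lemma pr_associator_J1:
  assumes "a \<in> UJ" "b \<in> UJ" "c \<in> UJ"
  shows "pr A s ((a \<circ>\<^sub>J b) \<circ>\<^sub>J c - a \<circ>\<^sub>J (b \<circ>\<^sub>J c)) \<in> J 1"
proof -
  let ?as = "\<lambda>a b c :: ('k, 'n) sqmat. (a \<circ>\<^sub>J b) \<circ>\<^sub>J c - a \<circ>\<^sub>J (b \<circ>\<^sub>J c)"
  let ?p = "\<lambda>g h k. ?as (pr A g a) (pr A h b) (pr A k c)"
  have as1: "?as (sum f X) y z = (\<Sum>x\<in>X. ?as (f x) y z)"
    and as2: "?as y (sum f X) z = (\<Sum>x\<in>X. ?as y (f x) z)"
    and as3: "?as y z (sum f X) = (\<Sum>x\<in>X. ?as y z (f x))"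
    for f :: "'g \<Rightarrow> ('k, 'n) sqmat" and X y z
    by (simp_all only: jordan_sum_left jordan_sum_right sum_subtractf)
  have "?as a b c = (\<Sum>k\<in>degrees. ?as a b (pr A k c))"
    using as3[of a b "\<lambda>k. pr A k c" degrees] pr_decompose[OF assms(3)] by simp
  also have "\<dots> = (\<Sum>k\<in>degrees. \<Sum>h\<in>degrees. ?as a (pr A h b) (pr A k c))"
    using as2[of a "\<lambda>k. pr A k b" degrees] pr_decompose[OF assms(2)] by simp
  also have "\<dots> = (\<Sum>k\<in>degrees. \<Sum>h\<in>degrees. \<Sum>g\<in>degrees. ?p g h k)"
    using as1[of "\<lambda>k. pr A k a" degrees] pr_decompose[OF assms(1)] by simp
  finally have e: "?as a b c = (\<Sum>k\<in>degrees. \<Sum>h\<in>degrees. \<Sum>g\<in>degrees. ?p g h k)" .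
  have hom: "?p g h k \<in> A ((g + h) + k)" for g h k
    using A_diff[OF A_jordan[OF A_jordan] A_jordan[OF _ A_jordan, unfolded add.assoc[symmetric]]]
      pr_spec(1) assms by blast
  have "pr A s (?p g h k) \<in> J 1" for g h k
    by (rule pr_homogeneous_in[OF hom]) (intro associator_J1 pr_UJ assms J_zero)+
  then have "(\<Sum>k\<in>degrees. \<Sum>h\<in>degrees. \<Sum>g\<in>degrees. pr A s (?p g h k)) \<in> J 1"
    by (intro J_sum)
  then show ?thesis
    unfolding e using hom by (simp add: pr_sum UJ_sum A_UJ[OF hom])
qed

lemma pr_J_from_units:
  assumes "\<And>i j. i + k \<le> j \<Longrightarrow> j < CARD('n) \<Longrightarrow> pr A g (E i j) \<in> J k" "v \<in> J k"
  shows "pr A g v \<in> J k"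
proof -
  have "(\<Sum>p\<in>{(i, j). i \<le> j \<and> j < CARD('n)}. case p of (i, j) \<Rightarrow> mscale (ent v i j) (pr A g (E i j))) \<in> J k"
  proof (rule J_sum)
    fix p assume "p \<in> {(i, j). i \<le> j \<and> j < CARD('n)}"
    then obtain i j where p: "p = (i, j)" "i \<le> j" "j < CARD('n)" by auto
    show "(case p of (i, j) \<Rightarrow> mscale (ent v i j) (pr A g (E i j))) \<in> J k"
      using assms p by (cases "i + k \<le> j") (auto simp: J_mscale J_def[of k])
  qed
  then show ?thesis using pr_expand[OF J_UJ[OF assms(2)]] by metis
qed

lemma pr_J: "v \<in> J k \<Longrightarrow> pr A g v \<in> J k"
proof (induction k arbitrary: v g rule: less_induct)
  case (less k)
  consider "k = 0" | "k = 1" | "k \<ge> 2" by linarith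
  then show ?case
  proof cases
    case 1 then show ?thesis using less.prems by (simp add: J_0 pr_UJ)
  next
    case 2
    have "pr A g (E i j) \<in> J 1" if "i + 1 \<le> j" "j < CARD('n)" for i j
    proof -
      let ?e = "E i i :: ('k, 'n) sqmat" and ?x = "E i j :: ('k, 'n) sqmat"
      \<comment> \<open>Bracketing to the left gives \<open>?x\<close>; since \<open>?e\<close> has
        Jordan square \<open>2 ?e\<close>, bracketing to the right gives
        \<open>2 ?x\<close>.\<close>
      have "?x = mscale (-1) ((?x \<circ>\<^sub>J ?e) \<circ>\<^sub>J ?e - ?x \<circ>\<^sub>J (?e \<circ>\<^sub>J ?e))"
      proof -
        have xe: "?x \<circ>\<^sub>J ?e = ?x" using that by (simp add: jordan_def E_mult)
        have ee: "?e \<circ>\<^sub>J ?e = mscale 2 ?e"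
          using that by (intro mat_eqI) (simp only: jordan_def E_mult ent_add ent_mscale mult_2 if_True simp_thms)
        show ?thesis by (rule mat_eqI) (simp add: xe ee jordan_distribs)
      qed
      then have "pr A g ?x = mscale (-1) (pr A g ((?x \<circ>\<^sub>J ?e) \<circ>\<^sub>J ?e - ?x \<circ>\<^sub>J (?e \<circ>\<^sub>J ?e)))"
        using pr_mscale[of "(?x \<circ>\<^sub>J ?e) \<circ>\<^sub>J ?e - ?x \<circ>\<^sub>J (?e \<circ>\<^sub>J ?e)" g "-1"] that
        by (simp add: UJ_diff UJ_jordan)
      moreover have "\<dots> \<in> J 1"
        using that by (intro J_mscale pr_associator_J1) auto
      ultimately show ?thesis by metis
    qed
    then show ?thesis using pr_J_from_units[of 1] less.prems 2 by blast
  next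
    case 3
    have "pr A g (E i j) \<in> J k" if ij: "i + k \<le> j" "j < CARD('n)" for i j
    proof -
      \<comment> \<open>Because \<open>k\<close> is at least 2, \<open>j\<close> exceeds
        \<open>Suc i\<close>; both factors lie in lower radical powers, and their product in the
        other order is 0.\<close>
      have e: "(E i j :: ('k, 'n) sqmat) = E i (Suc i) \<circ>\<^sub>J E (Suc i) j"
        using ij 3 by (simp add: jordan_def E_mult)
      have 1: "E i (Suc i) \<in> (J 1 :: ('k, 'n) sqmat set)"
        and 2: "E (Suc i) j \<in> (J (k - 1) :: ('k, 'n) sqmat set)"
        using ij 3 by (auto intro!: J_E)
      have "pr A g (pr A a (E i (Suc i)) \<circ>\<^sub>J pr A b (E (Suc i) j)) \<in> J k" for a b
      proof (rule pr_homogeneous_in)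
        show "pr A a (E i (Suc i)) \<circ>\<^sub>J pr A b (E (Suc i) j) \<in> A (a + b)"
          using 1 2 by (intro A_jordan pr_spec J_UJ)
        show "pr A a (E i (Suc i)) \<circ>\<^sub>J pr A b (E (Suc i) j) \<in> J k"
          using J_jordan[OF less.IH[OF _ 1] less.IH[OF _ 2]] 3 by simp
      qed simp
      then show ?thesis
        unfolding e using 1 2 by (subst pr_jordan_expand) (auto intro!: J_UJ J_sum)
    qed
    then show ?thesis using pr_J_from_units less.prems by blast
  qed
qed

end

subsection \<open>Traces of operators\<close>

definition linear_op :: "(('k::field, 'n::{finite,linorder}) sqmat \<Rightarrow> ('k, 'n) sqmat) \<Rightarrow> bool" where
  "linear_op F \<longleftrightarrow> (\<forall>a b. F (a + b) = F a + F b) \<and> (\<forall>c a. F (mscale c a) = mscale c (F a))"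

definition Tr :: "(('k::field, 'n::{finite,linorder}) sqmat \<Rightarrow> ('k, 'n) sqmat) \<Rightarrow> 'k" where
  "Tr F = (\<Sum>(i, j)\<in>{..<CARD('n)} \<times> {..<CARD('n)}. ent (F (E i j)) i j)"

text \<open>The projection onto \<open>J k\<close> along the remaining matrix units. Composing with
  it extends an operator on \<open>J k\<close> to the whole matrix space without changing its trace,
  so a single \<open>Tr\<close> serves all radical powers.\<close>

definition cut :: "nat \<Rightarrow> ('k::field, 'n::{finite,linorder}) sqmat \<Rightarrow> ('k, 'n) sqmat" where
  "cut k a = mk (\<lambda>i j. if i + k \<le> j then ent a i j else 0)"

lemma linear_op_sum:
  assumes "linear_op F"
  shows "F (sum f X) = (\<Sum>x\<in>X. F (f x))"
proof -
  have "F 0 = 0" using assms unfolding linear_op_def by (metis mat.scale_zero_left)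
  then show ?thesis
    using assms by (induction X rule: infinite_finite_induct) (auto simp: linear_op_def)
qed

lemma linear_op_compose: "linear_op F \<Longrightarrow> linear_op G \<Longrightarrow> linear_op (F \<circ> G)"
  by (simp add: linear_op_def)

lemma E_expand_full:
  fixes a :: "('k::field, 'n::{finite,linorder}) sqmat"
  shows "(\<Sum>(i, j)\<in>{..<CARD('n)} \<times> {..<CARD('n)}. mscale (ent a i j) (E i j)) = a"
proof (rule mat_eqI)
  let ?X = "{..<CARD('n)} \<times> {..<CARD('n)}"
  fix k l assume kl: "k < CARD('n)" "l < CARD('n)"
  have "ent (\<Sum>(i, j)\<in>?X. mscale (ent a i j) (E i j) :: ('k, 'n) sqmat) k l
      = (\<Sum>p\<in>?X. if p = (k, l) then ent a k l else 0)"
    unfolding ent_sum by (rule sum.cong) (use kl in \<open>auto split: if_splits\<close>)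
  also have "\<dots> = ent a k l" using kl by simp
  finally show "ent (\<Sum>(i, j)\<in>?X. mscale (ent a i j) (E i j) :: ('k, 'n) sqmat) k l = ent a k l" .
qed

lemma ent_linear_op:
  fixes F :: "('k::field, 'n::{finite,linorder}) sqmat \<Rightarrow> ('k, 'n) sqmat"
  assumes "linear_op F"
  shows "ent (F a) k l = (\<Sum>p\<in>{..<CARD('n)} \<times> {..<CARD('n)}. ent a (fst p) (snd p) * ent (F (E (fst p) (snd p))) k l)"
proof -
  have "F a = (\<Sum>p\<in>{..<CARD('n)} \<times> {..<CARD('n)}. F (mscale (ent a (fst p) (snd p)) (E (fst p) (snd p))))"
    unfolding linear_op_sum[OF assms, symmetric]
    by (rule arg_cong[of _ _ F]) (simp add: E_expand_full[unfolded case_prod_beta])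
  then show ?thesis using assms by (simp add: linear_op_def)
qed

lemma Tr_commute:
  fixes F G :: "('k::field, 'n::{finite,linorder}) sqmat \<Rightarrow> ('k, 'n) sqmat"
  assumes "linear_op F" "linear_op G"
  shows "Tr (F \<circ> G) = Tr (G \<circ> F)"
proof -
  let ?X = "{..<CARD('n)} \<times> {..<CARD('n)}"
  have *: "Tr (F \<circ> G) = (\<Sum>q\<in>?X. \<Sum>p\<in>?X. ent (G (E (fst q) (snd q))) (fst p) (snd p) * ent (F (E (fst p) (snd p))) (fst q) (snd q))"
    if "linear_op F" for F G :: "('k, 'n) sqmat \<Rightarrow> ('k, 'n) sqmat"
    unfolding Tr_def case_prod_beta o_apply by (intro sum.cong refl ent_linear_op[OF that])
  show ?thesis
    unfolding *[OF assms(1)] *[OF assms(2)]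
    by (subst sum.swap) (simp add: mult.commute)
qed

lemma Tr_sum: "Tr (\<lambda>x. \<Sum>s\<in>S. F s x) = (\<Sum>s\<in>S. Tr (F s))"
  unfolding Tr_def case_prod_beta ent_sum by (rule sum.swap)

lemma linear_cut: "linear_op (cut k)"
  unfolding linear_op_def cut_def by (auto intro!: mat_eqI)

lemma cut_J [simp]: "cut k a \<in> J k"
  by (simp add: cut_def J_def)

lemma cut_id: "a \<in> J k \<Longrightarrow> cut k a = a"
  by (rule mat_eqI) (auto simp: cut_def J_def)

lemma cut_E:
  "i < CARD('n) \<Longrightarrow> j < CARD('n) \<Longrightarrow>
    cut k (E i j :: ('k::field, 'n::{finite,linorder}) sqmat) = (if i + k \<le> j then E i j else 0)"
  by (rule mat_eqI) (auto simp: cut_def)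

text \<open>Multiplications by upper triangular matrices are triangular with respect to the matrix
  units, so the diagonal coefficients of a composition are products of diagonal coefficients. These
  are the summands of the trace.\<close>

lemma ent_jordan_E_diag:
  fixes a b :: "('k::field, 'n::{finite,linorder}) sqmat"
  assumes "a \<in> UJ" "b \<in> UJ" "i \<le> j" "j < CARD('n)"
  shows "ent (a \<circ>\<^sub>J (b \<circ>\<^sub>J E i j)) i j = (ent a i i + ent a j j) * (ent b i i + ent b j j)"
proof -
  let ?y = "b \<circ>\<^sub>J E i j"
  have y: "?y \<in> UJ" using assms by (simp add: UJ_jordan)
  have ey: "ent ?y k l = (if l = j then ent b k i else 0) + (if k = i then ent b j l else 0)"
    if "k < CARD('n)" "l < CARD('n)" for k l
    using that assms by (simp add: jordan_def ent_E_mult)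
  have "ent (a ** ?y) i j = (\<Sum>k\<in>{i..j}. ent a i k * ent ?y k j)"
    by (rule ent_mult_UJ) (use assms y in auto)
  also have "\<dots> = (\<Sum>k\<in>{i}. ent a i k * ent ?y k j)"
    by (rule sum.mono_neutral_right) (use assms in \<open>auto simp: ey ent_lower\<close>)
  finally have 1: "ent (a ** ?y) i j = ent a i i * (ent b i i + ent b j j)"
    using assms by (simp add: ey)
  have "ent (?y ** a) i j = (\<Sum>k\<in>{i..j}. ent ?y i k * ent a k j)"
    by (rule ent_mult_UJ) (use assms y in auto)
  also have "\<dots> = (\<Sum>k\<in>{j}. ent ?y i k * ent a k j)"
    by (rule sum.mono_neutral_right) (use assms in \<open>auto simp: ey ent_lower\<close>)
  finally have 2: "ent (?y ** a) i j = ent a j j * (ent b i i + ent b j j)"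
    using assms by (simp add: ey)
  show ?thesis using 1 2 by (simp add: jordan_def[of a] algebra_simps)
qed

lemma J_absorb: "a \<in> UJ \<Longrightarrow> b \<in> J k \<Longrightarrow> a \<circ>\<^sub>J b \<in> J k"
  using J_jordan[of a 0 b k] by (simp add: J_0)

section \<open>Relations between diagonals from vanishing traces\<close>

context graded_UJ
begin

text \<open>
  The operator \<open>x \<mapsto> a \<circ> (b \<circ> x)\<close> shifts degrees by \<open>g + h\<close>, so it has trace zero on each power
  of the radical.
\<close>

lemma Tr_shift:
  assumes "a \<in> A g" "b \<in> A h" "g + h \<noteq> 0"
  shows "Tr (\<lambda>x. a \<circ>\<^sub>J (b \<circ>\<^sub>J cut k x)) = 0"
proof -
  define T where "T = (\<lambda>x. a \<circ>\<^sub>J (b \<circ>\<^sub>J cut k x))"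
  \<comment> \<open>The cut makes the component map linear on all matrices, as the trace
    requires.\<close>
  define P where "P s x = pr A s (cut k x)" for s x
  have UJ: "a \<in> UJ" "b \<in> UJ" using assms A_UJ by auto
  have lc: "linear_op (cut k :: ('k, 'n) sqmat \<Rightarrow> _)" by (rule linear_cut)
  have linT: "linear_op T"
    using lc by (simp add: linear_op_def T_def jordan_distribs)
  have linP: "linear_op (P s)" for s
    using lc by (simp add: linear_op_def P_def pr_add pr_mscale J_UJ[OF cut_J])
  have PJ: "P s x \<in> J k" for s x unfolding P_def by (intro pr_J cut_J)
  have "T x = (\<Sum>s\<in>degrees. (T \<circ> P s) x)" for x
  proof -
    have "(\<Sum>s\<in>degrees. (T \<circ> P s) x) = T (\<Sum>s\<in>degrees. P s x)"
      by (simp add: linear_op_sum[OF linT])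
    also have "(\<Sum>s\<in>degrees. P s x) = cut k x"
      unfolding P_def by (rule pr_decompose) (rule J_UJ[OF cut_J])
    finally show ?thesis by (simp add: T_def cut_id)
  qed
  then have "Tr T = Tr (\<lambda>x. \<Sum>s\<in>degrees. (T \<circ> P s) x)"
    by (intro arg_cong[of _ _ Tr] ext)
  also have "\<dots> = (\<Sum>s\<in>degrees. Tr (T \<circ> P s))"
    by (rule Tr_sum)
  also have "\<dots> = 0"
  proof (rule sum.neutral, rule ballI)
    fix s
    \<comment> \<open>The projection onto the target degree can be inserted on the left for free.
      Cyclicity of the trace moves it to the right of \<open>P s\<close>, where it meets a different
      degree and gives 0.\<close>
    have "P ((g + h) + s) \<circ> (T \<circ> P s) = T \<circ> P s"
    proof
      fix x
      have "P s x \<in> A s" unfolding P_def by (intro pr_spec J_UJ[OF cut_J])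
      then have "T (P s x) \<in> A ((g + h) + s)"
        using assms PJ by (simp add: T_def cut_id A_jordan add.assoc)
      moreover have "T (P s x) \<in> J k" unfolding T_def by (intro J_absorb UJ cut_J)
      ultimately show "(P ((g + h) + s) \<circ> (T \<circ> P s)) x = (T \<circ> P s) x"
        by (simp add: P_def[of "(g + h) + s"] cut_id pr_homogeneous)
    qed
    then have "Tr (T \<circ> P s) = Tr (P ((g + h) + s) \<circ> (T \<circ> P s))" by simp
    also have "\<dots> = Tr ((T \<circ> P s) \<circ> P ((g + h) + s))"
      by (intro Tr_commute linear_op_compose linT linP)
    also have "(T \<circ> P s) \<circ> P ((g + h) + s) = (\<lambda>x. 0)"
    proof
      fix x
      have "P ((g + h) + s) x \<in> A ((g + h) + s)" unfolding P_def by (intro pr_spec J_UJ[OF cut_J])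
      moreover have "s \<noteq> (g + h) + s" using assms(3) by (metis add_0 add_right_cancel)
      ultimately have "P s (P ((g + h) + s) x) = 0"
        using PJ by (simp add: P_def[of s] cut_id pr_homogeneous)
      then show "((T \<circ> P s) \<circ> P ((g + h) + s)) x = 0"
        by (simp add: T_def cut_id jordan_distribs)
    qed
    finally show "Tr (T \<circ> P s) = 0" by (simp add: Tr_def)
  qed
  finally show ?thesis by (simp add: T_def)
qed

text \<open>Subtracting the trace on \<open>J (Suc k)\<close> from the trace on \<open>J k\<close>
  leaves the contribution of the matrix units on the \<open>k\<close>-th diagonal.\<close>

lemma diag_sum_zero2:
  assumes "a \<in> A g" "b \<in> A h" "g + h \<noteq> 0"
  shows "(\<Sum>i<CARD('n) - k. (ent a i i + ent a (i + k) (i + k)) * (ent b i i + ent b (i + k) (i + k))) = 0"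
proof -
  let ?X = "{..<CARD('n)} \<times> {..<CARD('n)}"
  let ?f = "\<lambda>i j. (ent a i i + ent a j j) * (ent b i i + ent b j j)"
  have UJ: "a \<in> UJ" "b \<in> UJ" using assms A_UJ by auto
  have T: "(\<Sum>p\<in>?X. if fst p + k \<le> snd p then ?f (fst p) (snd p) else 0) = 0" for k
  proof -
    have "Tr (\<lambda>x. a \<circ>\<^sub>J (b \<circ>\<^sub>J cut k x)) = (\<Sum>p\<in>?X. if fst p + k \<le> snd p then ?f (fst p) (snd p) else 0)"
      unfolding Tr_def case_prod_beta
      by (rule sum.cong) (auto simp: cut_E jordan_distribs ent_jordan_E_diag UJ)
    then show ?thesis using Tr_shift[OF assms] by simp
  qed
  have "(\<Sum>i<CARD('n) - k. ?f i (i + k)) = (\<Sum>p\<in>(\<lambda>i. (i, i + k)) ` {..<CARD('n) - k}. ?f (fst p) (snd p))"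
    by (subst sum.reindex) (auto simp: inj_on_def)
  also have "\<dots> = (\<Sum>p\<in>?X. if snd p = fst p + k then ?f (fst p) (snd p) else 0)"
    by (rule sum.mono_neutral_cong_left) (auto simp: image_iff)
  also have "\<dots> = (\<Sum>p\<in>?X. (if fst p + k \<le> snd p then ?f (fst p) (snd p) else 0)
                     - (if fst p + Suc k \<le> snd p then ?f (fst p) (snd p) else 0))"
    by (rule sum.cong) auto
  also have "\<dots> = 0" by (simp only: sum_subtractf T diff_0_right)
  finally show ?thesis .
qed

lemma diag_sum_zero:
  assumes "a \<in> A g" "g \<noteq> 0"
  shows "(\<Sum>i<CARD('n) - k. ent a i i + ent a (i + k) (i + k)) = 0"
proof -
  have "(\<Sum>i<CARD('n) - k. (ent a i i + ent a (i + k) (i + k)) * (1 + 1)) = 0"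
    using diag_sum_zero2[OF assms(1) one_A0, of k] assms(2) by simp
  then have "(\<Sum>i<CARD('n) - k. ent a i i + ent a (i + k) (i + k)) * 2 = 0"
    by (simp only: sum_distrib_right one_add_one)
  then show ?thesis using two by simp
qed

text \<open>The sums of \<open>diag_sum_zero\<close> for \<open>k\<close> and \<open>Suc k\<close>
  differ by one entry from each of their two halves: the last one of the first half, at
  \<open>CARD('n) - 1 - k\<close>, and the first one of the second half, at
  \<open>k\<close>.\<close>

lemma diag_antisymmetric:
  assumes "a \<in> A g" "g \<noteq> 0" "k < CARD('n)"
  shows "ent a (CARD('n) - 1 - k) (CARD('n) - 1 - k) = - ent a k k"
proof -
  define m where "m = CARD('n) - 1 - k"
  have nk: "CARD('n) - k = Suc m" "CARD('n) - Suc k = m" using assms(3) by (auto simp: m_def)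
  have shift: "(\<Sum>i<m. ent a (Suc (i + k)) (Suc (i + k))) + ent a k k = (\<Sum>i<Suc m. ent a (i + k) (i + k))"
    by (subst sum.lessThan_Suc_shift) simp
  have "0 = (\<Sum>i<Suc m. ent a i i + ent a (i + k) (i + k)) - (\<Sum>i<m. ent a i i + ent a (i + Suc k) (i + Suc k))"
    using diag_sum_zero[OF assms(1,2), of k] diag_sum_zero[OF assms(1,2), of "Suc k"]
    unfolding nk by simp
  also have "\<dots> = ent a m m + ent a k k"
    using shift by (simp add: sum.distrib del: sum.lessThan_Suc) (simp add: algebra_simps)
  finally show ?thesis by (simp add: m_def eq_neg_iff_add_eq_0)
qed

text \<open>Expand \<open>diag_sum_zero2\<close>. The terms with equal indices are half of the
  linear relation for the Jordan product of \<open>a\<close> and \<open>b\<close>, which has nonzero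
  degree \<open>g + h\<close>; the cross terms remain.\<close>

lemma diag_cross_sum_zero:
  assumes "a \<in> A g" "b \<in> A h" "g + h \<noteq> 0"
  shows "(\<Sum>i<CARD('n) - k. ent a i i * ent b (i + k) (i + k) + ent a (i + k) (i + k) * ent b i i) = 0"
    (is "sum ?f ?S = 0")
proof -
  have UJ: "a \<in> UJ" "b \<in> UJ" using assms A_UJ by auto
  have "(\<Sum>i<CARD('n) - k. 2 * ent a i i * ent b i i + 2 * ent a (i + k) (i + k) * ent b (i + k) (i + k)) = 0"
    using diag_sum_zero[OF A_jordan[OF assms(1,2)] assms(3), of k] UJ by (simp add: diag_jordan)
  then have "2 * (\<Sum>i<CARD('n) - k. ent a i i * ent b i i + ent a (i + k) (i + k) * ent b (i + k) (i + k)) = 0"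
    by (simp add: sum_distrib_left algebra_simps)
  then have "(\<Sum>i<CARD('n) - k. ent a i i * ent b i i + ent a (i + k) (i + k) * ent b (i + k) (i + k)) = 0"
    using two by simp
  moreover have "(\<Sum>i<CARD('n) - k. (ent a i i + ent a (i + k) (i + k)) * (ent b i i + ent b (i + k) (i + k)))
     = (\<Sum>i<CARD('n) - k. ent a i i * ent b i i + ent a (i + k) (i + k) * ent b (i + k) (i + k)) + sum ?f ?S"
    unfolding sum.distrib[symmetric] by (rule sum.cong) (auto simp: algebra_simps)
  ultimately show ?thesis using diag_sum_zero2[OF assms, of k] by simp
qed

end

text \<open>
  Modulo the radical a grading is either trivial or the \<open>\<int>\<^sub>2\<close>-grading by the eigenspaces of the
  reflection of the diagonal. In the second case the antisymmetry of the diagonals in degree \<open>t\<close> is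
  automatic.
\<close>

definition trivial_diagonal :: "('g::group_add \<Rightarrow> ('k::field, 'n::{finite,linorder}) sqmat set) \<Rightarrow> bool" where
  "trivial_diagonal A \<longleftrightarrow> (\<forall>g. g \<noteq> 0 \<longrightarrow> A g \<subseteq> J 1)"

definition mirror :: "('g::group_add \<Rightarrow> ('k::field, 'n::{finite,linorder}) sqmat set) \<Rightarrow> 'g \<Rightarrow> bool" where
  "mirror A t \<longleftrightarrow> t \<noteq> 0 \<and> t + t = 0 \<and> (\<forall>g. g \<noteq> 0 \<longrightarrow> g \<noteq> t \<longrightarrow> A g \<subseteq> J 1) \<and>
    (\<forall>a\<in>A 0. \<forall>i<CARD('n). ent a (CARD('n) - 1 - i) (CARD('n) - 1 - i) = ent a i i)"

section \<open>The two types of diagonals\<close>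

context graded_UJ
begin

lemma diag_two_components:
  assumes "v \<in> UJ" "t \<noteq> 0" "\<And>g. g \<noteq> 0 \<Longrightarrow> g \<noteq> t \<Longrightarrow> ent (pr A g v) i i = 0"
  shows "ent v i i = ent (pr A 0 v) i i + ent (pr A t v) i i"
proof -
  have "ent v i i = (\<Sum>g\<in>degrees. ent (pr A g v) i i)"
    using pr_decompose[OF assms(1)] by (metis ent_sum)
  also have "\<dots> = (\<Sum>g\<in>degrees \<union> {0, t}. ent (pr A g v) i i)"
    using pr_not_degree[OF assms(1)] finite_degrees by (intro sum.mono_neutral_left) auto
  also have "\<dots> = (\<Sum>g\<in>{0, t}. ent (pr A g v) i i)"
    using assms(3) finite_degrees by (intro sum.mono_neutral_right) auto
  finally show ?thesis using assms(2) by simp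
qed

text \<open>The product of \<open>v\<close> and \<open>a\<close> has zero diagonal and so lies in
  \<open>J 1\<close>. This space is graded, hence contains the components of the product, which are
  the products of the components of \<open>v\<close> with \<open>a\<close>.\<close>

lemma diag_pr_jordan:
  assumes "v \<in> UJ" "a \<in> A g" "i < CARD('n)"
    and "\<And>j. j < CARD('n) \<Longrightarrow> ent v j j * ent a j j = 0"
  shows "ent (pr A h v) i i * ent a i i = 0"
proof -
  have a: "a \<in> UJ" using assms(2) A_UJ by auto
  have "v \<circ>\<^sub>J a \<in> J 1"
    using assms a by (subst J_1_iff) (auto simp: UJ_jordan diag_jordan)
  then have "pr A h v \<circ>\<^sub>J a \<in> J 1"
    using pr_J[of "v \<circ>\<^sub>J a" 1 "h + g"] pr_jordan_right[OF assms(1,2)] by simp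
  then have "ent (pr A h v \<circ>\<^sub>J a) i i = 0"
    using assms(3) by (subst (asm) J_1_iff) auto
  then show ?thesis using two a assms by (simp add: diag_jordan pr_UJ)
qed

text \<open>The diagonal of \<open>d\<close> lives at the two end positions, so only the pairs
  \<open>(0, k)\<close> and \<open>(CARD('n) - 1 - k, CARD('n) - 1)\<close> contribute to the cross
  sum.\<close>

lemma E00_cross_sum:
  assumes "a \<in> A g" "d \<in> A h" "g + h \<noteq> 0" "0 < k" "k < CARD('n)"
    and "\<And>i. i < CARD('n) \<Longrightarrow> ent d i i = (if i = 0 then c else if i = CARD('n) - 1 then c' else 0)"
  shows "c * ent a k k + c' * ent a (CARD('n) - 1 - k) (CARD('n) - 1 - k) = 0"
proof -
  let ?n = "CARD('n)"
  have "0 = (\<Sum>i<?n - k. ent a i i * ent d (i + k) (i + k) + ent a (i + k) (i + k) * ent d i i)"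
    using diag_cross_sum_zero[OF assms(1-3), of k] by simp
  also have "\<dots> = (\<Sum>i<?n - k. (if i = ?n - 1 - k then c' * ent a (?n - 1 - k) (?n - 1 - k) else 0)
      + (if i = 0 then c * ent a k k else 0))"
    by (rule sum.cong) (use assms(4,5) in \<open>auto simp: assms(6)\<close>)
  also have "\<dots> = c' * ent a (?n - 1 - k) (?n - 1 - k) + c * ent a k k"
    using assms(4,5) unfolding sum.distrib by (simp add: sum.delta)
  finally show ?thesis by (simp add: add.commute)
qed

text \<open>Multiplying \<open>E 0 0\<close> by its component of degree \<open>g \<noteq> 0\<close>
  gives zero diagonal, hence so does the square of that component. Thus \<open>E 0 0\<close> agrees
  with its degree 0 component on the diagonal, and the cross relation with that component isolates
  each diagonal entry of an element of nonzero degree.\<close>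

lemma trivial_diagonalI:
  assumes V: "\<And>g a. g \<noteq> 0 \<Longrightarrow> a \<in> A g \<Longrightarrow> ent a 0 0 = 0"
  shows "trivial_diagonal A"
proof -
  let ?u = "E 0 0 :: ('k, 'n) sqmat"
  have u: "?u \<in> UJ" by simp
  have orth: "ent (pr A h ?u) i i * ent a i i = 0" if "g \<noteq> 0" "a \<in> A g" "i < CARD('n)" for g h a i
    using V[OF that(1,2)] that by (intro diag_pr_jordan[OF u]) auto
  have z: "ent (pr A g ?u) i i = 0" if "g \<noteq> 0" "i < CARD('n)" for g i
    using orth[OF that(1) pr_spec(1)[OF u, of g] that(2), of g] by simp
  have d: "ent (pr A 0 ?u) i i = (if i = 0 then 1 else if i = CARD('n) - 1 then 0 else 0)" if i: "i < CARD('n)" for i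
  \<comment> \<open>\<open>diag_two_components\<close> wants some nonzero degree; over the trivial
    group the sum is evaluated directly.\<close>
  proof (cases "\<exists>t. (t :: 'g) \<noteq> 0")
    case True
    then obtain t :: 'g where "t \<noteq> 0" by blast
    then show ?thesis
      using diag_two_components[OF u, of t i] z i by auto
  next
    case False
    then have "A g = A 0" for g by metis
    have "ent ?u i i = (\<Sum>g\<in>degrees. ent (pr A g ?u) i i)"
      using pr_decompose[OF u] by (metis ent_sum)
    also have "\<dots> = (\<Sum>g\<in>insert 0 degrees. ent (pr A g ?u) i i)"
      using pr_not_degree[OF u] finite_degrees by (intro sum.mono_neutral_left) auto
    also have "\<dots> = (\<Sum>g\<in>{0}. ent (pr A g ?u) i i)"
      using z i finite_degrees by (intro sum.mono_neutral_right) auto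
    finally show ?thesis using i by auto
  qed
  have "A g \<subseteq> J 1" if g: "g \<noteq> 0" for g
  proof
    fix a assume a: "a \<in> A g"
    have "ent a k k = 0" if "k < CARD('n)" for k
    proof (cases "k = 0")
      case True then show ?thesis using V[OF g a] by simp
    next
      case False
      then show ?thesis
        using E00_cross_sum[OF a pr_spec(1)[OF u, of 0], of k 1 0] g that d by simp
    qed
    then show "a \<in> J 1" using A_UJ[OF a] by (subst J_1_iff) auto
  qed
  then show ?thesis by (simp add: trivial_diagonal_def)
qed

text \<open>Antisymmetry of \<open>a\<close> and of its product with \<open>b\<close>, when
  \<open>t + h \<noteq> 0\<close>, makes the two end entries of \<open>b\<close> equal; for
  \<open>b = a\<close> this contradicts antisymmetry unless \<open>t + t = 0\<close>. The degree
  \<open>t\<close> component of \<open>E 0 0\<close> turns out to have diagonal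
  \<open>(1/2, 0, ..., 0, -1/2)\<close>, and the cross relation with it equates each diagonal entry
  of an element of degree other than \<open>t\<close> with its mirror image.\<close>

lemma mirrorI:
  assumes a: "a \<in> A t" "ent a 0 0 \<noteq> 0" and t: "t \<noteq> 0"
  shows "mirror A t"
proof -
  let ?n = "CARD('n)"
  let ?u = "E 0 0 :: ('k, 'n) sqmat"
  define l where "l = ?n - 1"
  have l: "l < ?n" "0 < ?n" "l \<noteq> 0" "?n - Suc 0 - l = 0" "?n - Suc 0 = l" using card2 by (auto simp: l_def)
  have u: "?u \<in> UJ" by simp
  have aUJ: "a \<in> UJ" using a A_UJ by auto
  have anti: "ent b l l = - ent b 0 0" if "b \<in> A g" "g \<noteq> 0" for b g
    using diag_antisymmetric[OF that, of 0] l by simp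
  have prod: "ent b l l = ent b 0 0" if "b \<in> A h" "t + h \<noteq> 0" for b h
  proof -
    have b: "b \<in> UJ" using that A_UJ by auto
    have "2 * ent a l l * ent b l l = - (2 * ent a 0 0 * ent b 0 0)"
      using anti[OF A_jordan[OF a(1) that(1)] that(2)] aUJ b l by (simp add: diag_jordan)
    then show ?thesis using anti[OF a(1) t] a(2) two by simp
  qed
  have tt: "t + t = 0"
  proof (rule ccontr)
    assume "t + t \<noteq> 0"
    then have "ent a 0 0 = - ent a 0 0" using prod[OF a(1)] anti[OF a(1) t] by simp
    then have "2 * ent a 0 0 = 0" by (metis add.right_inverse mult_2)
    then show False using a(2) two by simp
  qed
  have th: "t + h = 0 \<longleftrightarrow> h = t" for h using tt by (metis add_left_cancel)
  have off: "ent b 0 0 = 0" if "b \<in> A h" "h \<noteq> 0" "h \<noteq> t" for b h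
  proof -
    have "ent b 0 0 = - ent b 0 0" using prod[OF that(1)] anti[OF that(1,2)] th that(3) by simp
    then have "2 * ent b 0 0 = 0" by (metis add.right_inverse mult_2)
    then show ?thesis using two by simp
  qed
  let ?uz = "pr A 0 ?u" and ?ut = "pr A t ?u"
  have u0: "?uz \<in> A 0" and ut: "?ut \<in> A t" using pr_spec(1)[OF u] by auto
  have uUJ: "?uz \<in> UJ" "?ut \<in> UJ" using pr_UJ[OF u] by auto
  have z: "ent (pr A h ?u) i i = 0" if "h \<noteq> 0" "h \<noteq> t" "i < ?n" for h i
  proof -
    have "ent (pr A h ?u) i i * ent (pr A h ?u) i i = 0"
      using off[OF pr_spec(1)[OF u] that(1,2)]
      by (intro diag_pr_jordan[OF u pr_spec(1)[OF u, of h] that(3), where h = h]) auto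
    then show ?thesis by simp
  qed
  define \<alpha> where "\<alpha> = ent ?ut 0 0"
  have sum: "ent ?uz i i + ent ?ut i i = (if i = 0 then 1 else 0)" if "i < ?n" for i
    using diag_two_components[OF u t z[OF _ _ that]] that by auto
  have \<alpha>: "\<alpha> = 1 / 2"
  proof -
    have "ent ?uz 0 0 + \<alpha> = 1" using sum[of 0] l by (simp add: \<alpha>_def)
    moreover have "ent ?uz 0 0 - \<alpha> = 0"
      using sum[of l] l prod[OF u0] anti[OF ut t] t by (simp add: \<alpha>_def)
    ultimately have "2 * \<alpha> = 1" by simp
    then show ?thesis using two by (simp add: field_simps)
  qed
  \<comment> \<open>The diagonal of \<open>E 0 0\<close> sits at index 0, where \<open>?ut\<close>
    has the entry \<open>\<alpha>\<close>, so \<open>?w\<close> has zero diagonal. As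
    \<open>t + t = 0\<close>, its degree 0 component involves the square of
    \<open>?ut\<close>.\<close>
  have quad: "ent ?ut i i * ent ?ut i i = \<alpha> * ent ?uz i i" if i: "i < ?n" for i
  proof -
    let ?w = "?u \<circ>\<^sub>J ?ut - mscale (2 * \<alpha>) ?u"
    have w: "?w \<in> UJ" using uUJ by (simp add: UJ_diff UJ_jordan UJ_mscale)
    have "?w \<in> J 1"
      using w uUJ by (subst J_1_iff) (auto simp: diag_jordan \<alpha>_def)
    then have "pr A 0 ?w \<in> J 1" by (rule pr_J)
    moreover have "pr A 0 ?w = ?ut \<circ>\<^sub>J ?ut - mscale (2 * \<alpha>) ?uz"
    proof -
      have "pr A 0 (?u \<circ>\<^sub>J ?ut) = ?ut \<circ>\<^sub>J ?ut" using pr_jordan_right[OF u ut, of t] tt by simp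
      then show ?thesis using uUJ by (simp add: pr_diff pr_mscale UJ_jordan UJ_mscale)
    qed
    ultimately have "ent (?ut \<circ>\<^sub>J ?ut - mscale (2 * \<alpha>) ?uz) i i = 0"
      using i by (metis J_1_iff)
    then have "2 * (ent ?ut i i * ent ?ut i i - \<alpha> * ent ?uz i i) = 0"
      using uUJ i by (simp add: diag_jordan algebra_simps)
    then show ?thesis using two by simp
  qed
  have half: "ent ?ut i i = 0 \<or> ent ?ut i i = - (1 / 2)" if "i < ?n" "i \<noteq> 0" for i
  proof -
    have "ent ?uz i i = - ent ?ut i i" using sum[OF that(1)] that(2) by (simp add: eq_neg_iff_add_eq_0)
    then have "ent ?ut i i * (ent ?ut i i + 1 / 2) = 0"
      using quad[OF that(1)] \<alpha> by (simp add: algebra_simps)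
    then show ?thesis by (simp add: eq_neg_iff_add_eq_0)
  qed
  have d: "ent ?ut i i = (if i = 0 then 1 / 2 else if i = ?n - 1 then - (1 / 2) else 0)" if i: "i < ?n" for i
  proof -
    consider "i = 0" | "i = l" | "i \<noteq> 0" "i \<noteq> l" by blast
    then show ?thesis
    proof cases
      case 1 then show ?thesis using \<alpha> by (simp add: \<alpha>_def)
    next
      case 2 then show ?thesis using anti[OF ut t] \<alpha> l by (simp add: \<alpha>_def)
    next
      case 3
      have 1: "ent ?ut (l - i) (l - i) = - ent ?ut i i"
        using diag_antisymmetric[OF ut t i] by (simp add: l)
      have hh: "1 / 2 + 1 / 2 = (1 :: 'k)" using two by (simp flip: add_divide_distrib)
      \<comment> \<open>The only nonzero value that \<open>half\<close> permits is
        \<open>- (1 / 2)\<close>; antisymmetry would then put \<open>1 / 2\<close> at the mirror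
        index, which \<open>half\<close> rules out.\<close>
      have "ent ?ut i i = 0"
      proof (rule ccontr)
        assume "ent ?ut i i \<noteq> 0"
        then have y: "ent ?ut (l - i) (l - i) = 1 / 2" using half[OF i 3(1)] 1 by simp
        have "l - i < ?n" "l - i \<noteq> 0" using 3 i l(5) by auto
        then have "1 / 2 = (0 :: 'k) \<or> 1 / 2 = - (1 / 2 :: 'k)" using half[of "l - i"] unfolding y by blast
        then show False using hh two by (metis add.right_inverse one_neq_zero add_0)
      qed
      then show ?thesis using 3 l by simp
    qed
  qed
  have sym: "ent b (?n - 1 - k) (?n - 1 - k) = ent b k k" if b: "b \<in> A h" "h \<noteq> t" and k: "k < ?n" for b h k
  proof (cases "k = 0")
    case True then show ?thesis using prod[OF b(1)] th b(2) by (simp add: l)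
  next
    case False
    have "h + t \<noteq> 0" using th b(2) tt by (metis add_right_cancel)
    then have "1 / 2 * ent b k k + - (1 / 2) * ent b (?n - 1 - k) (?n - 1 - k) = 0"
      using False k by (intro E00_cross_sum[OF b(1) ut _ _ _ d]) auto
    then show ?thesis using two by (simp add: field_simps)
  qed
  have "A g \<subseteq> J 1" if g: "g \<noteq> 0" "g \<noteq> t" for g
  proof
    fix b assume b: "b \<in> A g"
    have "ent b k k = 0" if "k < ?n" for k
    proof -
      have "ent b k k = - ent b k k"
        using sym[OF b g(2) that] diag_antisymmetric[OF b g(1) that] by simp
      then have "2 * ent b k k = 0" by (metis add.right_inverse mult_2)
      then show ?thesis using two by simp
    qed
    then show "b \<in> J 1" using A_UJ[OF b] by (subst J_1_iff) auto
  qed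
  then show ?thesis using sym[of _ 0] t tt by (auto simp: mirror_def)
qed

lemma diagonal_dichotomy: "trivial_diagonal A \<or> (\<exists>t. mirror A t)"
  using trivial_diagonalI mirrorI by blast

end

subsection \<open>Lifting tripotents\<close>

primrec mpow :: "('k::field, 'n::{finite,linorder}) sqmat \<Rightarrow> nat \<Rightarrow> ('k, 'n) sqmat" where
  "mpow a 0 = mat 1"
| "mpow a (Suc k) = a ** mpow a k"

lemma mpow_add: "mpow a k ** mpow a l = mpow a (k + l)"
  by (induction k) (auto simp flip: matrix_mul_assoc)

text \<open>The polynomial \<open>p\<close> with \<open>p(x) = x\<close> and \<open>p'(x) = 0\<close> at the roots \<open>0, 1, -1\<close> of \<open>x\<^sup>3 - x\<close>.\<close>

definition tri_step :: "('k::field, 'n::{finite,linorder}) sqmat \<Rightarrow> ('k, 'n) sqmat" where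
  "tri_step a = mscale (5 * inverse 2) (a ** (a ** a)) - mscale (3 * inverse 2) (a ** (a ** (a ** (a ** a))))"

text \<open>With \<open>p\<close> the polynomial of \<open>tri_step\<close>, each root of
  \<open>x^3 - x\<close> is at least a double root of \<open>p^3 - p\<close>, because
  \<open>p\<close> fixes it and \<open>p'\<close> vanishes there. Hence \<open>(x^3 - x)^2\<close>
  divides \<open>p^3 - p\<close>.\<close>

lemma tri_step_cube:
  fixes a :: "('k::field, 'n::{finite,linorder}) sqmat"
  assumes two: "(2 :: 'k) \<noteq> 0"
  shows "\<exists>m. tri_step a ** (tri_step a ** tri_step a) - tri_step a
    = ((a ** (a ** a) - a) ** (a ** (a ** a) - a)) ** (a ** m)
    \<and> (a \<in> UJ \<longrightarrow> m \<in> UJ)"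
proof -
  define h where "h = inverse (2 :: 'k)"
  have h: "2 * h = 1" using two by (simp add: h_def)
  have p: "tri_step a = mscale (5 * h) (mpow a 3) - mscale (3 * h) (mpow a 5)"
    by (simp add: tri_step_def h_def eval_nat_numeral)
  have D: "a ** (a ** a) - a = mpow a 3 - mpow a 1" by (simp add: eval_nat_numeral)
  \<comment> \<open>The quotient of \<open>p^3 - p\<close> by \<open>x (x^3 - x)^2\<close>, found by
    polynomial division; it is even, with common denominator 8.\<close>
  define m where "m = mscale (- (h * h * h))
    (mscale 20 (mpow a 0) + mscale 28 (mpow a 2) + mscale 36 (mpow a 4) - mscale 81 (mpow a 6) + mscale 27 (mpow a 8))"
  have a: "a = mpow a 1" by simp
  have "tri_step a ** (tri_step a ** tri_step a) - tri_step a
    = ((a ** (a ** a) - a) ** (a ** (a ** a) - a)) ** (mpow a 1 ** m)"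
  proof (rule mat_eqI)
    fix i j
    define X where "X k = ent (mpow a k) i j" for k
    show "ent (tri_step a ** (tri_step a ** tri_step a) - tri_step a) i j
      = ent (((a ** (a ** a) - a) ** (a ** (a ** a) - a)) ** (mpow a 1 ** m)) i j"
      unfolding p D m_def mult_distribs mpow_add ent_add ent_diff ent_mscale X_def[symmetric]
      apply (simp add: algebra_simps eval_nat_numeral)
      using h by algebra
  qed
  moreover have "a \<in> UJ \<Longrightarrow> mpow a k \<in> UJ" for k
    by (induction k) (auto intro: UJ_mult)
  then have "a \<in> UJ \<Longrightarrow> m \<in> UJ"
    unfolding m_def by (intro UJ_mscale UJ_add UJ_diff)
  ultimately show ?thesis by auto
qed

text \<open>The step squares the error, as in Newton iteration; \<open>(k + 1) + (k + 1)\<close> is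
  at least \<open>k + 2\<close>.\<close>

lemma tri_step_J:
  fixes a :: "('k::field, 'n::{finite,linorder}) sqmat"
  assumes "(2 :: 'k) \<noteq> 0" "a \<in> UJ" "a ** (a ** a) - a \<in> J (Suc k)"
  shows "tri_step a ** (tri_step a ** tri_step a) - tri_step a \<in> J (Suc (Suc k))"
proof -
  obtain m where m: "tri_step a ** (tri_step a ** tri_step a) - tri_step a
    = ((a ** (a ** a) - a) ** (a ** (a ** a) - a)) ** (a ** m)" "m \<in> UJ"
    using tri_step_cube[OF assms(1), of a] assms(2) by blast
  have "((a ** (a ** a) - a) ** (a ** (a ** a) - a)) ** (a ** m) \<in> J ((Suc k + Suc k) + 0)"
    using assms m(2) by (intro J_mult) (auto simp: J_0 UJ_mult)
  then show ?thesis unfolding m(1) using J_mono[of "Suc (Suc k)" "(Suc k + Suc k) + 0"] by auto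
qed

lemma half_double:
  fixes a :: "('k::field, 'n::{finite,linorder}) sqmat"
  assumes "(2 :: 'k) \<noteq> 0"
  shows "mscale (inverse 2) (a + a) = a"
proof (rule mat_eqI)
  fix i j
  have "inverse 2 * (2 * ent a i j) = ent a i j" using assms by simp
  then show "ent (mscale (inverse 2) (a + a)) i j = ent a i j"
    by (simp only: ent_mscale ent_add mult_2)
qed

section \<open>Graded lifting of tripotents\<close>

context graded_UJ
begin

lemma square_A0: "a \<in> A s \<Longrightarrow> s + s = 0 \<Longrightarrow> a ** a \<in> A 0"
proof -
  assume "a \<in> A s" "s + s = 0"
  then have "mscale (inverse 2) (a \<circ>\<^sub>J a) \<in> A 0" using A_jordan[of a s a s] by (simp add: A_mscale)
  also have "mscale (inverse 2) (a \<circ>\<^sub>J a) = a ** a"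
    unfolding jordan_def by (rule half_double[OF two])
  finally show ?thesis .
qed

text \<open>The grading controls Jordan products only; for commuting factors the associative product
  is half of the Jordan product.\<close>

lemma mult_A0_commuting:
  assumes "a \<in> A s" "b \<in> A 0" "a ** b = b ** a"
  shows "a ** b \<in> A s"
proof -
  have "mscale (inverse 2) (a \<circ>\<^sub>J b) \<in> A s" using A_jordan[OF assms(1,2)] by (simp add: A_mscale)
  also have "mscale (inverse 2) (a \<circ>\<^sub>J b) = a ** b"
    unfolding jordan_def assms(3)[symmetric] by (rule half_double[OF two])
  finally show ?thesis .
qed

text \<open>The polynomial is odd, and odd powers of \<open>a\<close> stay in degree
  \<open>s\<close> because even ones have degree 0.\<close>

lemma tri_step_A:
  assumes "a \<in> A s" "s + s = 0"
  shows "tri_step a \<in> A s"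
proof -
  have 2: "a ** a \<in> A 0" using assms by (rule square_A0)
  have 3: "a ** (a ** a) \<in> A s"
    by (rule mult_A0_commuting[OF assms(1) 2]) (simp add: matrix_mul_assoc)
  have "(a ** (a ** a)) ** (a ** a) \<in> A s"
    by (rule mult_A0_commuting[OF 3 2]) (simp add: matrix_mul_assoc)
  then have 5: "a ** (a ** (a ** (a ** a))) \<in> A s"
    by (simp add: matrix_mul_assoc)
  show ?thesis unfolding tri_step_def using 3 5 by (intro A_diff A_mscale)
qed

text \<open>This is the quadratic operator of Jordan theory: \<open>S u S\<close> is a combination
  of \<open>(S, u, S)\<close> and \<open>(S, S, u)\<close>, both bracketed to the left, and
  \<open>S\<close> has degree 0.\<close>

lemma sandwich_A:
  assumes "S \<in> A 0" "u \<in> A s"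
  shows "S ** u ** S \<in> A s"
proof -
  define h where "h = inverse (2 :: 'k)"
  have h: "2 * h = 1" using two by (simp add: h_def)
  have "(S \<circ>\<^sub>J u) \<circ>\<^sub>J S \<in> A ((0 + s) + 0)" "(S \<circ>\<^sub>J S) \<circ>\<^sub>J u \<in> A ((0 + 0) + s)"
    using assms by (intro A_jordan; simp)+
  then have "mscale h ((S \<circ>\<^sub>J u) \<circ>\<^sub>J S - mscale h ((S \<circ>\<^sub>J S) \<circ>\<^sub>J u)) \<in> A s"
    by (intro A_mscale A_diff) auto
  also have "mscale h ((S \<circ>\<^sub>J u) \<circ>\<^sub>J S - mscale h ((S \<circ>\<^sub>J S) \<circ>\<^sub>J u)) = S ** u ** S"
  proof (rule mat_eqI)
    fix i j
    show "ent (mscale h ((S \<circ>\<^sub>J u) \<circ>\<^sub>J S - mscale h ((S \<circ>\<^sub>J S) \<circ>\<^sub>J u))) i j = ent (S ** u ** S) i j"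
      unfolding jordan_def mult_distribs matrix_mul_assoc ent_mscale ent_diff ent_add using h by algebra
  qed
  finally show ?thesis .
qed

text \<open>Each step moves the error into the next radical power, and high powers are 0. The
  annihilation clauses persist because all iterates are polynomials in \<open>u\<close> without
  constant term; they make lifted elements orthogonal to those found before.\<close>

lemma lift_tripotent:
  assumes u: "u \<in> A s" "s + s = 0"
    and d: "\<And>i. i < CARD('n) \<Longrightarrow> ent u i i * (ent u i i * ent u i i) = ent u i i"
  shows "\<exists>a\<in>A s. (\<forall>i<CARD('n). ent a i i = ent u i i) \<and> a ** (a ** a) = a \<and>
    (\<forall>z :: ('k, 'n) sqmat. z ** u = 0 \<longrightarrow> z ** a = 0) \<and> (\<forall>z :: ('k, 'n) sqmat. u ** z = 0 \<longrightarrow> a ** z = 0)"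
proof -
  have "\<exists>a\<in>A s. (\<forall>i<CARD('n). ent a i i = ent u i i) \<and> a ** (a ** a) - a \<in> J (Suc k) \<and>
    (\<forall>z :: ('k, 'n) sqmat. z ** u = 0 \<longrightarrow> z ** a = 0) \<and> (\<forall>z :: ('k, 'n) sqmat. u ** z = 0 \<longrightarrow> a ** z = 0)" for k
  proof (induction k)
    case 0
    have "u ** (u ** u) - u \<in> J 1"
      using A_UJ[OF u(1)] d by (subst J_1_iff) (auto simp: UJ_diff UJ_mult diag_mult)
    then show ?case using u by auto
  next
    case (Suc k)
    then obtain a where a: "a \<in> A s" "\<forall>i<CARD('n). ent a i i = ent u i i" "a ** (a ** a) - a \<in> J (Suc k)"
      "\<forall>z :: ('k, 'n) sqmat. z ** u = 0 \<longrightarrow> z ** a = 0" "\<forall>z :: ('k, 'n) sqmat. u ** z = 0 \<longrightarrow> a ** z = 0" by blast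
    have UJ: "a \<in> UJ" using a(1) A_UJ by auto
    have "ent (tri_step a) i i = ent u i i" if i: "i < CARD('n)" for i
    proof -
      let ?d = "ent u i i"
      have "ent (tri_step a) i i = 5 * inverse 2 * (?d * (?d * ?d)) - 3 * inverse 2 * (?d * (?d * (?d * (?d * ?d))))"
        using a(2) UJ i by (simp add: tri_step_def diag_mult UJ_mult)
      also have "\<dots> = 2 * (inverse 2 * ?d)" by (simp add: d[OF i] algebra_simps)
      finally show ?thesis using two by simp
    qed
    moreover have "z ** tri_step a = 0" if "z ** u = 0" for z :: "('k, 'n) sqmat"
      using a(4) that by (simp add: tri_step_def mult_distribs matrix_mul_assoc)
    moreover have "tri_step a ** z = 0" if "u ** z = 0" for z :: "('k, 'n) sqmat"
      using a(5) that by (simp add: tri_step_def mult_distribs flip: matrix_mul_assoc)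
    ultimately show ?case
      using tri_step_A[OF a(1) u(2)] tri_step_J[OF two UJ a(3)] by blast
  qed
  from this[of "CARD('n)"] show ?thesis
    using J_top[of "Suc CARD('n)"] by (metis eq_iff_diff_eq_0 le_SucI order_refl)
qed

text \<open>Subtracting the squares of the tripotents already found from the identity gives an
  \<open>S\<close> of degree 0 that annihilates them from both sides. Sandwiching the next
  \<open>u\<close> by \<open>S\<close> leaves its diagonal unchanged and makes it orthogonal to them
  before it is lifted.\<close>

lemma lift_tripotent_family:
  fixes r :: nat
  assumes "\<And>l. l < r \<Longrightarrow> u l \<in> A (s l)" "\<And>l. l < r \<Longrightarrow> s l + s l = 0"
    and "\<And>l i. l < r \<Longrightarrow> i < CARD('n) \<Longrightarrow> ent (u l) i i * (ent (u l) i i * ent (u l) i i) = ent (u l) i i"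
    and "\<And>l m i. l < r \<Longrightarrow> m < r \<Longrightarrow> l \<noteq> m \<Longrightarrow> i < CARD('n) \<Longrightarrow> ent (u l) i i * ent (u m) i i = 0"
  shows "\<exists>a. \<forall>l<r. a l \<in> A (s l) \<and> (\<forall>i<CARD('n). ent (a l) i i = ent (u l) i i) \<and>
    a l ** (a l ** a l) = a l \<and> (\<forall>m<r. m \<noteq> l \<longrightarrow> a l ** a m = 0)"
  using assms
proof (induction r)
  case 0 then show ?case by simp
next
  case (Suc r)
  have "\<exists>a. \<forall>l<r. a l \<in> A (s l) \<and> (\<forall>i<CARD('n). ent (a l) i i = ent (u l) i i) \<and>
    a l ** (a l ** a l) = a l \<and> (\<forall>m<r. m \<noteq> l \<longrightarrow> a l ** a m = 0)"
    by (rule Suc.IH) (rule Suc.prems; simp)+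
  then obtain a where a: "\<And>l. l < r \<Longrightarrow> a l \<in> A (s l)"
    "\<And>l i. l < r \<Longrightarrow> i < CARD('n) \<Longrightarrow> ent (a l) i i = ent (u l) i i"
    "\<And>l. l < r \<Longrightarrow> a l ** (a l ** a l) = a l"
    "\<And>l m. l < r \<Longrightarrow> m < r \<Longrightarrow> m \<noteq> l \<Longrightarrow> a l ** a m = 0" by blast
  define S where "S = mat 1 - (\<Sum>l<r. a l ** a l)"
  let ?u = "S ** u r ** S"
  have ur: "u r \<in> A (s r)" "u r \<in> UJ" using Suc.prems(1)[of r] A_UJ by auto
  have S: "S \<in> A 0" unfolding S_def
    using a(1) Suc.prems(2) by (intro A_diff one_A0 A_sum square_A0) auto
  then have SU: "S \<in> UJ" by (rule A_UJ)
  have aS: "a l ** S = 0" if "l < r" for l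
  proof -
    have "(\<Sum>m<r. a l ** (a m ** a m)) = (\<Sum>m<r. if m = l then a l else 0)"
      using a(3,4) that by (intro sum.cong) (auto simp: matrix_mul_assoc mult_distribs)
    then show ?thesis using that by (simp add: S_def mult_distribs mult_sum_right)
  qed
  have Sa: "S ** a l = 0" if "l < r" for l
  proof -
    have "(\<Sum>m<r. (a m ** a m) ** a l) = (\<Sum>m<r. if m = l then a l else 0)"
      using a(3,4) that by (intro sum.cong) (auto simp: mult_distribs simp flip: matrix_mul_assoc)
    then show ?thesis using that by (simp add: S_def mult_distribs mult_sum_left)
  qed
  have dS: "ent S i i * ent (u r) i i = ent (u r) i i" if i: "i < CARD('n)" for i
  proof -
    have "ent S i i = 1 - (\<Sum>l<r. ent (u l) i i * ent (u l) i i)"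
      using i by (simp add: S_def diag_mult A_UJ[OF a(1)] a(2))
    moreover have "(\<Sum>l<r. ent (u l) i i * ent (u l) i i) * ent (u r) i i = 0"
      unfolding sum_distrib_right
      by (rule sum.neutral) (use Suc.prems(4)[of _ r i] i in auto)
    ultimately show ?thesis by (simp add: left_diff_distrib)
  qed
  have du: "ent ?u i i = ent (u r) i i" if i: "i < CARD('n)" for i
    using dS[OF i] i SU ur by (auto simp: diag_mult UJ_mult)
  obtain b where b: "b \<in> A (s r)" "\<forall>i<CARD('n). ent b i i = ent ?u i i" "b ** (b ** b) = b"
      "\<forall>z :: ('k, 'n) sqmat. z ** ?u = 0 \<longrightarrow> z ** b = 0" "\<forall>z :: ('k, 'n) sqmat. ?u ** z = 0 \<longrightarrow> b ** z = 0"
    using lift_tripotent[OF sandwich_A[OF S ur(1)]] Suc.prems(2,3)[of r] du by auto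
  have "a l ** b = 0" if "l < r" for l
    using b(4) aS[OF that] by (simp add: matrix_mul_assoc mult_distribs)
  moreover have "b ** a l = 0" if "l < r" for l
    using b(5) Sa[OF that] by (simp add: mult_distribs flip: matrix_mul_assoc)
  ultimately have "\<forall>l<Suc r. (a(r := b)) l \<in> A (s l) \<and> (\<forall>i<CARD('n). ent ((a(r := b)) l) i i = ent (u l) i i) \<and>
    (a(r := b)) l ** ((a(r := b)) l ** (a(r := b)) l) = (a(r := b)) l \<and>
    (\<forall>m<Suc r. m \<noteq> l \<longrightarrow> (a(r := b)) l ** (a(r := b)) m = 0)"
    using a b du by (auto simp: less_Suc_eq)
  then show ?case by blast
qed

end

subsection \<open>Automorphisms\<close>

lemma automorphism_UJ: "UJ_automorphism \<phi> \<Longrightarrow> a \<in> UJ \<Longrightarrow> \<phi> a \<in> UJ"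
  by (auto simp: UJ_automorphism_def bij_betw_def)

lemma automorphism_inj: "UJ_automorphism \<phi> \<Longrightarrow> a \<in> UJ \<Longrightarrow> b \<in> UJ \<Longrightarrow> \<phi> a = \<phi> b \<longleftrightarrow> a = b"
  by (auto simp: UJ_automorphism_def bij_betw_def inj_on_def)

lemma automorphism_add: "UJ_automorphism \<phi> \<Longrightarrow> a \<in> UJ \<Longrightarrow> b \<in> UJ \<Longrightarrow> \<phi> (a + b) = \<phi> a + \<phi> b"
  by (auto simp: UJ_automorphism_def)

lemma automorphism_mscale: "UJ_automorphism \<phi> \<Longrightarrow> a \<in> UJ \<Longrightarrow> \<phi> (mscale c a) = mscale c (\<phi> a)"
  by (auto simp: UJ_automorphism_def)

lemma automorphism_jordan: "UJ_automorphism \<phi> \<Longrightarrow> a \<in> UJ \<Longrightarrow> b \<in> UJ \<Longrightarrow> \<phi> (a \<circ>\<^sub>J b) = \<phi> a \<circ>\<^sub>J \<phi> b"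
  by (auto simp: UJ_automorphism_def)

lemma automorphism_0: "UJ_automorphism \<phi> \<Longrightarrow> \<phi> 0 = 0"
  using automorphism_mscale[of \<phi> 0 0] by simp

lemma automorphism_diff: "UJ_automorphism \<phi> \<Longrightarrow> a \<in> UJ \<Longrightarrow> b \<in> UJ \<Longrightarrow> \<phi> (a - b) = \<phi> a - \<phi> b"
  using automorphism_add[of \<phi> a "mscale (- 1) b"] automorphism_mscale[of \<phi> b "- 1"] UJ_mscale[of b "- 1"]
  by simp

lemma automorphism_sum:
  "UJ_automorphism \<phi> \<Longrightarrow> (\<And>x. x \<in> X \<Longrightarrow> f x \<in> UJ) \<Longrightarrow> \<phi> (sum f X) = (\<Sum>x\<in>X. \<phi> (f x))"
  by (induction X rule: infinite_finite_induct) (auto simp: automorphism_0 automorphism_add UJ_sum)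

lemma automorphism_compose:
  assumes "UJ_automorphism \<phi>" "UJ_automorphism \<psi>"
  shows "UJ_automorphism (\<phi> \<circ> \<psi>)"
proof -
  have "bij_betw (\<phi> \<circ> \<psi>) UJ UJ"
    using assms by (auto simp: UJ_automorphism_def intro: bij_betw_trans)
  then show ?thesis
    using assms automorphism_UJ[OF assms(2)] unfolding UJ_automorphism_def by simp
qed

lemma automorphism_inverse:
  fixes \<phi> :: "('k::field, 'n::{finite,linorder}) sqmat \<Rightarrow> ('k, 'n) sqmat"
  assumes "UJ_automorphism \<phi>"
  shows "UJ_automorphism (the_inv_into UJ \<phi>)"
proof -
  let ?\<psi> = "the_inv_into UJ \<phi>"
  have inj: "inj_on \<phi> UJ" and surj: "\<phi> ` UJ = UJ" and bij: "bij_betw \<phi> UJ UJ"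
    using assms by (auto simp: UJ_automorphism_def bij_betw_def)
  have p: "?\<psi> a \<in> UJ" "\<phi> (?\<psi> a) = a" if "a \<in> UJ" for a
    using that surj by (auto intro: the_inv_into_into[OF inj, of _ UJ, simplified] f_the_inv_into_f[OF inj])
  have q: "?\<psi> (\<phi> a) = a" if "a \<in> UJ" for a using the_inv_into_f_f[OF inj that] .
  show ?thesis unfolding UJ_automorphism_def
  proof (intro conjI ballI allI)
    show "bij_betw ?\<psi> UJ UJ" by (rule bij_betw_the_inv_into[OF bij])
    fix a b :: "('k, 'n) sqmat" and c assume a: "a \<in> UJ"
    show "?\<psi> (mscale c a) = mscale c (?\<psi> a)"
      using q[of "mscale c (?\<psi> a)"] automorphism_mscale[OF assms p(1)[OF a], of c] p a by (simp add: UJ_mscale)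
    assume b: "b \<in> UJ"
    show "?\<psi> (a + b) = ?\<psi> a + ?\<psi> b"
      using q[of "?\<psi> a + ?\<psi> b"] automorphism_add[OF assms p(1)[OF a] p(1)[OF b]] p a b by (simp add: UJ_add)
    show "?\<psi> (a \<circ>\<^sub>J b) = ?\<psi> a \<circ>\<^sub>J ?\<psi> b"
      using q[of "?\<psi> a \<circ>\<^sub>J ?\<psi> b"] automorphism_jordan[OF assms p(1)[OF a] p(1)[OF b]] p a b by (simp add: UJ_jordan)
  qed
qed

lemma graded_isomorphic_image: "UJ_automorphism \<phi> \<Longrightarrow> graded_isomorphic A (\<lambda>g. \<phi> ` A g)"
  by (auto simp: graded_isomorphic_def)

lemma graded_isomorphic_trans:
  assumes "graded_isomorphic A B" "graded_isomorphic B C"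
  shows "graded_isomorphic A C"
proof -
  obtain \<phi> \<psi> where *: "UJ_automorphism \<phi>" "\<And>g. \<phi> ` A g = B g" "UJ_automorphism \<psi>" "\<And>g. \<psi> ` B g = C g"
    using assms by (auto simp: graded_isomorphic_def)
  have "(\<psi> \<circ> \<phi>) ` A g = C g" for g by (simp only: image_comp[symmetric] *)
  then show ?thesis
    using automorphism_compose[OF *(3,1)] unfolding graded_isomorphic_def by blast
qed

lemma graded_isomorphic_sym:
  assumes "graded_isomorphic A B" "\<And>g. A g \<subseteq> UJ"
  shows "graded_isomorphic B A"
proof -
  obtain \<phi> where \<phi>: "UJ_automorphism \<phi>" "\<And>g. \<phi> ` A g = B g"
    using assms(1) by (auto simp: graded_isomorphic_def)
  have inj: "inj_on \<phi> UJ" using \<phi> by (auto simp: UJ_automorphism_def bij_betw_def)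
  have "the_inv_into UJ \<phi> ` B g = A g" for g
  proof -
    have "(\<lambda>x. the_inv_into UJ \<phi> (\<phi> x)) ` A g = (\<lambda>x. x) ` A g"
      by (rule image_cong) (use assms(2)[of g] the_inv_into_f_f[OF inj] in auto)
    then show ?thesis unfolding \<phi>(2)[symmetric] image_image by simp
  qed
  then show ?thesis
    using automorphism_inverse[OF \<phi>(1)] by (auto simp: graded_isomorphic_def)
qed

section \<open>Transport of gradings along automorphisms\<close>

context graded_UJ
begin

lemma grading_image:
  assumes \<phi>: "UJ_automorphism \<phi>"
  shows "UJ_grading (\<lambda>g. \<phi> ` A g)"
proof -
  have sub': "mat.subspace (\<phi> ` A g)" for g
    unfolding mat.subspace_def
  proof (intro conjI ballI allI)
    show "0 \<in> \<phi> ` A g" by (rule image_eqI[of _ _ 0]) (simp_all add: automorphism_0[OF \<phi>])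
    fix x assume "x \<in> \<phi> ` A g"
    then obtain a where a: "x = \<phi> a" "a \<in> A g" by blast
    show "mscale c x \<in> \<phi> ` A g" for c
      using a by (auto intro!: image_eqI[of _ _ "mscale c a"] A_mscale simp: automorphism_mscale[OF \<phi> A_UJ])
    fix y assume "y \<in> \<phi> ` A g"
    then obtain b where b: "y = \<phi> b" "b \<in> A g" by blast
    show "x + y \<in> \<phi> ` A g"
      using a b by (auto intro!: image_eqI[of _ _ "a + b"] A_add simp: automorphism_add[OF \<phi> A_UJ A_UJ])
  qed
  have ex1: "\<exists>!c. (\<forall>g. c g \<in> \<phi> ` A g) \<and> finite {g. c g \<noteq> 0} \<and> v = (\<Sum>g | c g \<noteq> 0. c g)" if v: "v \<in> UJ" for v
  proof -
    have "v \<in> \<phi> ` UJ" using v \<phi> by (simp add: UJ_automorphism_def bij_betw_def)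
    then obtain w where w: "w \<in> UJ" "v = \<phi> w" by blast
    have zero: "\<phi> a = 0 \<longleftrightarrow> a = 0" if "a \<in> UJ" for a
      using automorphism_inj[OF \<phi> that UJ_0] automorphism_0[OF \<phi>] by simp
    have nz: "{g. \<phi> (c g) \<noteq> 0} = {g. c g \<noteq> 0}" if "\<forall>g. c g \<in> A g" for c :: "'g \<Rightarrow> _"
      using that zero A_UJ by blast
    have sum: "(\<Sum>g | \<phi> (c g) \<noteq> 0. \<phi> (c g)) = \<phi> (\<Sum>g | c g \<noteq> 0. c g)" if "\<forall>g. c g \<in> A g" for c :: "'g \<Rightarrow> _"
      unfolding nz[OF that] using that A_UJ by (subst automorphism_sum[OF \<phi>]) auto
    show ?thesis
    proof (rule ex1I[of _ "\<lambda>g. \<phi> (pr A g w)"])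
      show "(\<forall>g. \<phi> (pr A g w) \<in> \<phi> ` A g) \<and> finite {g. \<phi> (pr A g w) \<noteq> 0} \<and>
        v = (\<Sum>g | \<phi> (pr A g w) \<noteq> 0. \<phi> (pr A g w))"
      proof -
        have p: "\<forall>g. pr A g w \<in> A g" using pr_spec(1)[OF w(1)] by blast
        show ?thesis
          using pr_spec(2)[OF w(1)] w(2) p sum[OF p, folded pr_spec(3)[OF w(1)]] by (auto simp: nz[OF p])
      qed
    next
      fix c assume c: "(\<forall>g. c g \<in> \<phi> ` A g) \<and> finite {g. c g \<noteq> 0} \<and> v = (\<Sum>g | c g \<noteq> 0. c g)"
      then have "\<forall>g. \<exists>b. b \<in> A g \<and> c g = \<phi> b" by blast
      then obtain b where b: "\<forall>g. b g \<in> A g" "\<And>g. c g = \<phi> (b g)" by metis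
      have fin: "finite {g. b g \<noteq> 0}" using c nz[OF b(1)] by (simp add: b(2))
      have "\<phi> w = \<phi> (\<Sum>g | b g \<noteq> 0. b g)" using c w(2) by (simp add: b(2) sum[OF b(1)])
      moreover have "(\<Sum>g | b g \<noteq> 0. b g) \<in> UJ" using b(1) A_UJ by (intro UJ_sum) auto
      ultimately have "w = (\<Sum>g | b g \<noteq> 0. b g)" using automorphism_inj[OF \<phi> w(1)] by blast
      then have "pr A g w = (if g \<in> {g. b g \<noteq> 0} then b g else 0)" for g
        using fin b(1) by (intro pr_unique) auto
      then show "c = (\<lambda>g. \<phi> (pr A g w))" using b(2) by auto
    qed
  qed
  have "\<phi> ` A g \<subseteq> UJ" for g using A_UJ automorphism_UJ[OF \<phi>] by blast
  moreover have "x \<circ>\<^sub>J y \<in> \<phi> ` A (g + h)" if xy: "x \<in> \<phi> ` A g" "y \<in> \<phi> ` A h"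
    for x y :: "('k, 'n) sqmat" and g h :: 'g
  proof -
    obtain a b where "x = \<phi> a" "a \<in> A g" "y = \<phi> b" "b \<in> A h" using xy by blast
    then show ?thesis
      by (auto intro!: image_eqI[of _ _ "a \<circ>\<^sub>J b"] A_jordan simp: automorphism_jordan[OF \<phi> A_UJ A_UJ])
  qed
  ultimately show ?thesis
    using sub' ex1 by (simp add: UJ_grading_def direct_sum_decomposition_def)
qed

lemma graded_image: "UJ_automorphism \<phi> \<Longrightarrow> graded_UJ (\<lambda>g. \<phi> ` A g)"
  using grading_image two card2 by (simp add: graded_UJ_def)

end

section \<open>Inner automorphisms and the reflection\<close>

lemma automorphism_conj:
  fixes P Q :: "('k::field, 'n::{finite,linorder}) sqmat"
  assumes "P \<in> UJ" "Q \<in> UJ" "P ** Q = mat 1"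
  shows "UJ_automorphism (\<lambda>a. P ** a ** Q)"
proof -
  have QP: "Q ** P = mat 1" using assms(3) matrix_left_right_inverse by blast
  have 1: "Q ** (P ** a ** Q) ** P = a" "P ** (Q ** a ** P) ** Q = a" for a
    using QP assms(3) by (metis matrix_mul_assoc matrix_mul_lid matrix_mul_rid)+
  have 2: "(P ** a ** Q) ** (P ** b ** Q) = P ** (a ** b) ** Q" for a b
    using QP by (metis matrix_mul_assoc matrix_mul_rid)
  have "bij_betw (\<lambda>a. P ** a ** Q) UJ UJ"
    by (rule bij_betw_byWitness[where f' = "\<lambda>a. Q ** a ** P"]) (use assms 1 in \<open>auto intro!: UJ_mult\<close>)
  then show ?thesis
    unfolding UJ_automorphism_def jordan_def 2 by (simp add: mult_distribs)
qed

text \<open>Transposition along the antidiagonal. Unlike the ordinary transpose it preserves upper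
  triangular matrices; it reverses associative products and therefore respects the Jordan
  product.\<close>

definition flip_mat :: "('k::field, 'n::{finite,linorder}) sqmat \<Rightarrow> ('k, 'n) sqmat" where
  "flip_mat a = mk (\<lambda>i j. ent a (CARD('n) - 1 - j) (CARD('n) - 1 - i))"

lemma flip_mult:
  fixes a b :: "('k::field, 'n::{finite,linorder}) sqmat"
  shows "flip_mat a ** flip_mat b = flip_mat (b ** a)"
proof (rule mat_eqI)
  fix i j assume ij: "i < CARD('n)" "j < CARD('n)"
  have "ent (flip_mat a ** flip_mat b) i j
    = (\<Sum>k<CARD('n). ent a (CARD('n) - 1 - k) (CARD('n) - 1 - i) * ent b (CARD('n) - 1 - j) (CARD('n) - 1 - k))"
    unfolding ent_mult by (rule sum.cong) (use ij in \<open>auto simp: flip_mat_def\<close>)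
  also have "\<dots> = (\<Sum>k<CARD('n). ent a k (CARD('n) - 1 - i) * ent b (CARD('n) - 1 - j) k)"
    using sum.nat_diff_reindex[of "\<lambda>k. ent a k (CARD('n) - 1 - i) * ent b (CARD('n) - 1 - j) k" "CARD('n)"] by simp
  also have "\<dots> = ent (flip_mat (b ** a)) i j"
    using ij by (simp add: flip_mat_def ent_mult mult.commute)
  finally show "ent (flip_mat a ** flip_mat b) i j = ent (flip_mat (b ** a)) i j" .
qed

lemma automorphism_flip: "UJ_automorphism (flip_mat :: ('k::field, 'n::{finite,linorder}) sqmat \<Rightarrow> _)"
proof -
  have UJ: "flip_mat a \<in> UJ" if "a \<in> UJ" for a :: "('k, 'n) sqmat"
    using that unfolding UJ_iff by (auto simp: flip_mat_def)
  have inv: "flip_mat (flip_mat a) = a" for a :: "('k, 'n) sqmat"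
    by (rule mat_eqI) (auto simp: flip_mat_def)
  have add: "flip_mat (a + b) = flip_mat a + flip_mat b" for a b :: "('k, 'n) sqmat"
    by (rule mat_eqI) (auto simp: flip_mat_def)
  have scale: "flip_mat (mscale c a) = mscale c (flip_mat a)" for c and a :: "('k, 'n) sqmat"
    by (rule mat_eqI) (auto simp: flip_mat_def)
  have "bij_betw flip_mat UJ (UJ :: ('k, 'n) sqmat set)"
    by (rule bij_betw_byWitness[where f' = flip_mat]) (use UJ inv in auto)
  then show ?thesis
    unfolding UJ_automorphism_def jordan_def by (simp add: add scale flip_mult add.commute)
qed

lemma flip_E:
  "i < CARD('n) \<Longrightarrow> j < CARD('n) \<Longrightarrow>
    flip_mat (E i j :: ('k::field, 'n::{finite,linorder}) sqmat) = E (CARD('n) - 1 - j) (CARD('n) - 1 - i)"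
  by (rule mat_eqI) (auto simp: flip_mat_def)

text \<open>The matrix \<open>P\<close> intertwines the two families: \<open>P ** F j\<close> and
  \<open>E j j ** P\<close> both equal \<open>E j j ** F j\<close>. The entry 1 of
  \<open>F j\<close> at \<open>(j, j)\<close> makes \<open>Q\<close> its inverse.\<close>

lemma diagonalize_idempotents:
  fixes F :: "nat \<Rightarrow> ('k::field, 'n::{finite,linorder}) sqmat"
  assumes "\<And>i. i < CARD('n) \<Longrightarrow> F i \<in> UJ"
    and "\<And>i. i < CARD('n) \<Longrightarrow> ent (F i) i i = 1"
    and "\<And>i. i < CARD('n) \<Longrightarrow> F i ** F i = F i"
    and "\<And>i j. i < CARD('n) \<Longrightarrow> j < CARD('n) \<Longrightarrow> i \<noteq> j \<Longrightarrow> F i ** F j = 0"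
  shows "\<exists>\<phi>. UJ_automorphism \<phi> \<and> (\<forall>i<CARD('n). \<phi> (F i) = E i i)"
proof -
  define P where "P = (\<Sum>i<CARD('n). E i i ** F i)"
  define Q where "Q = (\<Sum>i<CARD('n). F i ** E i i)"
  have UJ: "P \<in> UJ" "Q \<in> UJ" unfolding P_def Q_def using assms(1) by (auto intro!: UJ_sum UJ_mult)
  have PF: "P ** F j = E j j ** F j" if "j < CARD('n)" for j
  proof -
    have "P ** F j = (\<Sum>i<CARD('n). if i = j then E j j ** F j else 0)"
      unfolding P_def mult_sum_left
      by (rule sum.cong) (use assms(3,4) that in \<open>auto simp: mult_distribs simp flip: matrix_mul_assoc\<close>)
    then show ?thesis using that by simp
  qed
  have EFE: "E j j ** F j ** E j j = E j j" if "j < CARD('n)" for j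
    by (rule mat_eqI) (use that assms(2) in \<open>auto simp: ent_E_mult\<close>)
  have "P ** Q = (\<Sum>j<CARD('n). E j j ** F j ** E j j)"
    unfolding Q_def mult_sum_right by (rule sum.cong) (auto simp: PF matrix_mul_assoc)
  also have "\<dots> = mat 1" unfolding mat_E_sum by (rule sum.cong) (auto simp: EFE)
  finally have PQ: "P ** Q = mat 1" .
  have "E j j ** P = E j j ** F j" if "j < CARD('n)" for j
  proof -
    have "E j j ** P = (\<Sum>i<CARD('n). if i = j then E j j ** F j else 0)"
      unfolding P_def mult_sum_right
      by (rule sum.cong) (use that in \<open>auto simp: matrix_mul_assoc E_mult mult_distribs\<close>)
    then show ?thesis using that by simp
  qed
  then have "P ** F j ** Q = E j j" if "j < CARD('n)" for j
    using PF that PQ by (metis matrix_mul_assoc matrix_mul_rid)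
  then show ?thesis using automorphism_conj[OF UJ PQ] by auto
qed

subsection \<open>Diagonal normal forms\<close>

context graded_UJ
begin

text \<open>The cases \<open>c = 1\<close> and \<open>c = - 1\<close> are symmetric and
  antisymmetric diagonals. The degree 0 and degree \<open>t\<close> components supply the symmetric
  and antisymmetric parts of the diagonal of \<open>v\<close>, and this splitting is unique as 2 is
  invertible.\<close>

lemma mirror_diag:
  assumes m: "mirror A t" and v: "v \<in> UJ"
    and "\<And>i. i < CARD('n) \<Longrightarrow> ent v (CARD('n) - 1 - i) (CARD('n) - 1 - i) = c * ent v i i"
  shows "c = 1 \<Longrightarrow> i < CARD('n) \<Longrightarrow> ent (pr A 0 v) i i = ent v i i"
    and "c = - 1 \<Longrightarrow> i < CARD('n) \<Longrightarrow> ent (pr A t v) i i = ent v i i"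
proof -
  let ?r = "\<lambda>i. CARD('n) - 1 - i"
  have t: "t \<noteq> 0" using m by (simp add: mirror_def)
  have s: "ent v i i = ent (pr A 0 v) i i + ent (pr A t v) i i" if "i < CARD('n)" for i
  proof (rule diag_two_components[OF v t])
    fix g assume "g \<noteq> 0" "g \<noteq> t"
    then have "pr A g v \<in> J 1" using m pr_spec(1)[OF v] by (auto simp: mirror_def)
    then show "ent (pr A g v) i i = 0" using that by (metis J_1_iff)
  qed
  have sym: "ent (pr A 0 v) (?r i) (?r i) = ent (pr A 0 v) i i" if "i < CARD('n)" for i
    using m pr_spec(1)[OF v] that by (auto simp: mirror_def)
  have anti: "ent (pr A t v) (?r i) (?r i) = - ent (pr A t v) i i" if "i < CARD('n)" for i
    using diag_antisymmetric[OF pr_spec(1)[OF v] t that] .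
  { assume i: "i < CARD('n)"
    then have r: "?r i < CARD('n)" by auto
    have e: "ent (pr A 0 v) i i - ent (pr A t v) i i = c * (ent (pr A 0 v) i i + ent (pr A t v) i i)"
      using assms(3)[OF i] s[OF i] s[OF r] sym[OF i] anti[OF i] by simp
    { assume "c = 1"
      then have "2 * ent (pr A t v) i i = 0" using e by (simp add: algebra_simps)
      then show "ent (pr A 0 v) i i = ent v i i" using s[OF i] two by simp }
    { assume "c = - 1"
      then have "2 * ent (pr A 0 v) i i = 0" using e by (simp add: algebra_simps)
      then show "ent (pr A t v) i i = ent v i i" using s[OF i] two by simp } }
qed

lemma trivial_diag:
  assumes "trivial_diagonal A" "v \<in> UJ" "i < CARD('n)"
  shows "ent (pr A 0 v) i i = ent v i i"
proof -
  have z: "ent (pr A g v) i i = 0" if "g \<noteq> 0" for g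
    using assms that pr_spec(1)[OF assms(2)] unfolding trivial_diagonal_def by (metis J_1_iff subsetD)
  have "ent v i i = (\<Sum>g\<in>degrees. ent (pr A g v) i i)"
    using pr_decompose[OF assms(2)] by (metis ent_sum)
  also have "\<dots> = (\<Sum>g\<in>insert 0 degrees. ent (pr A g v) i i)"
    using pr_not_degree[OF assms(2)] finite_degrees by (intro sum.mono_neutral_left) auto
  also have "\<dots> = (\<Sum>g\<in>{0}. ent (pr A g v) i i)"
    using z finite_degrees by (intro sum.mono_neutral_right) auto
  finally show ?thesis by simp
qed

lemma normalize_trivial:
  assumes "trivial_diagonal A"
  shows "\<exists>\<phi>. UJ_automorphism \<phi> \<and> (\<forall>i<CARD('n). E i i \<in> \<phi> ` A 0)"
proof -
  let ?u = "\<lambda>l. pr A 0 (E l l)"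
  have du: "ent (?u l) i i = (if i = l then 1 else 0)" if "i < CARD('n)" for l i
    using trivial_diag[OF assms, of "E l l"] that by simp
  have "\<exists>a. \<forall>l<CARD('n). a l \<in> A 0 \<and> (\<forall>i<CARD('n). ent (a l) i i = ent (?u l) i i) \<and>
    a l ** (a l ** a l) = a l \<and> (\<forall>m<CARD('n). m \<noteq> l \<longrightarrow> a l ** a m = 0)"
    by (rule lift_tripotent_family) (auto simp: du pr_spec(1))
  then obtain a where a: "\<And>l. l < CARD('n) \<Longrightarrow> a l \<in> A 0"
      "\<And>l i. l < CARD('n) \<Longrightarrow> i < CARD('n) \<Longrightarrow> ent (a l) i i = ent (?u l) i i"
      "\<And>l. l < CARD('n) \<Longrightarrow> a l ** (a l ** a l) = a l"
      "\<And>l m. l < CARD('n) \<Longrightarrow> m < CARD('n) \<Longrightarrow> m \<noteq> l \<Longrightarrow> a l ** a m = 0"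
    by blast
  \<comment> \<open>The square of a tripotent is idempotent; here its diagonal is again that of
    \<open>E l l\<close>.\<close>
  define F where "F l = a l ** a l" for l
  have UJ: "a l \<in> UJ" if "l < CARD('n)" for l using A_UJ[OF a(1)[OF that]] .
  have FA: "F l \<in> A 0" if "l < CARD('n)" for l
    unfolding F_def using a(1)[OF that] by (intro square_A0) auto
  have "\<exists>\<phi>. UJ_automorphism \<phi> \<and> (\<forall>i<CARD('n). \<phi> (F i) = E i i)"
  proof (rule diagonalize_idempotents)
      show "F i \<in> UJ" if "i < CARD('n)" for i using A_UJ[OF FA[OF that]] .
      show "ent (F i) i i = 1" if "i < CARD('n)" for i
        using that UJ a(2) du by (simp add: F_def diag_mult)
      show "F i ** F i = F i" if "i < CARD('n)" for i
        using a(3)[OF that] by (simp add: F_def matrix_mul_assoc)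
      show "F i ** F j = 0" if "i < CARD('n)" "j < CARD('n)" "i \<noteq> j" for i j
      proof -
        have "F i ** F j = a i ** (a i ** a j) ** a j" by (simp add: F_def matrix_mul_assoc)
        then show ?thesis using a(4)[of i j] that by (simp add: mult_distribs)
      qed
  qed
  then obtain \<phi> where \<phi>: "UJ_automorphism \<phi>" "\<forall>i<CARD('n). \<phi> (F i) = E i i" by blast
  have "E i i \<in> \<phi> ` A 0" if "i < CARD('n)" for i
    using \<phi>(2) FA[OF that] that by (metis image_eqI)
  then show ?thesis using \<phi>(1) by blast
qed

text \<open>For a pair of mirror indices the difference of units is lifted in degree
  \<open>t\<close>, for a fixed index the unit itself in degree 0. The idempotents of a lift
  \<open>a\<close> for the eigenvalues 1 and -1 have sum \<open>a ** a\<close> and difference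
  \<open>a\<close>, which are homogeneous.\<close>

lemma normalize_mirror:
  assumes m: "mirror A t"
  shows "\<exists>\<phi>. UJ_automorphism \<phi> \<and> (\<forall>i<CARD('n).
    E i i + E (CARD('n) - 1 - i) (CARD('n) - 1 - i) \<in> \<phi> ` A 0 \<and>
    E i i - E (CARD('n) - 1 - i) (CARD('n) - 1 - i) \<in> \<phi> ` A t)"
proof -
  \<comment> \<open>The number of orbits of the reflection; the indices below \<open>r\<close>
    represent them.\<close>
  define r where "r = (CARD('n) + 1) div 2"
  define M where "M i = CARD('n) - 1 - i" for i
  have M: "M i < CARD('n)" "M (M i) = i" if "i < CARD('n)" for i using that by (auto simp: M_def)
  have rn: "l < CARD('n)" "l \<le> M l" if "l < r" for l using that by (auto simp: M_def r_def)
  have rM: "M i < r" "M i < i" if "\<not> i < r" "i < CARD('n)" for i using that by (auto simp: M_def r_def)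
  have Mr: "\<not> M l < r" if "l < r" "l \<noteq> M l" for l using that by (auto simp: M_def r_def)
  define s where "s l = (if l = M l then 0 else t)" for l
  define u where "u l = (if l = M l then pr A 0 (E l l) else pr A t (E l l - E (M l) (M l)))" for l
  have uA: "u l \<in> A (s l)" for l
    unfolding u_def s_def by (auto intro!: pr_spec(1) UJ_diff)
  have ss: "s l + s l = 0" for l using m by (simp add: s_def mirror_def)
  have du: "ent (u l) i i = (if i = l then 1 else if i = M l then - 1 else 0)" if l: "l < r" and i: "i < CARD('n)" for l i
  proof (cases "l = M l")
    case True
    have "ent (pr A 0 (E l l)) i i = ent (E l l :: ('k, 'n) sqmat) i i"
      by (rule mirror_diag(1)[OF m, of _ 1])
        (use i rn[OF l] True in \<open>auto simp: M_def\<close>)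
    then show ?thesis using True i by (auto simp: u_def)
  next
    case False
    have "ent (pr A t (E l l - E (M l) (M l))) i i = ent (E l l - E (M l) (M l) :: ('k, 'n) sqmat) i i"
      by (rule mirror_diag(2)[OF m, of _ "- 1"])
        (use i rn[OF l] False in \<open>auto simp: M_def UJ_diff\<close>)
    then show ?thesis using False i by (auto simp: u_def)
  qed
  have "\<exists>a. \<forall>l<r. a l \<in> A (s l) \<and> (\<forall>i<CARD('n). ent (a l) i i = ent (u l) i i) \<and>
    a l ** (a l ** a l) = a l \<and> (\<forall>m<r. m \<noteq> l \<longrightarrow> a l ** a m = 0)"
  proof (rule lift_tripotent_family)
    fix l k i assume *: "l < r" "k < r" "l \<noteq> k" "i < CARD('n)"
    then show "ent (u l) i i * ent (u k) i i = 0"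
      using rn[OF *(1)] rn[OF *(2)] by (auto simp: du M_def)
  qed (auto simp: uA ss du)
  then obtain a where a: "\<And>l. l < r \<Longrightarrow> a l \<in> A (s l)"
      "\<And>l i. l < r \<Longrightarrow> i < CARD('n) \<Longrightarrow> ent (a l) i i = ent (u l) i i"
      "\<And>l. l < r \<Longrightarrow> a l ** (a l ** a l) = a l"
      "\<And>l m. l < r \<Longrightarrow> m < r \<Longrightarrow> m \<noteq> l \<Longrightarrow> a l ** a m = 0"
    by blast
  have aUJ: "a l \<in> UJ" if "l < r" for l using A_UJ[OF a(1)[OF that]] .
  define h where "h = inverse (2 :: 'k)"
  have h: "2 * h = 1" using two by (simp add: h_def)
  define p where "p l = mscale h (a l ** a l + a l)" for l
  define q where "q l = mscale h (a l ** a l - a l)" for l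
  have pp: "p l ** p l = p l" "q l ** q l = q l" "p l ** q l = 0" "q l ** p l = 0" if "l < r" for l
  proof -
    show "p l ** p l = p l" "q l ** q l = q l"
      unfolding p_def q_def mult_distribs matrix_mul_assoc[symmetric] a(3)[OF that]
      by (rule mat_eqI; simp only: ent_mscale ent_add ent_diff; use h in algebra)+
    show "p l ** q l = 0" "q l ** p l = 0"
      unfolding p_def q_def mult_distribs matrix_mul_assoc[symmetric] a(3)[OF that]
      by (simp_all add: add.commute flip: mat.scale_right_distrib)
  qed
  have sum: "p l + q l = a l ** a l" "p l - q l = a l" for l
    unfolding p_def q_def
    by (rule mat_eqI; simp only: ent_mscale ent_add ent_diff; use h in algebra)+
  have fact: "\<exists>c d. p l = a l ** c \<and> p l = d ** a l" "\<exists>c d. q l = a l ** c \<and> q l = d ** a l" for l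
  proof -
    have "p l = a l ** mscale h (a l + mat 1)" "p l = mscale h (a l + mat 1) ** a l"
      "q l = a l ** mscale h (a l - mat 1)" "q l = mscale h (a l - mat 1) ** a l"
      by (simp_all add: p_def q_def mult_distribs)
    then show "\<exists>c d. p l = a l ** c \<and> p l = d ** a l" "\<exists>c d. q l = a l ** c \<and> q l = d ** a l" by blast+
  qed
  have zero: "x ** y = 0" if lk: "l < r" "k < r" "l \<noteq> k" "x = p l \<or> x = q l" "y = p k \<or> y = q k" for x y l k
  proof -
    obtain d where "x = d ** a l" using fact[of l] lk(4) by blast
    moreover obtain c where "y = a k ** c" using fact[of k] lk(5) by blast
    ultimately have "x ** y = d ** (a l ** a k) ** c" by (simp add: matrix_mul_assoc)
    then show ?thesis using a(4)[of l k] lk by (simp add: mult_distribs)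
  qed
  \<comment> \<open>The lift for the orbit of \<open>l\<close> has diagonal entry 1 at
    \<open>l\<close> and -1 at a distinct mirror index, so \<open>p\<close> serves the
    representative and \<open>q\<close> its mirror image.\<close>
  define F where "F i = (if i < r then p i else q (M i))" for i
  have "\<exists>\<phi>. UJ_automorphism \<phi> \<and> (\<forall>i<CARD('n). \<phi> (F i) = E i i)"
  proof (rule diagonalize_idempotents)
    fix i assume i: "i < CARD('n)"
    show "F i \<in> UJ"
      using i aUJ rM(1) by (auto simp: F_def p_def q_def intro!: UJ_mscale UJ_add UJ_diff UJ_mult)
    show "F i ** F i = F i" using i rM(1) pp by (auto simp: F_def)
    show "ent (F i) i i = 1"
    proof (cases "i < r")
      case True
      then have "ent (F i) i i = h * (1 + 1)"
        using i aUJ a(2) du by (simp add: F_def p_def diag_mult)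
      then show ?thesis using h by (simp add: mult.commute)
    next
      case False
      have "ent (a (M i)) i i = - 1" using rM[OF False i] a(2) du M(2)[OF i] i by auto
      then have "ent (F i) i i = h * (1 + 1)"
        using i False aUJ[OF rM(1)[OF False i]] by (simp add: F_def q_def diag_mult)
      then show ?thesis using h by (simp add: mult.commute)
    qed
    fix j assume j: "j < CARD('n)" "i \<noteq> j"
    define i' j' where "i' = (if i < r then i else M i)" and "j' = (if j < r then j else M j)"
    have r: "i' < r" "j' < r" using rM i j by (auto simp: i'_def j'_def)
    show "F i ** F j = 0"
    proof (cases "i' = j'")
      case False
      show ?thesis by (rule zero[OF r False]) (auto simp: F_def i'_def j'_def)
    next
      case True
      then have "(F i = p i' \<and> F j = q i') \<or> (F i = q i' \<and> F j = p i')"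
        using i j M(2) by (auto simp: F_def i'_def j'_def split: if_splits) metis
      then show ?thesis using pp r by auto
    qed
  qed
  then obtain \<phi> where \<phi>: "UJ_automorphism \<phi>" "\<And>i. i < CARD('n) \<Longrightarrow> \<phi> (F i) = E i i" by blast
  have FUJ: "F i \<in> UJ" if "i < CARD('n)" for i
    using that aUJ rM(1) by (auto simp: F_def p_def q_def intro!: UJ_mscale UJ_add UJ_diff UJ_mult)
  have FA: "F i + F (M i) \<in> A 0 \<and> F i - F (M i) \<in> A t" if i: "i < CARD('n)" for i
  proof -
    have sq: "a l ** a l \<in> A 0" if "l < r" for l using square_A0[OF a(1)[OF that] ss] .
    consider "i < r" "i = M i" | "i < r" "i \<noteq> M i" | "\<not> i < r" by blast
    then show ?thesis
    proof cases
      case 1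
      have "a i \<in> A 0" using a(1)[OF 1(1)] 1(2) by (simp add: s_def)
      then have "p i \<in> A 0" unfolding p_def using sq[OF 1(1)] by (intro A_mscale A_add)
      then have "F i \<in> A 0" using 1(1) by (simp add: F_def)
      then show ?thesis unfolding 1(2)[symmetric] by (simp only: A_add diff_self A_zero simp_thms)
    next
      case 2
      then have "F i = p i" "F (M i) = q i" using Mr[OF 2] M(2)[OF i] by (auto simp: F_def)
      then show ?thesis using sum[of i] sq[OF 2(1)] a(1)[OF 2(1)] 2(2) by (simp add: s_def)
    next
      case 3
      have "M i \<noteq> M (M i)" using rM(2)[OF 3 i] M(2)[OF i] by simp
      then have "a (M i) \<in> A t" using a(1)[OF rM(1)[OF 3 i]] by (simp add: s_def)
      moreover have "F i = q (M i)" "F (M i) = p (M i)" using 3 rM(1)[OF 3 i] by (auto simp: F_def)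
      moreover have "q (M i) + p (M i) = a (M i) ** a (M i)"
        by (subst add.commute) (rule sum)
      moreover have "q (M i) - p (M i) = mscale (- 1) (a (M i))"
        by (subst minus_diff_eq[symmetric]) (simp add: sum del: minus_diff_eq)
      ultimately show ?thesis using sq[OF rM(1)[OF 3 i]] A_mscale[of "a (M i)" t "- 1"] by simp
    qed
  qed
  have "E i i + E (M i) (M i) \<in> \<phi> ` A 0 \<and> E i i - E (M i) (M i) \<in> \<phi> ` A t" if i: "i < CARD('n)" for i
  proof -
    have "\<phi> (F i + F (M i)) = E i i + E (M i) (M i)" "\<phi> (F i - F (M i)) = E i i - E (M i) (M i)"
      using automorphism_add[OF \<phi>(1) FUJ FUJ] automorphism_diff[OF \<phi>(1) FUJ FUJ] \<phi>(2) M(1) i by simp_all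
    then show ?thesis using FA[OF i] by (metis image_eqI)
  qed
  then show ?thesis using \<phi>(1) unfolding M_def by blast
qed

end

subsection \<open>Polynomial functions\<close>

text \<open>Identities depend only on the map that a polynomial induces on substitutions. With
  closure under the operations, polynomials can be written as matrix expressions in the substitution
  instead of elements of the free algebra.\<close>

definition polyfun :: "(('x \<Rightarrow> ('k::field, 'n::{finite,linorder}) sqmat) \<Rightarrow> ('k, 'n) sqmat) \<Rightarrow> bool" where
  "polyfun F \<longleftrightarrow> (\<exists>f. \<forall>\<sigma>. F \<sigma> = eval_poly \<sigma> f)"

lemma eval_poly_superset:
  assumes "finite T" "Poly_Mapping.keys f \<subseteq> T"
  shows "eval_poly \<sigma> f = (\<Sum>m\<in>T. mscale (Poly_Mapping.lookup f m) (eval_monom \<sigma> m))"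
  unfolding eval_poly_def
  by (rule sum.mono_neutral_left) (use assms in \<open>auto simp: in_keys_iff\<close>)

lemma polyfun_add:
  assumes "polyfun F" "polyfun G"
  shows "polyfun (\<lambda>\<sigma>. F \<sigma> + G \<sigma>)"
proof -
  obtain f g where fg: "\<And>\<sigma>. F \<sigma> = eval_poly \<sigma> f" "\<And>\<sigma>. G \<sigma> = eval_poly \<sigma> g"
    using assms by (auto simp: polyfun_def)
  let ?T = "Poly_Mapping.keys f \<union> Poly_Mapping.keys g"
  have "F \<sigma> + G \<sigma> = eval_poly \<sigma> (f + g)" for \<sigma>
    unfolding fg using eval_poly_superset[of ?T f \<sigma>] eval_poly_superset[of ?T g \<sigma>]
      eval_poly_superset[of ?T "f + g" \<sigma>] Poly_Mapping.keys_add[of f g]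
    by (simp add: lookup_add mat.scale_left_distrib sum.distrib)
  then show ?thesis by (auto simp: polyfun_def)
qed

lemma polyfun_monom: "polyfun (\<lambda>\<sigma>. mscale c (eval_monom \<sigma> m))"
proof -
  have "eval_poly \<sigma> (Poly_Mapping.single m c) = mscale c (eval_monom \<sigma> m)" for \<sigma>
    using eval_poly_superset[of "{m}" "Poly_Mapping.single m c" \<sigma>] by auto
  then show ?thesis by (metis polyfun_def)
qed

lemma polyfun_var: "polyfun (\<lambda>\<sigma>. \<sigma> x)"
  using polyfun_monom[of 1 "Var x"] by simp

lemma polyfun_zero: "polyfun (\<lambda>\<sigma>. 0)"
  using polyfun_monom[of 0 "Var undefined"] by simp

lemma polyfun_sum:
  "(\<And>x. x \<in> X \<Longrightarrow> polyfun (F x)) \<Longrightarrow> polyfun (\<lambda>\<sigma>. \<Sum>x\<in>X. F x \<sigma>)"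
  by (induction X rule: infinite_finite_induct) (auto simp: polyfun_zero polyfun_add)

lemma polyfun_expand:
  assumes "polyfun F"
  obtains S c where "finite S" "\<And>\<sigma>. F \<sigma> = (\<Sum>m\<in>S. mscale (c m) (eval_monom \<sigma> m))"
  using assms that unfolding polyfun_def eval_poly_def by (metis finite_keys)

lemma polyfun_mscale:
  assumes "polyfun F"
  shows "polyfun (\<lambda>\<sigma>. mscale c (F \<sigma>))"
proof -
  obtain S d where "\<And>\<sigma>. F \<sigma> = (\<Sum>m\<in>S. mscale (d m) (eval_monom \<sigma> m))"
    using polyfun_expand[OF assms] by metis
  then have "(\<lambda>\<sigma>. mscale c (F \<sigma>)) = (\<lambda>\<sigma>. \<Sum>m\<in>S. mscale (c * d m) (eval_monom \<sigma> m))"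
    by (simp add: mat.scale_sum_right)
  then show ?thesis by (simp add: polyfun_sum polyfun_monom)
qed

lemma polyfun_diff:
  assumes "polyfun F" "polyfun G"
  shows "polyfun (\<lambda>\<sigma>. F \<sigma> - G \<sigma>)"
  using polyfun_add[OF assms(1) polyfun_mscale[OF assms(2), of "- 1"]] by simp

lemma polyfun_jordan:
  assumes "polyfun F" "polyfun G"
  shows "polyfun (\<lambda>\<sigma>. F \<sigma> \<circ>\<^sub>J G \<sigma>)"
proof -
  obtain S c where F: "\<And>\<sigma>. F \<sigma> = (\<Sum>m\<in>S. mscale (c m) (eval_monom \<sigma> m))"
    using polyfun_expand[OF assms(1)] by metis
  obtain T d where G: "\<And>\<sigma>. G \<sigma> = (\<Sum>m\<in>T. mscale (d m) (eval_monom \<sigma> m))"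
    using polyfun_expand[OF assms(2)] by metis
  have "(\<lambda>\<sigma>. F \<sigma> \<circ>\<^sub>J G \<sigma>) = (\<lambda>\<sigma>. \<Sum>m\<in>S. \<Sum>m'\<in>T. mscale (d m' * c m) (eval_monom \<sigma> (Mul m m')))"
  proof (rule ext)
    fix \<sigma>
    have "F \<sigma> \<circ>\<^sub>J G \<sigma> = (\<Sum>m\<in>S. mscale (c m) (eval_monom \<sigma> m) \<circ>\<^sub>J G \<sigma>)"
      unfolding F by (rule jordan_sum_left)
    also have "\<dots> = (\<Sum>m\<in>S. \<Sum>m'\<in>T. mscale (d m' * c m) (eval_monom \<sigma> (Mul m m')))"
      unfolding G jordan_sum_right by (simp add: jordan_distribs mult.commute)
    finally show "F \<sigma> \<circ>\<^sub>J G \<sigma> = (\<Sum>m\<in>S. \<Sum>m'\<in>T. mscale (d m' * c m) (eval_monom \<sigma> (Mul m m')))" .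
  qed
  then show ?thesis by (simp only: polyfun_sum polyfun_monom)
qed

lemma same_identities_polyfun:
  fixes A B :: "'g \<Rightarrow> ('k::field, 'n::{finite,linorder}) sqmat set"
    and F :: "(nat \<times> 'g \<Rightarrow> ('k, 'n) sqmat) \<Rightarrow> ('k, 'n) sqmat"
  assumes "graded_identities A = graded_identities B" "polyfun F"
    and "\<And>\<sigma>. (\<And>i g. \<sigma> (i, g) \<in> B g) \<Longrightarrow> F \<sigma> = 0" "\<And>i g. \<sigma> (i, g) \<in> A g"
  shows "F \<sigma> = 0"
proof -
  obtain f where f: "\<And>\<sigma>. F \<sigma> = eval_poly \<sigma> f" using assms(2) by (auto simp: polyfun_def)
  have "f \<in> graded_identities B" using assms(3) by (auto simp: graded_identities_def f)
  then have "f \<in> graded_identities A" using assms(1) by simp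
  then show ?thesis using assms(4) by (auto simp: graded_identities_def f)
qed

primrec jordan_pow :: "('k::field, 'n::{finite,linorder}) sqmat \<Rightarrow> nat \<Rightarrow> ('k, 'n) sqmat" where
  "jordan_pow a 0 = a"
| "jordan_pow a (Suc k) = jordan_pow a k \<circ>\<^sub>J a"

lemma identities_degree_nilpotent:
  fixes A B :: "'g::group_add \<Rightarrow> ('k::field, 'n::{finite,linorder}) sqmat set"
  assumes "graded_identities A = graded_identities B" "graded_UJ A" "graded_UJ B" "B g \<subseteq> J 1"
  shows "A g \<subseteq> J 1"
proof
  interpret A: graded_UJ A by fact
  interpret B: graded_UJ B by fact
  fix a assume a: "a \<in> A g"
  have aUJ: "a \<in> UJ" using A.A_UJ[OF a] .
  have pf: "polyfun (\<lambda>\<sigma> :: nat \<times> 'g \<Rightarrow> ('k, 'n) sqmat. jordan_pow (\<sigma> (0, g)) k)" for k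
    by (induction k) (auto intro: polyfun_var polyfun_jordan)
  have J: "jordan_pow b k \<in> J (Suc k)" if "b \<in> J 1" for b :: "('k, 'n) sqmat" and k
    using that J_jordan[of _ _ b 1] by (induction k) auto
  have UJ: "jordan_pow a k \<in> UJ" for k by (induction k) (auto intro: UJ_jordan aUJ)
  define \<sigma> where "\<sigma> p = (if p = (0::nat, g) then a else 0)" for p
  have "jordan_pow (\<sigma> (0, g)) CARD('n) = 0"
  proof (rule same_identities_polyfun[OF assms(1) pf])
    show "jordan_pow (\<tau> (0, g)) CARD('n) = 0" if "\<And>i g. \<tau> (i, g) \<in> B g" for \<tau>
      by (rule J_top[OF _ J]) (use that assms(4) in auto)
    show "\<sigma> (i, h) \<in> A h" for i h using a by (auto simp: \<sigma>_def)
  qed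
  then have 0: "jordan_pow a CARD('n) = 0" by (simp add: \<sigma>_def)
  have "ent a i i = 0" if i: "i < CARD('n)" for i
  proof -
    have "ent (jordan_pow a k) i i = 2 ^ k * ent a i i ^ Suc k" for k
      using i by (induction k) (auto simp: diag_jordan UJ aUJ algebra_simps)
    from this[of "CARD('n)"] show ?thesis using 0 A.two by simp
  qed
  then show "a \<in> J 1" using aUJ by (subst J_1_iff) auto
qed

subsection \<open>A polynomial detecting the superdiagonal\<close>

text \<open>The Jordan triple product, up to scaling. Its middle argument stands between the outer
  ones in both orders, which ties it to the vertex where they meet. Over a noncommutative group its
  terms may differ in degree; graded identities may well be inhomogeneous.\<close>

definition triple :: "('k::field, 'n::{finite,linorder}) sqmat \<Rightarrow> ('k, 'n) sqmat \<Rightarrow> ('k, 'n) sqmat \<Rightarrow> ('k, 'n) sqmat" where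
  "triple a b c = (a \<circ>\<^sub>J b) \<circ>\<^sub>J c + a \<circ>\<^sub>J (b \<circ>\<^sub>J c) - (a \<circ>\<^sub>J c) \<circ>\<^sub>J b"

lemma triple_eq: "triple a b c = mscale 2 (a ** b ** c + c ** b ** a)"
proof (rule mat_eqI)
  show "ent (triple a b c) i j = ent (mscale 2 (a ** b ** c + c ** b ** a)) i j" for i j
    unfolding triple_def jordan_def mult_distribs matrix_mul_assoc ent_mscale ent_diff ent_add by algebra
qed

text \<open>The start evaluates \<open>Y 0\<close> at an end of the edge occupied by
  \<open>X 0\<close>. If that end is an interior vertex, it is also the junction of another factor;
  alternation destroys this repetition.\<close>

primrec chain :: "(nat \<Rightarrow> ('k::field, 'n::{finite,linorder}) sqmat) \<Rightarrow> (nat \<Rightarrow> ('k, 'n) sqmat) \<Rightarrow> nat \<Rightarrow> ('k, 'n) sqmat" where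
  "chain X Y 0 = X 0 \<circ>\<^sub>J Y 0"
| "chain X Y (Suc l) = triple (chain X Y l) (Y (Suc l)) (X (Suc l))"

text \<open>
  \<open>growth x b l a y\<close> is the contribution to the entry \<open>(a, a + l + 1)\<close> of \<^const>\<open>chain\<close> in which
  \<open>X 0\<close> is placed at \<open>(b, b + 1)\<close> and the other factors extend it to the right or to the left.
\<close>

primrec growth :: "(nat \<Rightarrow> nat \<Rightarrow> 'k::field) \<Rightarrow> nat \<Rightarrow> nat \<Rightarrow> nat \<Rightarrow> (nat \<Rightarrow> nat \<Rightarrow> 'k) \<Rightarrow> 'k" where
  "growth x b 0 a y = (if a = b then 1 else 0)"
| "growth x b (Suc l) a y = 2 * (growth x b l a y * (x (Suc l) (a + Suc l) * y (Suc l) (a + Suc l))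
     + growth x b l (Suc a) y * (x (Suc l) a * y (Suc l) (Suc a)))"

lemma chain_J:
  assumes "\<And>i. X i \<in> J 1" "\<And>i. Y i \<in> UJ"
  shows "chain X Y l \<in> J (Suc l)"
proof (induction l)
  case 0 then show ?case using J_jordan[of "X 0" 1 "Y 0" 0] assms by (simp add: J_0)
next
  case (Suc l)
  have "chain X Y l ** Y (Suc l) ** X (Suc l) \<in> J (Suc l + 0 + 1)"
    "X (Suc l) ** Y (Suc l) ** chain X Y l \<in> J (1 + 0 + Suc l)"
    using Suc assms by (intro J_mult; simp add: J_0)+
  then show ?case by (simp add: triple_eq J_mscale J_add)
qed

text \<open>Only leading entries of the factors reach this diagonal. Of the two orders in
  \<open>triple\<close>, one attaches the new edge on the right and the other on the left, as in the
  recursion of \<open>growth\<close>.\<close>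

lemma ent_chain:
  fixes X Y :: "nat \<Rightarrow> ('k::field, 'n::{finite,linorder}) sqmat"
  assumes X: "\<And>i. X i \<in> J 1" and Y: "\<And>i. Y i \<in> UJ"
    and "a + Suc l < CARD('n)"
  defines "x \<equiv> \<lambda>l a. ent (X l) a (Suc a)" and "y \<equiv> \<lambda>l i. ent (Y l) i i"
  shows "ent (chain X Y l) a (a + Suc l)
    = (\<Sum>b<CARD('n) - 1. x 0 b * (y 0 b + y 0 (Suc b)) * growth x b l a y)"
  using assms(3)
proof (induction l arbitrary: a)
  case 0
  have "ent (X 0 ** Y 0) a (a + 1 + 0) = ent (X 0) a (a + 1) * ent (Y 0) (a + 1) (a + 1 + 0)"
    "ent (Y 0 ** X 0) a (a + 0 + 1) = ent (Y 0) a (a + 0) * ent (X 0) (a + 0) (a + 0 + 1)"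
    using 0 X Y by (intro J_mult_leading; simp add: J_0)+
  then have "ent (chain X Y 0) a (a + Suc 0) = x 0 a * (y 0 a + y 0 (Suc a))"
    by (simp add: jordan_def x_def y_def algebra_simps)
  also have "\<dots> = (\<Sum>b<CARD('n) - 1. if b = a then x 0 a * (y 0 a + y 0 (Suc a)) else 0)"
    using 0 by simp
  also have "\<dots> = (\<Sum>b<CARD('n) - 1. x 0 b * (y 0 b + y 0 (Suc b)) * growth x b 0 a y)"
    by (rule sum.cong) auto
  finally show ?case .
next
  case (Suc l)
  let ?t = "\<lambda>b. x 0 b * (y 0 b + y 0 (Suc b))"
  let ?W = "chain X Y l" and ?y = "Y (Suc l)" and ?x = "X (Suc l)"
  have W: "?W \<in> J (Suc l)" using X Y by (rule chain_J)
  have Wy: "?W ** ?y \<in> J (Suc l + 0)" and xy: "?x ** ?y \<in> J (1 + 0)"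
    using X Y W by (intro J_mult; simp add: J_0)+
  have 1: "ent (?W ** ?y ** ?x) a (a + (Suc l + 0) + 1)
      = ent ?W a (a + Suc l) * ent ?y (a + Suc l) (a + Suc l + 0) * ent ?x (a + (Suc l + 0)) (a + (Suc l + 0) + 1)"
    using J_mult_leading[OF Wy X, of a] J_mult_leading[OF W, of ?y 0 a] Y Suc.prems by (simp add: J_0)
  have 2: "ent (?x ** ?y ** ?W) a (a + (1 + 0) + Suc l)
      = ent ?x a (a + 1) * ent ?y (a + 1) (a + 1 + 0) * ent ?W (a + (1 + 0)) (a + (1 + 0) + Suc l)"
    using J_mult_leading[OF xy W, of a] J_mult_leading[OF X, of ?y 0 a] Y Suc.prems by (simp add: J_0)
  have "ent (chain X Y (Suc l)) a (a + Suc (Suc l))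
     = 2 * (ent ?W a (a + Suc l) * (x (Suc l) (a + Suc l) * y (Suc l) (a + Suc l))
        + ent ?W (Suc a) (Suc a + Suc l) * (x (Suc l) a * y (Suc l) (Suc a)))"
    using 1 2 by (simp add: triple_eq x_def y_def algebra_simps)
  also have "ent ?W a (a + Suc l) = (\<Sum>b<CARD('n) - 1. ?t b * growth x b l a y)"
    using Suc.prems by (intro Suc.IH) simp
  also have "ent ?W (Suc a) (Suc a + Suc l) = (\<Sum>b<CARD('n) - 1. ?t b * growth x b l (Suc a) y)"
    using Suc.prems by (intro Suc.IH) simp
  finally have "ent (chain X Y (Suc l)) a (a + Suc (Suc l)) =
     (\<Sum>b<CARD('n) - 1. 2 * (?t b * growth x b l a y * (x (Suc l) (a + Suc l) * y (Suc l) (a + Suc l))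
        + ?t b * growth x b l (Suc a) y * (x (Suc l) a * y (Suc l) (Suc a))))"
    by (simp only: sum.distrib sum_distrib_left[symmetric] sum_distrib_right[symmetric])
  also have "\<dots> = (\<Sum>b<CARD('n) - 1. ?t b * growth x b (Suc l) a y)"
    by (rule sum.cong) (simp_all add: algebra_simps)
  finally show ?case .
qed

text \<open>
  The interior vertices \<open>a + 1, \<dots>, a + l\<close> of the interval are each used exactly once as a junction,
  i.e. as argument of one of \<open>y 1, \<dots>, y l\<close>.
\<close>

inductive junctions :: "nat \<Rightarrow> nat \<Rightarrow> ((nat \<Rightarrow> nat \<Rightarrow> 'k::field) \<Rightarrow> 'k) \<Rightarrow> bool" where
  prod: "bij_betw j {1..l} {a + 1..a + l} \<Longrightarrow> junctions l a (\<lambda>y. c * (\<Prod>i\<in>{1..l}. y i (j i)))"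
| add: "junctions l a F \<Longrightarrow> junctions l a G \<Longrightarrow> junctions l a (\<lambda>y. F y + G y)"

text \<open>A new edge turns the end \<open>u\<close> of the old interval into an interior vertex,
  and \<open>u\<close> is the junction of the new factor.\<close>

lemma junctions_extend:
  assumes "junctions l a' F" "insert u {a' + 1..a' + l} = {a + 1..a + Suc l}" "u \<notin> {a' + 1..a' + l}"
  shows "junctions (Suc l) a (\<lambda>y. F y * (d * y (Suc l) u))"
  using assms
proof (induction rule: junctions.induct)
  case (prod j l a' c)
  let ?j = "j(Suc l := u)"
  have "bij_betw ?j {1..l} {a' + 1..a' + l}"
    using prod(1) by (subst bij_betw_cong[of _ ?j j]) auto
  then have "bij_betw ?j (insert (Suc l) {1..l}) (insert u {a' + 1..a' + l})"
    using notIn_Un_bij_betw3[of "Suc l" "{1..l}" ?j "{a' + 1..a' + l}"] prod(3) by simp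
  then have "bij_betw ?j {1..Suc l} {a + 1..a + Suc l}"
    using prod(2) by (simp add: atLeastAtMostSuc_conv)
  then have "junctions (Suc l) a (\<lambda>y. (c * d) * (\<Prod>i\<in>{1..Suc l}. y i (?j i)))"
    by (rule junctions.prod)
  moreover have "(\<lambda>y. (c * d) * (\<Prod>i\<in>{1..Suc l}. y i (?j i))) = (\<lambda>y. c * (\<Prod>i\<in>{1..l}. y i (j i)) * (d * y (Suc l) u))"
    by (auto simp: algebra_simps)
  ultimately show ?case by simp
next
  case (add l a' F G)
  then have "junctions (Suc l) a (\<lambda>y. F y * (d * y (Suc l) u) + G y * (d * y (Suc l) u))"
    by (intro junctions.add) auto
  then show ?case by (simp add: algebra_simps)
qed

lemma junctions_growth:
  fixes x :: "nat \<Rightarrow> nat \<Rightarrow> 'k::field"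
  shows "junctions l a (growth x b l a)"
proof (induction l arbitrary: a)
  case 0
  have "junctions 0 a (\<lambda>y :: nat \<Rightarrow> nat \<Rightarrow> 'k. (if a = b then 1 else 0) * (\<Prod>i\<in>{1..0}. y i (id i)))"
    by (rule junctions.prod) (simp add: bij_betw_def)
  moreover have "(\<lambda>y :: nat \<Rightarrow> nat \<Rightarrow> 'k. (if a = b then 1 else 0) * (\<Prod>i\<in>{1..0::nat}. y i (id i))) = growth x b 0 a" by auto
  ultimately show ?case by (simp only:)
next
  case (Suc l)
  have "junctions (Suc l) a (\<lambda>y. growth x b l a y * ((2 * x (Suc l) (a + Suc l)) * y (Suc l) (a + Suc l)))"
    by (rule junctions_extend[OF Suc.IH]) auto
  moreover have "junctions (Suc l) a (\<lambda>y. growth x b l (Suc a) y * ((2 * x (Suc l) a) * y (Suc l) (Suc a)))"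
    by (rule junctions_extend[OF Suc.IH]) auto
  ultimately have "junctions (Suc l) a (\<lambda>y. growth x b l a y * ((2 * x (Suc l) (a + Suc l)) * y (Suc l) (a + Suc l))
     + growth x b l (Suc a) y * ((2 * x (Suc l) a) * y (Suc l) (Suc a)))"
    by (rule junctions.add)
  moreover have "(\<lambda>y. growth x b l a y * ((2 * x (Suc l) (a + Suc l)) * y (Suc l) (a + Suc l))
     + growth x b l (Suc a) y * ((2 * x (Suc l) a) * y (Suc l) (Suc a))) = growth x b (Suc l) a"
    by (rule ext) (simp add: algebra_simps)
  ultimately show ?case by (simp only:)
qed

lemma growth_range: "growth x b l a y \<noteq> 0 \<Longrightarrow> a \<le> b \<and> b \<le> a + l"
proof (induction l arbitrary: a)
  case (Suc l)
  then have "growth x b l a y \<noteq> 0 \<or> growth x b l (Suc a) y \<noteq> 0" by auto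
  then show ?case using Suc.IH[of a] Suc.IH[of "Suc a"] by auto
qed (auto split: if_splits)

lemma growth_right: "growth x a l a y = 2 ^ l * (\<Prod>i\<in>{1..l}. x i (a + i) * y i (a + i))"
proof (induction l)
  case (Suc l)
  have "growth x a l (Suc a) y = 0" using growth_range[of x a l "Suc a" y] by auto
  then show ?case using Suc by (simp add: algebra_simps)
qed simp

text \<open>With \<open>X 0\<close> on the last edge every factor goes to the left: factor
  \<open>i\<close> occupies the edge starting at \<open>a + l - i\<close> and meets the earlier ones
  at the right end of that edge.\<close>

lemma growth_left:
  "growth x (a + l) l a y = 2 ^ l * (\<Prod>i\<in>{1..l}. x i (a + l - i) * y i (Suc (a + l) - i))"
proof (induction l arbitrary: a)
  case (Suc l)
  have "growth x (a + Suc l) l a y = 0" using growth_range[of x "a + Suc l" l a y] by auto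
  moreover have "growth x (a + Suc l) l (Suc a) y = 2 ^ l * (\<Prod>i\<in>{1..l}. x i (a + Suc l - i) * y i (Suc (a + Suc l) - i))"
    using Suc[of "Suc a"] by simp
  ultimately show ?case by (simp add: algebra_simps)
qed simp

text \<open>Swapping the slot \<open>0\<close> with the slot whose junction is \<open>u\<close> leaves the summand unchanged.\<close>

lemma alternating_junctions:
  fixes y :: "nat \<Rightarrow> nat \<Rightarrow> 'k::field"
  assumes "junctions M a F" "a = 0" "(2 :: 'k) \<noteq> 0" "1 \<le> u" "u \<le> M"
  shows "(\<Sum>p | p permutes {..<Suc M}. of_int (sign p) * (y (p 0) u * F (\<lambda>l. y (p l)))) = 0"
  using assms
proof (induction rule: junctions.induct)
  case (prod j M a c)
  let ?S = "{..<Suc M}"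
  obtain i where i: "i \<in> {1..M}" "j i = u"
    using prod by (metis add_0 atLeastAtMost_iff bij_betw_imp_surj_on imageE)
  let ?t = "Transposition.transpose 0 i"
  have t: "?t permutes ?S" using i by (intro permutes_swap_id) auto
  define T where "T p = y (p 0) u * (c * (\<Prod>k\<in>{1..M}. y (p k) (j k)))" for p :: "nat \<Rightarrow> nat"
  have Tt: "T (p \<circ> ?t) = T p" for p
  proof -
    have "(\<Prod>k\<in>{1..M}. y (p k) (j k)) = y (p i) (j i) * (\<Prod>k\<in>{1..M} - {i}. y (p k) (j k))" for p :: "nat \<Rightarrow> nat"
      using i by (simp add: prod.remove)
    moreover have "(\<Prod>k\<in>{1..M} - {i}. y ((p \<circ> ?t) k) (j k)) = (\<Prod>k\<in>{1..M} - {i}. y (p k) (j k))"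
      by (rule prod.cong) (auto simp: Transposition.transpose_def)
    ultimately show ?thesis using i by (simp add: T_def)
  qed
  have "(\<Sum>p | p permutes ?S. of_int (sign p) * T p) = (\<Sum>p | p permutes ?S. of_int (sign (p \<circ> ?t)) * T (p \<circ> ?t))"
    by (rule sum_permutations_compose_right[OF t])
  also have "\<dots> = (\<Sum>p | p permutes ?S. - (of_int (sign p) * T p))"
  proof (rule sum.cong)
    fix p assume "p \<in> {p. p permutes ?S}"
    then have "permutation p" by (auto simp: permutation_permutes)
    moreover have "permutation ?t" using t by (auto simp: permutation_permutes)
    ultimately have "sign (p \<circ> ?t) = - sign p" using i by (simp add: sign_compose sign_swap_id)
    then show "of_int (sign (p \<circ> ?t)) * T (p \<circ> ?t) = - (of_int (sign p) * T p)" using Tt by simp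
  qed simp
  finally have "2 * (\<Sum>p | p permutes ?S. of_int (sign p) * T p) = 0"
    by (simp only: sum_negf mult_2) simp
  then show ?case using prod(3) by (simp add: T_def)
next
  case (add l a F G)
  then show ?case by (simp add: distrib_left sum.distrib)
qed

text \<open>It is used with \<open>CARD('n) = M + 2\<close>, so \<open>M + 1\<close> is the number
  of superdiagonal edges. For radical \<open>X\<close> and upper triangular \<open>Y\<close> the
  value lies in \<open>J (Suc M)\<close>, the line spanned by the corner unit, and is in effect a
  scalar.\<close>

definition detector ::
  "(nat \<Rightarrow> ('k::field, 'n::{finite,linorder}) sqmat) \<Rightarrow> (nat \<Rightarrow> ('k, 'n) sqmat) \<Rightarrow> nat \<Rightarrow> ('k, 'n) sqmat" where
  "detector X Y M = (\<Sum>p | p permutes {..<Suc M}. mscale (of_int (sign p)) (chain X (\<lambda>l. Y (p l)) M))"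

lemma ent_detector:
  fixes X Y :: "nat \<Rightarrow> ('k::field, 'n::{finite,linorder}) sqmat"
  assumes X: "\<And>i. X i \<in> J 1" and Y: "\<And>i. Y i \<in> UJ" and n: "CARD('n) = Suc (Suc M)"
  defines "x \<equiv> \<lambda>l a. ent (X l) a (Suc a)" and "y \<equiv> \<lambda>l i. ent (Y l) i i"
  shows "ent (detector X Y M) 0 (Suc M) = (\<Sum>b\<le>M. x 0 b *
    ((\<Sum>p | p permutes {..<Suc M}. of_int (sign p) * (y (p 0) b * growth x b M 0 (\<lambda>l. y (p l))))
    + (\<Sum>p | p permutes {..<Suc M}. of_int (sign p) * (y (p 0) (Suc b) * growth x b M 0 (\<lambda>l. y (p l))))))"
proof -
  let ?P = "{p. p permutes {..<Suc M}}"
  have "ent (detector X Y M) 0 (Suc M)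
     = (\<Sum>p\<in>?P. of_int (sign p) * (\<Sum>b\<le>M. x 0 b * (y (p 0) b + y (p 0) (Suc b)) * growth x b M 0 (\<lambda>l. y (p l))))"
    unfolding detector_def ent_sum ent_mscale
  proof (rule sum.cong)
    fix p
    have "ent (chain X (\<lambda>l. Y (p l)) M) 0 (0 + Suc M) = (\<Sum>b<CARD('n) - 1. x 0 b * (y (p 0) b + y (p 0) (Suc b)) * growth x b M 0 (\<lambda>l. y (p l)))"
      unfolding x_def y_def by (rule ent_chain) (use X Y n in auto)
    then show "of_int (sign p) * ent (chain X (\<lambda>l. Y (p l)) M) 0 (Suc M)
      = of_int (sign p) * (\<Sum>b\<le>M. x 0 b * (y (p 0) b + y (p 0) (Suc b)) * growth x b M 0 (\<lambda>l. y (p l)))"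
      by (simp add: n lessThan_Suc_atMost)
  qed simp
  also have "\<dots> = (\<Sum>b\<le>M. \<Sum>p\<in>?P. of_int (sign p) * (x 0 b * (y (p 0) b + y (p 0) (Suc b)) * growth x b M 0 (\<lambda>l. y (p l))))"
    unfolding sum_distrib_left by (rule sum.swap)
  also have "\<dots> = (\<Sum>b\<le>M. x 0 b *
    ((\<Sum>p\<in>?P. of_int (sign p) * (y (p 0) b * growth x b M 0 (\<lambda>l. y (p l))))
    + (\<Sum>p\<in>?P. of_int (sign p) * (y (p 0) (Suc b) * growth x b M 0 (\<lambda>l. y (p l))))))"
    unfolding sum.distrib[symmetric] sum_distrib_left
    by (intro sum.cong refl) (simp add: algebra_simps)
  finally show ?thesis .
qed

text \<open>If \<open>b\<close> is neither 0 nor \<open>M\<close>, both ends of the edge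
  \<open>b\<close> lie in \<open>{1..M}\<close> and both alternating sums vanish. For
  \<open>b = 0\<close> and \<open>b = M\<close> the growth is the explicit product, so all its
  factors are nonzero.\<close>

lemma detector_nonzero:
  fixes X Y :: "nat \<Rightarrow> ('k::field, 'n::{finite,linorder}) sqmat"
  assumes X: "\<And>i. X i \<in> J 1" and Y: "\<And>i. Y i \<in> UJ" and n: "CARD('n) = Suc (Suc M)"
    and two: "(2 :: 'k) \<noteq> 0" and nz: "detector X Y M \<noteq> 0"
  shows "(\<forall>l\<le>M. ent (X l) l (Suc l) \<noteq> 0) \<or> (\<forall>l\<le>M. ent (X l) (M - l) (Suc (M - l)) \<noteq> 0)"
proof -
  define x where "x = (\<lambda>l a. ent (X l) a (Suc a))"
  define y where "y = (\<lambda>l i. ent (Y l) i i)"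
  let ?P = "{p. p permutes {..<Suc M}}"
  let ?s = "\<lambda>b u. \<Sum>p\<in>?P. of_int (sign p) * (y (p 0) u * growth x b M 0 (\<lambda>l. y (p l)))"
  have J: "detector X Y M \<in> J (Suc M)"
    unfolding detector_def by (intro J_sum J_mscale chain_J X Y)
  have "ent (detector X Y M) 0 (Suc M) \<noteq> 0"
  proof
    assume 0: "ent (detector X Y M) 0 (Suc M) = 0"
    have "detector X Y M = 0"
    proof (rule mat_eqI)
      fix i j assume "i < CARD('n)" "j < CARD('n)"
      then show "ent (detector X Y M) i j = ent 0 i j"
        using 0 J by (cases "i = 0 \<and> j = Suc M") (auto simp: J_def n)
    qed
    then show False using nz by simp
  qed
  then have "(\<Sum>b\<le>M. x 0 b * (?s b b + ?s b (Suc b))) \<noteq> 0"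
    using ent_detector[of X Y M, OF X Y n] unfolding x_def y_def by simp
  then obtain b where b: "b \<le> M" "x 0 b * (?s b b + ?s b (Suc b)) \<noteq> 0"
    by (metis (no_types, lifting) atMost_iff sum.not_neutral_contains_not_neutral)
  have alt: "?s b u = 0" if "1 \<le> u" "u \<le> M" for u
    by (rule alternating_junctions[OF junctions_growth refl two that])
  have ends: "b = 0 \<or> b = M"
  proof (rule ccontr)
    assume "\<not> ?thesis"
    then have "?s b b = 0" "?s b (Suc b) = 0" using b(1) by (intro alt; simp)+
    then show False using b(2) by simp
  qed
  have "?s b b \<noteq> 0 \<or> ?s b (Suc b) \<noteq> 0" using b(2) by auto
  then obtain p where p: "growth x b M 0 (\<lambda>l. y (p l)) \<noteq> 0"
    by (metis (no_types, lifting) mult_zero_right sum.neutral)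
  have x0: "x 0 b \<noteq> 0" using b(2) by auto
  show ?thesis
  proof (cases "b = 0")
    case True
    then have "x i i \<noteq> 0" if "i \<in> {1..M}" for i
      using p that growth_right[of x 0 M "\<lambda>l. y (p l)"] by auto
    then have "\<forall>l\<le>M. x l l \<noteq> 0" using x0 True by (metis One_nat_def Suc_leI atLeastAtMost_iff gr0I)
    then show ?thesis by (simp add: x_def)
  next
    case False
    then have M: "b = M" using ends by simp
    then have "x i (M - i) \<noteq> 0" if "i \<in> {1..M}" for i
      using p that growth_left[of x 0 M "\<lambda>l. y (p l)"] by auto
    moreover have "x 0 (M - 0) \<noteq> 0" using x0 M by simp
    ultimately have "\<forall>l\<le>M. x l (M - l) \<noteq> 0" by (metis One_nat_def Suc_leI atLeastAtMost_iff gr0I)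
    then show ?thesis by (simp add: x_def)
  qed
qed

text \<open>The units \<open>E l l\<close> turn products of diagonal entries into indicators of
  conditions on \<open>p\<close>. For \<open>b = 0\<close> the junctions select the identity
  permutation.\<close>

lemma detector_value:
  fixes X :: "nat \<Rightarrow> ('k::field, 'n::{finite,linorder}) sqmat"
  assumes X: "\<And>i. X i \<in> J 1" and n: "CARD('n) = Suc (Suc M)" and two: "(2 :: 'k) \<noteq> 0"
    and ends: "\<And>b. 0 < b \<Longrightarrow> b < M \<Longrightarrow> ent (X 0) b (Suc b) = 0"
    and diag: "\<And>l. l \<le> M \<Longrightarrow> ent (X l) l (Suc l) \<noteq> 0"
  shows "detector X (\<lambda>l. E l l) M \<noteq> 0"
proof -
  define x where "x = (\<lambda>l a. ent (X l) a (Suc a))"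
  define y where "y = (\<lambda>l i. ent (E l l :: ('k, 'n) sqmat) i i)"
  have y: "y l i = (if i = l then 1 else 0)" if "i \<le> Suc M" for l i
    using that by (simp add: y_def n)
  let ?P = "{p. p permutes {..<Suc M}}"
  let ?s = "\<lambda>b u. \<Sum>p\<in>?P. of_int (sign p) * (y (p 0) u * growth x b M 0 (\<lambda>l. y (p l)))"
  have fin: "finite ?P" by (rule finite_permutations) simp
  define c where "c = 2 ^ M * (\<Prod>i\<in>{1..M}. x i i)"
  have c: "c \<noteq> 0" using two diag by (auto simp: c_def x_def)
  have right: "growth x 0 M 0 (\<lambda>l. y (p l)) = (if p = id then c else 0)" if p: "p \<in> ?P" for p
  proof -
    have g: "growth x 0 M 0 (\<lambda>l. y (p l)) = 2 ^ M * (\<Prod>i\<in>{1..M}. x i i * y (p i) i)"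
      using growth_right[of x 0 M "\<lambda>l. y (p l)"] by simp
    show ?thesis
    proof (cases "\<forall>i\<in>{1..M}. p i = i")
      case True
      have "p i = i" for i
      proof (cases "i \<in> {1..M}")
        case False
        show ?thesis
        proof (cases "i = 0")
          case i0: True
          have "p 0 \<in> {..<Suc M}" using p permutes_in_image[of p "{..<Suc M}" 0] by simp
          moreover have "p 0 \<notin> {1..M}"
            using True p by (metis CollectD One_nat_def Suc_n_not_le_n atLeastAtMost_iff permutes_def)
          ultimately show ?thesis using i0 by auto
        next
          case i0: False
          then have "i \<notin> {..<Suc M}" using False by auto
          then show ?thesis using p by (auto simp: permutes_def)
        qed
      qed (use True in auto)
      then have "p = id" by auto
      moreover have "(\<Prod>i\<in>{1..M}. x i i * y i i) = (\<Prod>i\<in>{1..M}. x i i)"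
        by (rule prod.cong) (auto simp: y)
      ultimately show ?thesis using g by (simp add: c_def)
    next
      case False
      then obtain i where i: "i \<in> {1..M}" "p i \<noteq> i" by blast
      then have "x i i * y (p i) i = 0" by (simp add: y)
      then have "(\<Prod>i\<in>{1..M}. x i i * y (p i) i) = 0" using i(1) by (metis (no_types, lifting) finite_atLeastAtMost prod_zero)
      moreover have "p \<noteq> id" using i by auto
      ultimately show ?thesis using g by simp
    qed
  qed
  \<comment> \<open>\<open>X 0\<close> may be nonzero on the last edge as well. There the junctions
    force \<open>p i = Suc M - i\<close> for positive \<open>i\<close>, hence
    \<open>p 0 = 0\<close>; then \<open>Y 0\<close> is evaluated at \<open>M\<close> or
    \<open>Suc M\<close>, where it vanishes.\<close>
  have left: "y (p 0) u * growth x M M 0 (\<lambda>l. y (p l)) = 0" if p: "p \<in> ?P" and M: "M \<noteq> 0" and u: "u = M \<or> u = Suc M" for p u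
  proof (cases "\<forall>i\<in>{1..M}. p i = Suc M - i")
    case True
    have "p 0 \<in> {..<Suc M}" using p permutes_in_image[of p "{..<Suc M}" 0] by simp
    moreover have "p 0 \<notin> {1..M}"
    proof
      assume a: "p 0 \<in> {1..M}"
      then have "Suc M - p 0 \<in> {1..M}" "Suc M - (Suc M - p 0) = p 0"
        unfolding atLeastAtMost_iff by arith+
      then have "p (Suc M - p 0) = p 0" using True by metis
      then have "Suc M - p 0 = 0" using p by (metis mem_Collect_eq permutes_inj injD)
      then show False using a by auto
    qed
    ultimately have "p 0 = 0" by auto
    then show ?thesis using u M by (auto simp: y)
  next
    case False
    then obtain i where i: "i \<in> {1..M}" "p i \<noteq> Suc M - i" by blast
    then have "x i (M - i) * y (p i) (Suc M - i) = 0" by (simp add: y)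
    then have "(\<Prod>i\<in>{1..M}. x i (M - i) * y (p i) (Suc M - i)) = 0"
      using i(1) by (metis (no_types, lifting) finite_atLeastAtMost prod_zero)
    then show ?thesis using growth_left[of x 0 M "\<lambda>l. y (p l)"] by simp
  qed
  have s0: "?s 0 u = (if u = 0 then c else 0)" if "u \<le> Suc M" for u
  proof -
    have "?s 0 u = (\<Sum>p\<in>?P. if p = id then y 0 u * c else 0)"
      by (rule sum.cong) (auto simp: right)
    then show ?thesis using fin that by (simp add: y permutes_id)
  qed
  have "(\<Sum>b\<le>M. x 0 b * (?s b b + ?s b (Suc b))) = (\<Sum>b\<in>{0}. x 0 b * (?s b b + ?s b (Suc b)))"
  proof (rule sum.mono_neutral_right)
    show "\<forall>b\<in>{..M} - {0}. x 0 b * (?s b b + ?s b (Suc b)) = 0"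
    proof
      fix b assume b: "b \<in> {..M} - {0}"
      show "x 0 b * (?s b b + ?s b (Suc b)) = 0"
      proof (cases "b = M")
        case True
        have "?s b b = 0" "?s b (Suc b) = 0"
          using b unfolding True by (intro sum.neutral ballI; simp only: left mult_zero_right; fail | auto simp: left)+
        then show ?thesis by simp
      next
        case False
        then show ?thesis using ends[of b] b by (simp add: x_def)
      qed
    qed
  qed auto
  also have "\<dots> = x 0 0 * c" using s0[of 0] s0[of 1] by simp
  finally have "ent (detector X (\<lambda>l. E l l) M) 0 (Suc M) = x 0 0 * c"
    using ent_detector[of X "\<lambda>l. E l l" M, OF X _ n] unfolding x_def y_def by simp
  moreover have "x 0 0 \<noteq> 0" using diag[of 0] by (simp add: x_def)
  ultimately show ?thesis using c by (metis ent_zero mult_eq_0_iff)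
qed

subsection \<open>Isomorphic gradings and graded identities\<close>

lemma automorphism_eval_poly:
  assumes \<phi>: "UJ_automorphism \<phi>" and \<sigma>: "\<And>x. \<sigma> x \<in> UJ"
  shows "eval_poly \<sigma> f \<in> UJ" "\<phi> (eval_poly \<sigma> f) = eval_poly (\<lambda>x. \<phi> (\<sigma> x)) f"
proof -
  have m: "eval_monom \<sigma> m \<in> UJ \<and> \<phi> (eval_monom \<sigma> m) = eval_monom (\<lambda>x. \<phi> (\<sigma> x)) m" for m
    by (induction m) (auto simp: \<sigma> UJ_jordan automorphism_jordan[OF \<phi>])
  show "eval_poly \<sigma> f \<in> UJ" unfolding eval_poly_def using m by (intro UJ_sum UJ_mscale) auto
  show "\<phi> (eval_poly \<sigma> f) = eval_poly (\<lambda>x. \<phi> (\<sigma> x)) f"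
    unfolding eval_poly_def using m
    by (subst automorphism_sum[OF \<phi>]) (auto simp: UJ_mscale automorphism_mscale[OF \<phi>])
qed

lemma graded_isomorphic_identities:
  fixes A B :: "'g::group_add \<Rightarrow> ('k::field, 'n::{finite,linorder}) sqmat set"
  assumes "graded_isomorphic A B" "graded_UJ A"
  shows "graded_identities A = graded_identities B"
proof -
  interpret graded_UJ A by fact
  obtain \<phi> where \<phi>: "UJ_automorphism \<phi>" and im: "\<And>g. \<phi> ` A g = B g"
    using assms(1) by (auto simp: graded_isomorphic_def)
  have zero: "\<phi> a = 0 \<longleftrightarrow> a = 0" if "a \<in> UJ" for a
    using automorphism_inj[OF \<phi> that UJ_0] automorphism_0[OF \<phi>] by simp
  show ?thesis
  proof (intro set_eqI iffI)
    fix f assume f: "f \<in> graded_identities A"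
    show "f \<in> graded_identities B"
      unfolding graded_identities_def
    proof (intro CollectI allI impI)
      fix \<tau> :: "nat \<times> 'g \<Rightarrow> ('k, 'n) sqmat" assume \<tau>: "\<forall>i g. \<tau> (i, g) \<in> B g"
      have "\<forall>p. \<exists>a. a \<in> A (snd p) \<and> \<phi> a = \<tau> p"
        using \<tau> im by (metis (no_types, lifting) imageE prod.collapse)
      then obtain \<sigma> where \<sigma>: "\<And>p. \<sigma> p \<in> A (snd p)" "\<And>p. \<phi> (\<sigma> p) = \<tau> p" by metis
      have "eval_poly \<sigma> f = 0" using f \<sigma>(1) by (auto simp: graded_identities_def)
      then show "eval_poly \<tau> f = 0"
        using automorphism_eval_poly(2)[OF \<phi>, of \<sigma> f] A_UJ[OF \<sigma>(1)] automorphism_0[OF \<phi>] by (simp add: \<sigma>(2))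
    qed
  next
    fix f assume f: "f \<in> graded_identities B"
    show "f \<in> graded_identities A"
      unfolding graded_identities_def
    proof (intro CollectI allI impI)
      fix \<sigma> :: "nat \<times> 'g \<Rightarrow> ('k, 'n) sqmat" assume \<sigma>: "\<forall>i g. \<sigma> (i, g) \<in> A g"
      then have UJ: "\<sigma> p \<in> UJ" for p using A_UJ by (metis surj_pair)
      have "\<phi> (\<sigma> (i, g)) \<in> B g" for i g using \<sigma> im by (metis imageI)
      then have "eval_poly (\<lambda>p. \<phi> (\<sigma> p)) f = 0" using f by (auto simp: graded_identities_def)
      then show "eval_poly \<sigma> f = 0"
        using automorphism_eval_poly[OF \<phi>, of \<sigma> f] UJ zero by simp
    qed
  qed
qed

lemma polyfun_chain:
  assumes "\<And>i. polyfun (\<lambda>\<sigma>. X \<sigma> i)" "\<And>i. polyfun (\<lambda>\<sigma>. Y \<sigma> i)"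
  shows "polyfun (\<lambda>\<sigma>. chain (X \<sigma>) (Y \<sigma>) l)"
  by (induction l) (auto simp: triple_def intro!: assms polyfun_add polyfun_diff polyfun_jordan)

text \<open>An associator \<open>(x, w, w)\<close> is radical under every substitution and keeps the
  degree of \<open>x\<close>, since \<open>t + t = 0\<close>. The alternating arguments combine the
  degrees 0 and \<open>t\<close>, as \<open>E l l\<close> need not be homogeneous. Taking
  \<open>t = 0\<close> covers the trivial type.\<close>

lemma detector_transfer:
  fixes A B :: "'g::group_add \<Rightarrow> ('k::field, 'n::{finite,linorder}) sqmat set"
  assumes ids: "graded_identities A = graded_identities B" and "graded_UJ A" "graded_UJ B"
    and n: "CARD('n) = Suc (Suc M)" and t: "t + t = 0"
    and x: "\<And>l. x l \<in> A (g l)" and w: "\<And>l. w l \<in> A t"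
    and y: "\<And>l. y l \<in> A 0" "\<And>l. z l \<in> A t" "\<And>l. y l + z l = E l l"
    and ends: "\<And>b. 0 < b \<Longrightarrow> b < M \<Longrightarrow> ent ((x 0 \<circ>\<^sub>J w 0) \<circ>\<^sub>J w 0 - x 0 \<circ>\<^sub>J (w 0 \<circ>\<^sub>J w 0)) b (Suc b) = 0"
    and diag: "\<And>l. l \<le> M \<Longrightarrow> ent ((x l \<circ>\<^sub>J w l) \<circ>\<^sub>J w l - x l \<circ>\<^sub>J (w l \<circ>\<^sub>J w l)) l (Suc l) \<noteq> 0"
  shows "\<exists>X. (\<forall>l. X l \<in> B (g l)) \<and>
    ((\<forall>l\<le>M. ent (X l) l (Suc l) \<noteq> 0) \<or> (\<forall>l\<le>M. ent (X l) (M - l) (Suc (M - l)) \<noteq> 0))"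
proof -
  interpret A: graded_UJ A by fact
  interpret B: graded_UJ B by fact
  \<comment> \<open>Residues modulo 4 keep the four roles of variables apart even when degrees
    coincide.\<close>
  define X where "X \<sigma> l = (\<sigma> (4 * l, g l) \<circ>\<^sub>J \<sigma> (4 * l + 1, t)) \<circ>\<^sub>J \<sigma> (4 * l + 1, t)
    - \<sigma> (4 * l, g l) \<circ>\<^sub>J (\<sigma> (4 * l + 1, t) \<circ>\<^sub>J \<sigma> (4 * l + 1, t))" for \<sigma> :: "nat \<times> 'g \<Rightarrow> ('k, 'n) sqmat" and l
  define Y where "Y \<sigma> l = \<sigma> (4 * l + 2, 0) + \<sigma> (4 * l + 3, t)" for \<sigma> :: "nat \<times> 'g \<Rightarrow> ('k, 'n) sqmat" and l
  have pX: "polyfun (\<lambda>\<sigma>. X \<sigma> l)" for l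
    unfolding X_def by (intro polyfun_diff polyfun_jordan polyfun_var)
  have pY: "polyfun (\<lambda>\<sigma>. Y \<sigma> l)" for l
    unfolding Y_def by (intro polyfun_add polyfun_var)
  have p: "polyfun (\<lambda>\<sigma>. detector (X \<sigma>) (Y \<sigma>) M)"
    unfolding detector_def by (intro polyfun_sum polyfun_mscale polyfun_chain pX pY)
  define \<sigma> where "\<sigma> p = (if fst p mod 4 = 0 \<and> snd p = g (fst p div 4) then x (fst p div 4)
    else if fst p mod 4 = 1 \<and> snd p = t then w (fst p div 4)
    else if fst p mod 4 = 2 \<and> snd p = 0 then y (fst p div 4)
    else if fst p mod 4 = 3 \<and> snd p = t then z (fst p div 4) else 0)" for p
  have \<sigma>A: "\<sigma> (i, h) \<in> A h" for i h using x w y by (auto simp: \<sigma>_def)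
  have m: "(4 * l) mod 4 = 0" "(4 * l + 1) mod 4 = 1" "(4 * l + 2) mod 4 = 2" "(4 * l + 3) mod 4 = 3"
    "(4 * l) div 4 = l" "(4 * l + 1) div 4 = l" "(4 * l + 2) div 4 = l" "(4 * l + 3) div 4 = l" for l :: nat
    by presburger+
  have X\<sigma>: "X \<sigma> l = (x l \<circ>\<^sub>J w l) \<circ>\<^sub>J w l - x l \<circ>\<^sub>J (w l \<circ>\<^sub>J w l)" for l
    unfolding X_def \<sigma>_def fst_conv snd_conv m by simp
  have Y\<sigma>: "Y \<sigma> = (\<lambda>l. E l l)"
    unfolding Y_def \<sigma>_def fst_conv snd_conv m using y(3) by simp
  have "detector (X \<sigma>) (Y \<sigma>) M \<noteq> 0"
    unfolding Y\<sigma>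
  proof (rule detector_value[OF _ n A.two])
    show "X \<sigma> l \<in> J 1" for l
      unfolding X\<sigma> using A.A_UJ[OF x] A.A_UJ[OF w] by (intro A.associator_J1) auto
  qed (use ends diag X\<sigma> in auto)
  then have "\<not> (\<forall>\<tau>. (\<forall>i h. \<tau> (i, h) \<in> B h) \<longrightarrow> detector (X \<tau>) (Y \<tau>) M = 0)"
    using same_identities_polyfun[OF ids p _ \<sigma>A] by blast
  then obtain \<tau> where \<tau>: "\<And>i h. \<tau> (i, h) \<in> B h" "detector (X \<tau>) (Y \<tau>) M \<noteq> 0" by blast
  have UJ: "\<tau> (i, h) \<in> UJ" for i h using B.A_UJ[OF \<tau>(1)] .
  have "X \<tau> l \<in> B (g l)" for l
  proof -
    have "(\<tau> (4 * l, g l) \<circ>\<^sub>J \<tau> (4 * l + 1, t)) \<circ>\<^sub>J \<tau> (4 * l + 1, t) \<in> B ((g l + t) + t)"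
      "\<tau> (4 * l, g l) \<circ>\<^sub>J (\<tau> (4 * l + 1, t) \<circ>\<^sub>J \<tau> (4 * l + 1, t)) \<in> B (g l + (t + t))"
      by (intro B.A_jordan \<tau>(1))+
    then show ?thesis unfolding X_def using t by (intro B.A_diff) (auto simp: add.assoc)
  qed
  moreover have "X \<tau> l \<in> J 1" for l
    unfolding X_def by (intro B.associator_J1 UJ)
  moreover have "Y \<tau> l \<in> UJ" for l
    unfolding Y_def by (intro UJ_add UJ)
  ultimately show ?thesis
    using detector_nonzero[of "X \<tau>" "Y \<tau>" M, OF _ _ n B.two \<tau>(2)] by blast
qed

subsection \<open>Gradings in normal form\<close>

lemma ent_diag_mult:
  fixes w z :: "('k::field, 'n::{finite,linorder}) sqmat"
  assumes "\<And>i j. i < CARD('n) \<Longrightarrow> j < CARD('n) \<Longrightarrow> i \<noteq> j \<Longrightarrow> ent w i j = 0" "a < CARD('n)" "b < CARD('n)"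
  shows "ent (w ** z) a b = ent w a a * ent z a b" "ent (z ** w) a b = ent z a b * ent w b b"
proof -
  have "ent (w ** z) a b = (\<Sum>k<CARD('n). if k = a then ent w a a * ent z a b else 0)"
    unfolding ent_mult by (rule sum.cong) (use assms in auto)
  then show "ent (w ** z) a b = ent w a a * ent z a b" using assms by simp
  have "ent (z ** w) a b = (\<Sum>k<CARD('n). if k = b then ent z a b * ent w b b else 0)"
    unfolding ent_mult by (rule sum.cong) (use assms in auto)
  then show "ent (z ** w) a b = ent z a b * ent w b b" using assms by simp
qed

text \<open>Multiplication by a diagonal \<open>w\<close> acts on each entry by a scalar, and
  \<open>(p + q)^2 - 2 (p^2 + q^2) = - (p - q)^2\<close>. The associator thus retains the entries at
  whose two indices \<open>w\<close> differs.\<close>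

lemma ent_associator_diag:
  fixes w z :: "('k::field, 'n::{finite,linorder}) sqmat"
  assumes w: "\<And>i j. i < CARD('n) \<Longrightarrow> j < CARD('n) \<Longrightarrow> i \<noteq> j \<Longrightarrow> ent w i j = 0"
    and "a < CARD('n)" "b < CARD('n)"
  shows "ent ((z \<circ>\<^sub>J w) \<circ>\<^sub>J w - z \<circ>\<^sub>J (w \<circ>\<^sub>J w)) a b = - ((ent w a a - ent w b b) ^ 2 * ent z a b)"
proof -
  have ww: "ent (w \<circ>\<^sub>J w) i j = 0" if "i < CARD('n)" "j < CARD('n)" "i \<noteq> j" for i j
    unfolding jordan_def ent_add using that by (simp add: ent_diag_mult[OF w] w)
  have d: "ent (w \<circ>\<^sub>J w) i i = 2 * (ent w i i * ent w i i)" if "i < CARD('n)" for i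
    unfolding jordan_def ent_add using that by (simp add: ent_diag_mult[OF w])
  have j: "ent (v \<circ>\<^sub>J w) a b = ent v a b * (ent w a a + ent w b b)" for v
    unfolding jordan_def ent_add using assms(2,3) by (simp add: ent_diag_mult[OF w] algebra_simps)
  have "ent (z \<circ>\<^sub>J (w \<circ>\<^sub>J w)) a b = ent z a b * (ent (w \<circ>\<^sub>J w) a a + ent (w \<circ>\<^sub>J w) b b)"
    unfolding jordan_def[of z] ent_add using assms(2,3) by (simp add: ent_diag_mult[OF ww] algebra_simps)
  then show ?thesis
    using assms(2,3) by (simp add: j d power2_eq_square algebra_simps)
qed

lemma peirce_component:
  fixes x :: "('k::field, 'n::{finite,linorder}) sqmat"
  assumes "i < CARD('n)" "j < CARD('n)" "i \<noteq> j"
  shows "E i i \<circ>\<^sub>J (E j j \<circ>\<^sub>J x) = mscale (ent x i j) (E i j) + mscale (ent x j i) (E j i)"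
  by (rule mat_eqI) (use assms in \<open>auto simp: jordan_def ent_E_mult\<close>)

lemma E_outside: "CARD('n) \<le> l \<Longrightarrow> E l l = (0 :: ('k::field, 'n::{finite,linorder}) sqmat)"
  by (rule mat_eqI) auto

text \<open>The span of the common homogeneous elements is closed under the Jordan product. Peirce
  projections extract from it the superdiagonal units, these generate all units, and then both
  gradings assign the same components to every element.\<close>

lemma common_generators_eq:
  fixes A B :: "'g::group_add \<Rightarrow> ('k::field, 'n::{finite,linorder}) sqmat set"
  assumes "graded_UJ A" "graded_UJ B"
    and e: "\<And>i. i < CARD('n) \<Longrightarrow> E i i \<in> mat.span (\<Union>g. A g \<inter> B g)"
    and x: "\<And>l. Suc l < CARD('n) \<Longrightarrow> \<exists>x \<in> mat.span (\<Union>g. A g \<inter> B g). ent x l (Suc l) \<noteq> 0"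
  shows "A = B"
proof -
  interpret A: graded_UJ A by fact
  interpret B: graded_UJ B by fact
  let ?V = "mat.span (\<Union>g. A g \<inter> B g)"
  have UJ: "v \<in> UJ" if "v \<in> ?V" for v
    using that mat.span_minimal[OF _ UJ_subspace, of "\<Union>g. A g \<inter> B g"] A.A_UJ by blast
  have mult1: "v \<circ>\<^sub>J b \<in> ?V" if "v \<in> ?V" "b \<in> A g \<inter> B g" for v b g
    using that(1)
  proof (induction rule: mat.span_induct_alt)
    case base then show ?case by (simp add: jordan_distribs mat.span_zero)
  next
    case (step c a y)
    then obtain h where "a \<in> A h \<inter> B h" by blast
    then have "a \<circ>\<^sub>J b \<in> A (h + g) \<inter> B (h + g)" using that(2) by (auto intro: A.A_jordan B.A_jordan)
    then have "a \<circ>\<^sub>J b \<in> ?V" by (intro mat.span_base) auto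
    then show ?case using step by (simp add: jordan_distribs mat.span_add mat.span_scale)
  qed
  have mult: "v \<circ>\<^sub>J b \<in> ?V" if "b \<in> ?V" "v \<in> ?V" for v b
    using that(1)
  proof (induction rule: mat.span_induct_alt)
    case base then show ?case by (simp add: jordan_distribs mat.span_zero)
  next
    case (step c a y)
    then show ?case using mult1[OF that(2)] by (auto simp: jordan_distribs intro!: mat.span_add mat.span_scale)
  qed
  have edge: "E l (Suc l) \<in> ?V" if l: "Suc l < CARD('n)" for l
  proof -
    obtain x where x': "x \<in> ?V" "ent x l (Suc l) \<noteq> 0" using x[OF l] by blast
    have "E l l \<circ>\<^sub>J (E (Suc l) (Suc l) \<circ>\<^sub>J x) \<in> ?V" using l by (intro mult x' e) auto
    moreover have "ent x (Suc l) l = 0" using UJ[OF x'(1)] l by (simp add: ent_lower)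
    ultimately have "mscale (ent x l (Suc l)) (E l (Suc l)) \<in> ?V"
      using l by (simp add: peirce_component)
    then have "mscale (inverse (ent x l (Suc l))) (mscale (ent x l (Suc l)) (E l (Suc l))) \<in> ?V"
      by (rule mat.span_scale)
    then show ?thesis using x'(2) by simp
  qed
  have unit: "E i (i + d) \<in> ?V" if "i + d < CARD('n)" for i d
    using that
  proof (induction d arbitrary: i)
    case 0 then show ?case using e[of i] by simp
  next
    case (Suc d)
    show ?case
    proof (cases "d = 0")
      case True then show ?thesis using edge[of i] Suc.prems by simp
    next
      case False
      have "(E i (Suc i) :: ('k, 'n) sqmat) \<circ>\<^sub>J E (Suc i) (Suc i + d) = E i (i + Suc d)"
        using False Suc.prems by (simp add: jordan_def E_mult)
      moreover have "(E i (Suc i) :: ('k, 'n) sqmat) \<circ>\<^sub>J E (Suc i) (Suc i + d) \<in> ?V"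
        using Suc.prems by (intro mult edge Suc.IH) auto
      ultimately show ?thesis by simp
    qed
  qed
  have all: "v \<in> ?V" if "v \<in> UJ" for v
  proof -
    have "(\<Sum>(i, j)\<in>{(i, j). i \<le> j \<and> j < CARD('n)}. mscale (ent v i j) (E i j)) \<in> ?V"
    proof (rule mat.span_sum, clarify)
      fix i j :: nat assume "i \<le> j" "j < CARD('n)"
      then show "mscale (ent v i j) (E i j) \<in> ?V" using unit[of i "j - i"] by (intro mat.span_scale) simp
    qed
    then show ?thesis using E_expand[OF that] by metis
  qed
  have pr: "v \<in> UJ \<and> pr A h v = pr B h v" if "v \<in> ?V" for v h
    using that
  proof (induction rule: mat.span_induct_alt)
    case (step c a y)
    then obtain g where a: "a \<in> A g" "a \<in> B g" by blast
    then have "a \<in> UJ" "y \<in> UJ" using step A.A_UJ by auto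
    then show ?case
      using step a by (simp add: UJ_add A.pr_add B.pr_add A.pr_mscale B.pr_mscale UJ_mscale A.pr_homogeneous B.pr_homogeneous)
  qed simp
  have "a \<in> A g \<longleftrightarrow> a \<in> B g" for a g
  proof -
    have "a \<in> B g" if "a \<in> A g"
      using pr[OF all[OF A.A_UJ[OF that]], of g] A.pr_homogeneous[OF that, of g] B.pr_spec(1)[OF A.A_UJ[OF that], of g] by simp
    moreover have "a \<in> A g" if "a \<in> B g"
      using pr[OF all[OF B.A_UJ[OF that]], of g] B.pr_homogeneous[OF that, of g] A.pr_spec(1)[OF B.A_UJ[OF that], of g] by simp
    ultimately show ?thesis by blast
  qed
  then show ?thesis by auto
qed

section \<open>Homogeneous superdiagonal elements in normal form\<close>

context graded_UJ
begin

lemma card_eq: "\<exists>M. CARD('n) = Suc (Suc M)"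
  by (rule exI[of _ "CARD('n) - 2"]) (use card2 in simp)

lemma exists_component:
  assumes "x \<in> UJ" "ent x i j \<noteq> 0"
  shows "\<exists>g. ent (pr A g x) i j \<noteq> 0"
proof (rule ccontr)
  assume "\<not> ?thesis"
  then have "(\<Sum>g\<in>degrees. ent (pr A g x) i j) = 0" by simp
  then show False using assms pr_decompose[OF assms(1)] by (metis ent_sum)
qed

lemma trivial_edge:
  assumes e: "\<And>i. i < CARD('n) \<Longrightarrow> E i i \<in> A 0"
    and x: "x \<in> A g" and l: "Suc l < CARD('n)" and nz: "ent x l (Suc l) \<noteq> 0"
  shows "E l (Suc l) \<in> A g"
proof -
  have "E l l \<circ>\<^sub>J (E (Suc l) (Suc l) \<circ>\<^sub>J x) \<in> A (0 + (0 + g))"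
    using l by (intro A_jordan e x) auto
  moreover have "ent x (Suc l) l = 0" using A_UJ[OF x] l by (simp add: ent_lower)
  ultimately have "mscale (ent x l (Suc l)) (E l (Suc l)) \<in> A g"
    using l by (simp add: peirce_component)
  then have "mscale (inverse (ent x l (Suc l))) (mscale (ent x l (Suc l)) (E l (Suc l))) \<in> A g"
    by (rule A_mscale)
  then show ?thesis using nz by simp
qed

definition mirror_normal :: "'g \<Rightarrow> bool" where
  "mirror_normal t \<longleftrightarrow> t \<noteq> 0 \<and> t + t = 0 \<and> (\<forall>i<CARD('n).
    E i i + E (CARD('n) - 1 - i) (CARD('n) - 1 - i) \<in> A 0 \<and>
    E i i - E (CARD('n) - 1 - i) (CARD('n) - 1 - i) \<in> A t)"

lemma mirror_normalD:
  assumes "mirror_normal t" "Suc (i + j) = CARD('n)"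
  shows "E i i + E j j \<in> A 0" "E i i - E j j \<in> A t"
proof -
  have "i < CARD('n)" "j = CARD('n) - 1 - i" using assms(2) by auto
  then show "E i i + E j j \<in> A 0" "E i i - E j j \<in> A t"
    using assms(1) unfolding mirror_normal_def by blast+
qed

text \<open>Multiplying by two sums of mirror units, or by two differences, preserves the degree
  since \<open>t + t = 0\<close>. In the average of both operators the mixed terms cancel, leaving
  the Peirce projections onto an edge and its mirror image.\<close>

lemma mirror_edge:
  assumes m: "mirror_normal t" and n: "CARD('n) = Suc (Suc M)" and x: "x \<in> A g" and l: "l \<le> M"
  shows "mscale (ent x l (Suc l)) (E l (Suc l))
    + mscale (ent x (M - l) (Suc (M - l))) (E (M - l) (Suc (M - l))) \<in> A g"
proof -
  have r: "Suc (l + Suc (M - l)) = CARD('n)" "Suc (Suc l + (M - l)) = CARD('n)" using l n by auto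
  define a a' b b' where "a = (E l l :: ('k, 'n) sqmat)" and "a' = (E (Suc (M - l)) (Suc (M - l)) :: ('k, 'n) sqmat)"
    and "b = (E (Suc l) (Suc l) :: ('k, 'n) sqmat)" and "b' = (E (M - l) (M - l) :: ('k, 'n) sqmat)"
  have e: "a + a' \<in> A 0" "a - a' \<in> A t" "b + b' \<in> A 0" "b - b' \<in> A t"
    unfolding a_def a'_def b_def b'_def by (rule mirror_normalD[OF m r(1)] mirror_normalD[OF m r(2)])+
  have tt: "t + (t + g) = g" using m by (simp add: mirror_normal_def flip: add.assoc)
  have "(a + a') \<circ>\<^sub>J ((b + b') \<circ>\<^sub>J x) \<in> A (0 + (0 + g))" "(a - a') \<circ>\<^sub>J ((b - b') \<circ>\<^sub>J x) \<in> A (t + (t + g))"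
    by (intro A_jordan e x)+
  then have "mscale (inverse 2) ((a + a') \<circ>\<^sub>J ((b + b') \<circ>\<^sub>J x) + (a - a') \<circ>\<^sub>J ((b - b') \<circ>\<^sub>J x)) \<in> A g"
    unfolding tt by (intro A_mscale A_add) auto
  also have "(a + a') \<circ>\<^sub>J ((b + b') \<circ>\<^sub>J x) + (a - a') \<circ>\<^sub>J ((b - b') \<circ>\<^sub>J x)
     = (a \<circ>\<^sub>J (b \<circ>\<^sub>J x) + a' \<circ>\<^sub>J (b' \<circ>\<^sub>J x)) + (a \<circ>\<^sub>J (b \<circ>\<^sub>J x) + a' \<circ>\<^sub>J (b' \<circ>\<^sub>J x))"
    unfolding jordan_distribs by (simp add: algebra_simps)
  also have "mscale (inverse 2) \<dots> = a \<circ>\<^sub>J (b \<circ>\<^sub>J x) + a' \<circ>\<^sub>J (b' \<circ>\<^sub>J x)"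
    by (rule half_double[OF two])
  also have "a \<circ>\<^sub>J (b \<circ>\<^sub>J x) = mscale (ent x l (Suc l)) (E l (Suc l))"
    using l n A_UJ[OF x] by (simp add: a_def b_def peirce_component ent_lower)
  also have "a' \<circ>\<^sub>J (b' \<circ>\<^sub>J x) = mscale (ent x (M - l) (Suc (M - l))) (E (M - l) (Suc (M - l)))"
    using l n A_UJ[OF x] by (simp add: a'_def b'_def peirce_component ent_lower)
  finally show ?thesis .
qed

lemma two_degrees_zero: "x \<in> A g \<Longrightarrow> x \<in> A h \<Longrightarrow> g \<noteq> h \<Longrightarrow> x = 0"
  using pr_homogeneous[of x g g] pr_homogeneous[of x h g] by simp

text \<open>The degree \<open>t\<close> difference of the two outer end units acts as 1 on the edge
  \<open>l\<close> and as -1 on its mirror image. If one coefficient were 0, the element would lie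
  both in degree \<open>g\<close> and in degree \<open>t + g\<close>.\<close>

lemma mirror_edge_both:
  assumes m: "mirror_normal t" and n: "CARD('n) = Suc (Suc M)" and l: "l < M - l"
    and z: "mscale \<alpha> (E l (Suc l)) + mscale \<beta> (E (M - l) (Suc (M - l))) \<in> A g"
  shows "\<alpha> = 0 \<longleftrightarrow> \<beta> = 0"
proof -
  define e e' where "e = (E l (Suc l) :: ('k, 'n) sqmat)" and "e' = (E (M - l) (Suc (M - l)) :: ('k, 'n) sqmat)"
  define a where "a = (E l l - E (Suc (M - l)) (Suc (M - l)) :: ('k, 'n) sqmat)"
  have "Suc (l + Suc (M - l)) = CARD('n)" using l n by auto
  then have a: "a \<in> A t" unfolding a_def by (rule mirror_normalD[OF m])
  have tg: "g \<noteq> t + g" using m by (metis add_0 add_right_cancel mirror_normal_def)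
  have ae: "a \<circ>\<^sub>J e = e" "a \<circ>\<^sub>J e' = - e'"
    using l n by (simp_all add: a_def e_def e'_def jordan_def mult_distribs E_mult)
  have ne: "e \<noteq> 0" "e' \<noteq> 0"
  proof -
    have "ent e l (Suc l) \<noteq> 0" "ent e' (M - l) (Suc (M - l)) \<noteq> 0"
      using l n by (simp_all add: e_def e'_def)
    then show "e \<noteq> 0" "e' \<noteq> 0" by auto
  qed
  have z: "mscale \<alpha> e + mscale \<beta> e' \<in> A g" using z by (simp add: e_def e'_def)
  have "a \<circ>\<^sub>J (mscale \<alpha> e + mscale \<beta> e') \<in> A (t + g)" by (rule A_jordan[OF a z])
  then have z': "mscale \<alpha> e - mscale \<beta> e' \<in> A (t + g)" by (simp add: jordan_distribs ae)
  show ?thesis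
  proof
    assume "\<alpha> = 0"
    then have "mscale \<beta> e' \<in> A g" "mscale \<beta> e' \<in> A (t + g)"
      using z z' A_mscale[of "- mscale \<beta> e'" "t + g" "- 1"] by simp_all
    then show "\<beta> = 0" using two_degrees_zero[OF _ _ tg] ne by fastforce
  next
    assume "\<beta> = 0"
    then have "mscale \<alpha> e \<in> A g" "mscale \<alpha> e \<in> A (t + g)" using z z' by simp_all
    then show "\<alpha> = 0" using two_degrees_zero[OF _ _ tg] ne by fastforce
  qed
qed

lemma mirror_not_J1:
  assumes "mirror A t"
  shows "\<not> A t \<subseteq> J 1"
proof
  assume sub: "A t \<subseteq> J 1"
  define v where "v = (E 0 0 - E (CARD('n) - 1) (CARD('n) - 1) :: ('k, 'n) sqmat)"
  have v: "v \<in> UJ" by (simp add: v_def UJ_diff)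
  have "ent (pr A t v) 0 0 = ent v 0 0"
    by (rule mirror_diag(2)[OF assms v, of "- 1"]) (use card2 in \<open>auto simp: v_def\<close>)
  also have "\<dots> = 1" using card2 by (simp add: v_def)
  finally have "ent (pr A t v) 0 0 \<noteq> 0" by simp
  moreover have "pr A t v \<in> J 1" using sub pr_spec(1)[OF v] by blast
  then have "ent (pr A t v) 0 0 = 0" using card2 by (subst (asm) J_1_iff) auto
  ultimately show False by simp
qed

end

text \<open>The detector carries the degrees of the superdiagonal units of \<open>A\<close> over to
  \<open>B\<close>, in the same or in the reversed order. The gradings then coincide, directly or
  after reflecting \<open>B\<close>.\<close>

lemma trivial_normal_isomorphic:
  fixes A B :: "'g::group_add \<Rightarrow> ('k::field, 'n::{finite,linorder}) sqmat set"
  assumes "graded_UJ A" "graded_UJ B" and ids: "graded_identities A = graded_identities B"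
    and eA: "\<And>i. i < CARD('n) \<Longrightarrow> E i i \<in> A 0" and eB: "\<And>i. i < CARD('n) \<Longrightarrow> E i i \<in> B 0"
  shows "graded_isomorphic A B"
proof -
  interpret A: graded_UJ A by fact
  interpret B: graded_UJ B by fact
  obtain M where n: "CARD('n) = Suc (Suc M)" using A.card_eq by blast
  have "\<exists>g. E l (Suc l) \<in> A g" if l: "l \<le> M" for l
  proof -
    obtain g where "ent (pr A g (E l (Suc l))) l (Suc l) \<noteq> 0"
      using A.exists_component[of "E l (Suc l)" l "Suc l"] l n by auto
    then have "E l (Suc l) \<in> A g"
      using l n by (intro A.trivial_edge[OF eA A.pr_spec(1)]) auto
    then show ?thesis by blast
  qed
  then obtain g where g: "\<And>l. l \<le> M \<Longrightarrow> E l (Suc l) \<in> A (g l)" by metis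
  \<comment> \<open>The transfer lemma speaks of all \<open>l\<close>; beyond \<open>M\<close> the
    value 0 lies in every component.\<close>
  define x where "x l = (if l \<le> M then E l (Suc l) else 0 :: ('k, 'n) sqmat)" for l
  have EA: "E l l \<in> A 0" for l using eA[of l] E_outside[of l, where 'n = 'n and 'k = 'k] by (cases "l < CARD('n)") auto
  have ent_X: "ent ((x l \<circ>\<^sub>J E l l) \<circ>\<^sub>J E l l - x l \<circ>\<^sub>J (E l l \<circ>\<^sub>J E l l)) b (Suc b)
    = - ((ent (E l l :: ('k, 'n) sqmat) b b - ent (E l l :: ('k, 'n) sqmat) (Suc b) (Suc b)) ^ 2 * ent (x l) b (Suc b))"
    if "b \<le> M" for l b
    by (rule ent_associator_diag) (use that n in auto)
  have "\<exists>X. (\<forall>l. X l \<in> B (g l)) \<and>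
    ((\<forall>l\<le>M. ent (X l) l (Suc l) \<noteq> 0) \<or> (\<forall>l\<le>M. ent (X l) (M - l) (Suc (M - l)) \<noteq> 0))"
  proof (rule detector_transfer[OF ids assms(1,2) n, of 0 x g "\<lambda>l. E l l" "\<lambda>l. E l l" "\<lambda>_. 0"])
    show "x l \<in> A (g l)" for l using g by (simp add: x_def)
    show "ent ((x l \<circ>\<^sub>J E l l) \<circ>\<^sub>J E l l - x l \<circ>\<^sub>J (E l l \<circ>\<^sub>J E l l)) l (Suc l) \<noteq> 0" if "l \<le> M" for l
      unfolding ent_X[OF that] using that n by (simp add: x_def)
    show "ent ((x 0 \<circ>\<^sub>J E 0 0) \<circ>\<^sub>J E 0 0 - x 0 \<circ>\<^sub>J (E 0 0 \<circ>\<^sub>J E 0 0)) b (Suc b) = 0" if "0 < b" "b < M" for b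
      using ent_X[of b 0] that n by (simp add: x_def)
  qed (simp_all add: EA)
  then obtain X where X: "\<And>l. X l \<in> B (g l)"
    "(\<forall>l\<le>M. ent (X l) l (Suc l) \<noteq> 0) \<or> (\<forall>l\<le>M. ent (X l) (M - l) (Suc (M - l)) \<noteq> 0)" by blast
  have eq: "A = C" if C: "graded_UJ C" "\<And>i. i < CARD('n) \<Longrightarrow> E i i \<in> C 0" "\<And>l. l \<le> M \<Longrightarrow> E l (Suc l) \<in> C (g l)" for C
  proof (rule common_generators_eq[OF assms(1) C(1)])
    show "E i i \<in> mat.span (\<Union>g. A g \<inter> C g)" if "i < CARD('n)" for i
      using eA[OF that] C(2)[OF that] by (intro mat.span_base) auto
    fix l assume l: "Suc l < CARD('n)"
    then have "E l (Suc l) \<in> mat.span (\<Union>g. A g \<inter> C g)"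
      using g[of l] C(3)[of l] n by (intro mat.span_base) auto
    then show "\<exists>x\<in>mat.span (\<Union>g. A g \<inter> C g). ent x l (Suc l) \<noteq> 0"
      using l by (intro bexI[of _ "E l (Suc l)"]) auto
  qed
  from X(2) show ?thesis
  proof
    assume "\<forall>l\<le>M. ent (X l) l (Suc l) \<noteq> 0"
    then have EB: "E l (Suc l) \<in> B (g l)" if "l \<le> M" for l
      using that n by (intro B.trivial_edge[OF eB X(1)]) auto
    have "A = B" by (rule eq[OF assms(2) eB EB])
    moreover have "UJ_automorphism (\<lambda>a. a :: ('k, 'n) sqmat)"
      by (auto simp: UJ_automorphism_def bij_betw_def)
    ultimately show ?thesis unfolding graded_isomorphic_def by (metis image_ident)
  next
    assume nz: "\<forall>l\<le>M. ent (X l) (M - l) (Suc (M - l)) \<noteq> 0"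
    have E: "E (M - l) (Suc (M - l)) \<in> B (g l)" if "l \<le> M" for l
      using nz that n by (intro B.trivial_edge[OF eB X(1)]) auto
    have "A = (\<lambda>g. flip_mat ` B g)"
    proof (rule eq)
      show "graded_UJ (\<lambda>g. flip_mat ` B g)" by (rule B.graded_image[OF automorphism_flip])
      show "E i i \<in> flip_mat ` B 0" if i: "i < CARD('n)" for i
      proof (rule image_eqI)
        show "E (CARD('n) - 1 - i) (CARD('n) - 1 - i) \<in> B 0" by (rule eB) (use i in simp)
        show "E i i = flip_mat (E (CARD('n) - 1 - i) (CARD('n) - 1 - i) :: ('k, 'n) sqmat)"
          using i by (subst flip_E) auto
      qed
      show "E l (Suc l) \<in> flip_mat ` B (g l)" if l: "l \<le> M" for l
      proof (rule image_eqI)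
        show "E (M - l) (Suc (M - l)) \<in> B (g l)" by (rule E[OF l])
        show "E l (Suc l) = flip_mat (E (M - l) (Suc (M - l)) :: ('k, 'n) sqmat)"
          using l n by (subst flip_E) auto
      qed
    qed
    then have "graded_isomorphic B A" by (simp only: graded_isomorphic_image[OF automorphism_flip])
    then show ?thesis by (rule graded_isomorphic_sym) (use B.A_UJ in blast)
  qed
qed

text \<open>A homogeneous element on an edge pair has both coefficients nonzero as soon as one is,
  so the order found by the detector does not matter. Only the ratios of the two coefficients can
  differ between \<open>A\<close> and \<open>B\<close>, and a diagonal conjugation adjusts them
  independently for each pair.\<close>

lemma mirror_normal_isomorphic:
  fixes A B :: "'g::group_add \<Rightarrow> ('k::field, 'n::{finite,linorder}) sqmat set"
  assumes "graded_UJ A" "graded_UJ B" and ids: "graded_identities A = graded_identities B"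
    and mA: "graded_UJ.mirror_normal A t" and mB: "graded_UJ.mirror_normal B t"
  shows "graded_isomorphic A B"
proof -
  interpret A: graded_UJ A by fact
  interpret B: graded_UJ B by fact
  obtain M where n: "CARD('n) = Suc (Suc M)" using A.card_eq by blast
  have t: "t \<noteq> 0" "t + t = 0" using mA by (auto simp: A.mirror_normal_def)
  \<comment> \<open>In the middle case \<open>l = M - l\<close> both terms are multiples of the same
    unit, with total coefficient \<open>a + b\<close>.\<close>
  define F where "F l a b = mscale a (E l (Suc l)) + mscale b (E (M - l) (Suc (M - l)) :: ('k, 'n) sqmat)" for l and a b :: 'k
  have entF: "ent (F l a b) i (Suc i) = (if i = l then a else 0) + (if i = M - l then b else 0)" if "l \<le> M" "i \<le> M" for l a b i
    using that n by (simp add: F_def)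
  have ep: "E i i + E (Suc M - i) (Suc M - i) \<in> A 0" "E i i - E (Suc M - i) (Suc M - i) \<in> A t"
    "E i i + E (Suc M - i) (Suc M - i) \<in> B 0" "E i i - E (Suc M - i) (Suc M - i) \<in> B t" if "i \<le> Suc M" for i
    using A.mirror_normalD[OF mA, of i "Suc M - i"] B.mirror_normalD[OF mB, of i "Suc M - i"] that n by auto

  have "\<exists>g a b. F l a b \<in> A g \<and> a \<noteq> 0 \<and> (l = M - l \<longrightarrow> a = b)" if l: "l \<le> M" for l
  proof -
    obtain g where "ent (pr A g (E l (Suc l))) l (Suc l) \<noteq> 0"
      using A.exists_component[of "E l (Suc l)" l "Suc l"] l n by auto
    moreover have "F l (ent (pr A g (E l (Suc l))) l (Suc l)) (ent (pr A g (E l (Suc l))) (M - l) (Suc (M - l))) \<in> A g"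
      unfolding F_def by (rule A.mirror_edge[OF mA n _ l]) (simp add: A.pr_spec(1))
    ultimately show ?thesis by metis
  qed
  then obtain g \<alpha> \<beta> where A: "\<And>l. l \<le> M \<Longrightarrow> F l (\<alpha> l) (\<beta> l) \<in> A (g l)" "\<And>l. l \<le> M \<Longrightarrow> \<alpha> l \<noteq> 0"
    "\<And>l. l \<le> M \<Longrightarrow> l = M - l \<Longrightarrow> \<alpha> l = \<beta> l" by metis

  text \<open>A vertex of the edge \<open>l\<close> which is not fixed by the reflection.\<close>
  define k where "k l = (if Suc M - l = l then Suc l else l)" for l
  define x where "x l = (if l \<le> M then F l (\<alpha> l) (\<beta> l) else 0)" for l
  define w where "w l = (if l \<le> M then E (k l) (k l) - E (Suc M - k l) (Suc M - k l) else 0 :: ('k, 'n) sqmat)" for l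
  define y where "y l = (if l \<le> Suc M then mscale (inverse 2) (E l l + E (Suc M - l) (Suc M - l)) else 0 :: ('k, 'n) sqmat)" for l
  define z where "z l = (if l \<le> Suc M then mscale (inverse 2) (E l l - E (Suc M - l) (Suc M - l)) else 0 :: ('k, 'n) sqmat)" for l
  have kM: "k l \<le> Suc M" if "l \<le> M" for l using that by (auto simp: k_def)
  have ent_X: "ent ((x l \<circ>\<^sub>J w l) \<circ>\<^sub>J w l - x l \<circ>\<^sub>J (w l \<circ>\<^sub>J w l)) b (Suc b)
    = - ((ent (w l) b b - ent (w l) (Suc b) (Suc b)) ^ 2 * ent (x l) b (Suc b))" if "b \<le> M" for l b
    by (rule ent_associator_diag) (use that n in \<open>auto simp: w_def\<close>)
  \<comment> \<open>The difference is 1 or -1, except on a middle edge joining two mirror vertices,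
    where it is 2.\<close>
  have w_diff: "ent (w l) l l - ent (w l) (Suc l) (Suc l) \<noteq> 0" if "l \<le> M" for l
    using that n A.two by (auto simp: w_def k_def)
  have "\<exists>X. (\<forall>l. X l \<in> B (g l)) \<and>
    ((\<forall>l\<le>M. ent (X l) l (Suc l) \<noteq> 0) \<or> (\<forall>l\<le>M. ent (X l) (M - l) (Suc (M - l)) \<noteq> 0))"
  proof (rule detector_transfer[OF ids assms(1,2) n t(2), of x g w y z])
    show "x l \<in> A (g l)" for l using A(1) by (simp add: x_def)
    show "w l \<in> A t" for l using ep(2)[OF kM] by (simp add: w_def)
    show "y l \<in> A 0" for l using ep(1) by (simp add: y_def A.A_mscale)
    show "z l \<in> A t" for l using ep(2) by (simp add: z_def A.A_mscale)
    show "y l + z l = E l l" for l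
    proof (cases "l \<le> Suc M")
      case True
      have "y l + z l = mscale (inverse 2) (E l l + E l l)"
        using True by (simp only: y_def z_def if_True flip: mat.scale_right_distrib) (simp add: algebra_simps)
      then show ?thesis by (simp only: half_double[OF A.two])
    next
      case False
      then show ?thesis using E_outside[of l, where 'n = 'n and 'k = 'k] n by (simp add: y_def z_def)
    qed
    show "ent ((x l \<circ>\<^sub>J w l) \<circ>\<^sub>J w l - x l \<circ>\<^sub>J (w l \<circ>\<^sub>J w l)) l (Suc l) \<noteq> 0" if "l \<le> M" for l
    proof -
      have "ent (x l) l (Suc l) \<noteq> 0"
        using that A(2,3)[OF that] A.two by (auto simp: x_def entF simp flip: mult_2)
      then show ?thesis unfolding ent_X[OF that] using w_diff[OF that] by simp
    qed
    show "ent ((x 0 \<circ>\<^sub>J w 0) \<circ>\<^sub>J w 0 - x 0 \<circ>\<^sub>J (w 0 \<circ>\<^sub>J w 0)) b (Suc b) = 0" if "0 < b" "b < M" for b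
      using ent_X[of b 0] that by (simp add: x_def entF)
  qed
  then obtain X where X: "\<And>l. X l \<in> B (g l)"
    "(\<forall>l\<le>M. ent (X l) l (Suc l) \<noteq> 0) \<or> (\<forall>l\<le>M. ent (X l) (M - l) (Suc (M - l)) \<noteq> 0)" by blast
  define \<gamma> \<delta> where "\<gamma> l = ent (X l) l (Suc l)" and "\<delta> l = ent (X l) (M - l) (Suc (M - l))" for l
  have B: "F l (\<gamma> l) (\<delta> l) \<in> B (g l)" if "l \<le> M" for l
    unfolding F_def \<gamma>_def \<delta>_def by (rule B.mirror_edge[OF mB n X(1) that])
  have \<beta>: "\<beta> l \<noteq> 0" if "l < M - l" for l
    using A.mirror_edge_both[OF mA n that, of "\<alpha> l" "\<beta> l" "g l"] A(1,2)[of l] that by (simp add: F_def)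
  have \<gamma>\<delta>: "\<gamma> l \<noteq> 0 \<and> \<delta> l \<noteq> 0" if "l < M - l" for l
  proof -
    have "\<gamma> l \<noteq> 0 \<or> \<delta> l \<noteq> 0" using X(2) that by (auto simp: \<gamma>_def \<delta>_def)
    moreover have "\<gamma> l = 0 \<longleftrightarrow> \<delta> l = 0"
      using B.mirror_edge_both[OF mB n that, of "\<gamma> l" "\<delta> l" "g l"] B[of l] that by (simp add: F_def)
    ultimately show ?thesis by blast
  qed
  have \<gamma>mid: "\<gamma> l \<noteq> 0 \<and> \<gamma> l = \<delta> l" if "l = M - l" "l \<le> M" for l
    using X(2) that by (metis \<gamma>_def \<delta>_def)

  text \<open>
    Conjugation by \<open>diag s\<close> multiplies \<open>E l (Suc l)\<close> by \<open>r l\<close>; the choice of \<open>r\<close> turns the ratio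
    \<open>\<delta> / \<gamma>\<close> into \<open>\<beta> / \<alpha>\<close> and leaves the first half of the superdiagonal unchanged.
  \<close>
  define r where "r l = (if l \<le> M - l then 1 else \<beta> (M - l) / \<alpha> (M - l) * (\<gamma> (M - l) / \<delta> (M - l)))" for l
  define s where "s i = (\<Prod>j\<in>{i..M}. r j)" for i
  have r0: "r l \<noteq> 0" if "l \<le> M" for l
  proof (cases "l \<le> M - l")
    case False
    then have "M - l < M - (M - l)" using that by auto
    then show ?thesis using \<beta>[of "M - l"] \<gamma>\<delta>[of "M - l"] A(2)[of "M - l"] False by (simp add: r_def)
  qed (simp add: r_def)
  have s0: "s i \<noteq> 0" for i using r0 by (simp add: s_def)
  have s_step: "s l = r l * s (Suc l)" if "l \<le> M" for l
    using that by (simp add: s_def prod.atLeast_Suc_atMost)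
  define P Q where "P = (mk (\<lambda>i j. if i = j then s i else 0) :: ('k, 'n) sqmat)"
    and "Q = (mk (\<lambda>i j. if i = j then inverse (s i) else 0) :: ('k, 'n) sqmat)"
  have dP: "ent P i j = 0" and dQ: "ent Q i j = 0" if "i < CARD('n)" "j < CARD('n)" "i \<noteq> j" for i j
    using that by (simp_all add: P_def Q_def)
  define \<phi> where "\<phi> a = P ** a ** Q" for a
  have ent\<phi>: "ent (\<phi> a) i j = s i * ent a i j * inverse (s j)" if "i < CARD('n)" "j < CARD('n)" for a i j
    using that by (simp add: \<phi>_def ent_diag_mult[OF dP] ent_diag_mult[OF dQ]) (simp add: P_def Q_def)
  have "UJ_automorphism (\<lambda>a. P ** a ** Q)"
  proof (rule automorphism_conj)
    show "P \<in> UJ" "Q \<in> UJ" by (auto simp: UJ_iff P_def Q_def)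
    show "P ** Q = mat 1"
    proof (rule mat_eqI)
      fix i j assume ij: "i < CARD('n)" "j < CARD('n)"
      have "ent (P ** Q) i j = ent P i i * ent Q i j"
        by (rule ent_diag_mult(1)[OF dP]) (use ij in auto)
      also have "\<dots> = ent (mat 1 :: ('k, 'n) sqmat) i j"
        using ij s0 by (simp add: P_def Q_def)
      finally show "ent (P ** Q) i j = ent (mat 1 :: ('k, 'n) sqmat) i j" .
    qed
  qed
  then have \<phi>: "UJ_automorphism \<phi>" by (simp add: \<phi>_def[abs_def])
  have \<phi>E: "\<phi> (E i i) = E i i" for i
    by (rule mat_eqI) (use s0 in \<open>auto simp: ent\<phi>\<close>)
  have \<phi>F: "\<phi> (F l a b) = F l (r l * a) (r (M - l) * b)" if l: "l \<le> M" for l a b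
  proof (rule mat_eqI)
    fix i j assume ij: "i < CARD('n)" "j < CARD('n)"
    have "s l * inverse (s (Suc l)) = r l" "s (M - l) * inverse (s (Suc (M - l))) = r (M - l)"
      using s_step[of l] s_step[of "M - l"] s0 l by simp_all
    then show "ent (\<phi> (F l a b)) i j = ent (F l (r l * a) (r (M - l) * b)) i j"
      using ij by (auto simp: ent\<phi> F_def algebra_simps)
  qed
  define C where "C = (\<lambda>g. \<phi> ` B g)"
  interpret C: graded_UJ C unfolding C_def by (rule B.graded_image[OF \<phi>])
  \<comment> \<open>In the first half \<open>r l = 1\<close>, so after scaling by
    \<open>\<alpha> l / \<gamma> l\<close> only the second coefficient has to be matched, through
    \<open>r (M - l)\<close>.\<close>
  have CF: "F l (\<alpha> l) (\<beta> l) \<in> C (g l)" if l: "l \<le> M - l" "l \<le> M" for l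
  proof -
    have "mscale (\<alpha> l / \<gamma> l) (\<phi> (F l (\<gamma> l) (\<delta> l))) \<in> C (g l)"
      using B[OF l(2)] by (intro C.A_mscale) (auto simp: C_def)
    also have "mscale (\<alpha> l / \<gamma> l) (\<phi> (F l (\<gamma> l) (\<delta> l))) = F l (\<alpha> l / \<gamma> l * \<gamma> l) (\<alpha> l / \<gamma> l * (r (M - l) * \<delta> l))"
      unfolding \<phi>F[OF l(2)] using l(1) by (simp add: r_def[of l] F_def mat.scale_right_distrib)
    also have "\<dots> = F l (\<alpha> l) (\<beta> l)"
    proof (cases "l = M - l")
      case True
      have "r (M - l) = 1" using True by (simp add: r_def)
      moreover have "\<gamma> l \<noteq> 0" "\<delta> l = \<gamma> l" "\<beta> l = \<alpha> l"
        using \<gamma>mid[OF True l(2)] A(3)[OF l(2) True] by auto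
      ultimately show ?thesis by simp
    next
      case False
      then have lt: "l < M - l" using l by simp
      then have "r (M - l) = \<beta> l / \<alpha> l * (\<gamma> l / \<delta> l)" by (simp add: r_def)
      then show ?thesis using \<gamma>\<delta>[OF lt] A(2)[OF l(2)] by simp
    qed
    finally show ?thesis .
  qed
  have "A = C"
  proof (rule common_generators_eq[OF assms(1) C.graded_UJ_axioms])
    let ?V = "mat.span (\<Union>g. A g \<inter> C g)"
    fix i assume "i < CARD('n)"
    then have i: "i \<le> Suc M" using n by simp
    have "\<phi> (E i i + E (Suc M - i) (Suc M - i)) = E i i + E (Suc M - i) (Suc M - i)"
      "\<phi> (E i i - E (Suc M - i) (Suc M - i)) = E i i - E (Suc M - i) (Suc M - i)"
      using automorphism_add[OF \<phi>] automorphism_diff[OF \<phi>] by (simp_all add: \<phi>E)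
    then have "E i i + E (Suc M - i) (Suc M - i) \<in> C 0" "E i i - E (Suc M - i) (Suc M - i) \<in> C t"
      using ep(3,4)[OF i] unfolding C_def by (metis image_eqI)+
    then have "E i i + E (Suc M - i) (Suc M - i) \<in> ?V" "E i i - E (Suc M - i) (Suc M - i) \<in> ?V"
      using ep(1,2)[OF i] by (auto intro!: mat.span_base)
    then have "mscale (inverse 2) ((E i i + E (Suc M - i) (Suc M - i)) + (E i i - E (Suc M - i) (Suc M - i))) \<in> ?V"
      by (rule mat.span_scale[OF mat.span_add])
    also have "(E i i + E (Suc M - i) (Suc M - i)) + (E i i - E (Suc M - i) (Suc M - i)) = E i i + (E i i :: ('k, 'n) sqmat)"
      by (simp add: algebra_simps)
    finally show "E i i \<in> ?V" by (simp only: half_double[OF A.two])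
  next
    let ?V = "mat.span (\<Union>g. A g \<inter> C g)"
    fix l assume "Suc l < CARD('n)"
    then have l: "l \<le> M" using n by simp
    \<comment> \<open>The representative of the edge pair of \<open>l\<close>; its element has
      nonzero entries on both edges of the pair.\<close>
    define m where "m = min l (M - l)"
    have m: "m \<le> M - m" "m \<le> M" "l = m \<or> l = M - m" using l by (auto simp: m_def)
    have "F m (\<alpha> m) (\<beta> m) \<in> ?V" using CF[OF m(1,2)] A(1)[OF m(2)] by (intro mat.span_base) auto
    moreover have "ent (F m (\<alpha> m) (\<beta> m)) l (Suc l) \<noteq> 0"
    proof (cases "m = M - m")
      case True
      then have "ent (F m (\<alpha> m) (\<beta> m)) l (Suc l) = 2 * \<alpha> m"
        using entF[OF m(2) l] m(3) A(3)[OF m(2) True] by simp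
      then show ?thesis using A(2)[OF m(2)] A.two by simp
    next
      case False
      then show ?thesis using entF[OF m(2) l] m A(2)[OF m(2)] \<beta>[of m] by auto
    qed
    ultimately show "\<exists>x\<in>?V. ent x l (Suc l) \<noteq> 0" by blast
  qed
  then have "graded_isomorphic B A" by (simp only: C_def graded_isomorphic_image[OF \<phi>])
  then show ?thesis by (rule graded_isomorphic_sym) (use B.A_UJ in blast)
qed

theorem theorem25:
  fixes A1 A2 :: "'g::group_add \<Rightarrow> ('k::field, 'n::{finite,linorder}) sqmat set"
  assumes "CHAR('k) \<noteq> 2"
    and "CARD('n) \<ge> 2"
    and "UJ_grading A1"
    and "UJ_grading A2"
  shows "graded_isomorphic A1 A2 \<longleftrightarrow> graded_identities A1 = graded_identities A2"
proof
  have two: "(2 :: 'k) \<noteq> 0"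
  proof
    assume "(2 :: 'k) = 0"
    then have "CHAR('k) dvd 2" by (metis of_nat_eq_0_iff_char_dvd of_nat_numeral)
    then have "CHAR('k) = 1 \<or> CHAR('k) = 2" using two_is_prime_nat by (auto simp: prime_nat_iff)
    then show False using assms(1) by simp
  qed
  interpret A: graded_UJ A1 using assms two by unfold_locales auto
  interpret B: graded_UJ A2 using assms two by unfold_locales auto
  { assume "graded_isomorphic A1 A2"
    then show "graded_identities A1 = graded_identities A2"
      by (rule graded_isomorphic_identities) (rule A.graded_UJ_axioms) }
  assume ids: "graded_identities A1 = graded_identities A2"
  \<comment> \<open>The degrees not contained in the radical are 0 alone or 0 and \<open>t\<close>,
    so the identities determine the type and \<open>t\<close>.\<close>
  have sub: "A1 g \<subseteq> J 1 \<longleftrightarrow> A2 g \<subseteq> J 1" for g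
    using identities_degree_nilpotent[OF ids A.graded_UJ_axioms B.graded_UJ_axioms, of g]
      identities_degree_nilpotent[OF ids[symmetric] B.graded_UJ_axioms A.graded_UJ_axioms, of g] by blast
  have transport: "graded_isomorphic A1 A2"
    if "UJ_automorphism \<phi>" "UJ_automorphism \<psi>" "graded_isomorphic (\<lambda>g. \<phi> ` A1 g) (\<lambda>g. \<psi> ` A2 g)" for \<phi> \<psi>
    using graded_isomorphic_trans[OF graded_isomorphic_trans[OF graded_isomorphic_image[OF that(1)] that(3)]
        graded_isomorphic_sym[OF graded_isomorphic_image[OF that(2)]]] B.A_UJ by blast
  have ids': "graded_identities (\<lambda>g. \<phi> ` A1 g) = graded_identities (\<lambda>g. \<psi> ` A2 g)"
    if "UJ_automorphism \<phi>" "UJ_automorphism \<psi>" for \<phi> \<psi>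
    using ids graded_isomorphic_identities[OF graded_isomorphic_image[OF that(1)] A.graded_UJ_axioms]
      graded_isomorphic_identities[OF graded_isomorphic_image[OF that(2)] B.graded_UJ_axioms] by simp
  consider "trivial_diagonal A1" | t where "mirror A1 t" using A.diagonal_dichotomy by blast
  then show "graded_isomorphic A1 A2"
  proof cases
    case 1
    then have "trivial_diagonal A2" using sub by (simp add: trivial_diagonal_def)
    then obtain \<psi> where \<psi>: "UJ_automorphism \<psi>" "\<forall>i<CARD('n). E i i \<in> \<psi> ` A2 0"
      using B.normalize_trivial by blast
    obtain \<phi> where \<phi>: "UJ_automorphism \<phi>" "\<forall>i<CARD('n). E i i \<in> \<phi> ` A1 0"
      using A.normalize_trivial[OF 1] by blast
    show ?thesis
      by (rule transport[OF \<phi>(1) \<psi>(1) trivial_normal_isomorphic[OF A.graded_image[OF \<phi>(1)] B.graded_image[OF \<psi>(1)]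
          ids'[OF \<phi>(1) \<psi>(1)]]]) (use \<phi>(2) \<psi>(2) in auto)
  next
    case (2 t)
    have nt: "\<not> A2 t \<subseteq> J 1" using A.mirror_not_J1[OF 2] sub by simp
    have t: "t \<noteq> 0" "t + t = 0" using 2 by (auto simp: mirror_def)
    have "\<not> trivial_diagonal A2" using nt t by (auto simp: trivial_diagonal_def)
    then obtain t' where t': "mirror A2 t'" using B.diagonal_dichotomy by blast
    then have "t' = t" using nt t by (auto simp: mirror_def)
    then obtain \<psi> where \<psi>: "UJ_automorphism \<psi>" "\<forall>i<CARD('n).
        E i i + E (CARD('n) - 1 - i) (CARD('n) - 1 - i) \<in> \<psi> ` A2 0 \<and>
        E i i - E (CARD('n) - 1 - i) (CARD('n) - 1 - i) \<in> \<psi> ` A2 t"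
      using B.normalize_mirror[OF t'] by blast
    obtain \<phi> where \<phi>: "UJ_automorphism \<phi>" "\<forall>i<CARD('n).
        E i i + E (CARD('n) - 1 - i) (CARD('n) - 1 - i) \<in> \<phi> ` A1 0 \<and>
        E i i - E (CARD('n) - 1 - i) (CARD('n) - 1 - i) \<in> \<phi> ` A1 t"
      using A.normalize_mirror[OF 2] by blast
    interpret A': graded_UJ "\<lambda>g. \<phi> ` A1 g" by (rule A.graded_image[OF \<phi>(1)])
    interpret B': graded_UJ "\<lambda>g. \<psi> ` A2 g" by (rule B.graded_image[OF \<psi>(1)])
    have "A'.mirror_normal t" "B'.mirror_normal t"
      using \<phi>(2) \<psi>(2) t by (simp_all add: A'.mirror_normal_def B'.mirror_normal_def)
    then show ?thesis
      by (rule transport[OF \<phi>(1) \<psi>(1) mirror_normal_isomorphic[OF A'.graded_UJ_axioms B'.graded_UJ_axioms ids'[OF \<phi>(1) \<psi>(1)]]])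
  qed
qed

end
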